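(* Let $k\ge2$ be an integer, and let $\alpha,\beta,\nu$ be complex numbers with $\mathrm{Re}(\sqrt\alpha)\ge\mathrm{Re}(\sqrt\beta)>0$ and $\mathrm{Re}(\nu)>0$. Then $$\sum_{n=1}^{\infty}r_k(n)\,I_{\nu}\big(\pi(\sqrt{n\alpha}-\sqrt{n\beta})\big)K_{\nu}\big(\pi(\sqrt{n\alpha}+\sqrt{n\beta})\big)$$ $$=-\frac{1}{2\nu}\left(\frac{\sqrt{\alpha}-\sqrt{\beta}}{\sqrt{\alpha}+\sqrt{\beta}}\right)^{\nu}+\frac{\Gamma\left(\nu+\frac{k}{2}\right)}{\pi^{\frac{k}{2}}2^{k-1}\Gamma(\nu+1)}\sum_{n=0}^{\infty}\frac{r_{k}(n)}{\sqrt{n+\alpha}\sqrt{n+\beta}}\left(\frac{\sqrt{n+\alpha}-\sqrt{n+\beta}}{\sqrt{n+\alpha}+\sqrt{n+\beta}}\right)^{\nu}\left(\frac{1}{\sqrt{n+\alpha}}+\frac{1}{\sqrt{n+\beta}}\right)^{k-2}$$ $$\times\,{}_2F_1\left(\nu+1-\tfrac{k}{2},\,1-\tfrac{k}{2};\,\nu+1;\,\left(\frac{\sqrt{n+\alpha}-\sqrt{n+\beta}}{\sqrt{n+\alpha}+\sqrt{n+\beta}}\right)^{2}\right).$$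
   Context: $r_k(n)$ is the number of representations of $n$ as a sum of $k$ squares of integers (different signs and different orders counted as distinct), with $r_k(0)=1$. $I_\nu$ and $K_\nu$ are the modified Bessel functions of the first and second kind of order $\nu$. Square roots and powers are principal values, and $0^\nu=0$ for $\mathrm{Re}(\nu)>0$. ${}_2F_1(a,b;c;z)=\sum_{n\ge0}\frac{(a)_n(b)_n}{(c)_n n!}z^n$ for $|z|<1$, where $(a)_0=1$ and $(a)_n=a(a+1)\cdots(a+n-1)$; it denotes the principal analytic continuation to $\mathbb{C}\setminus[1,\infty)$ otherwise. *)

theory Defs
  imports "HOL-Complex_Analysis.Complex_Analysis"
begin

definition sum_squares_reps :: "nat \<Rightarrow> nat \<Rightarrow> nat" where
  "sum_squares_reps k n = card {xs :: int list. length xs = k \<and> (\<Sum>x\<leftarrow>xs. x ^ 2) = int n}"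

text \<open>
  The case distinction gives the usual value 1 of the modified Bessel function of the first kind
  of order 0 at 0, because \<open>0 powr 0 = 0\<close> in HOL. The reciprocal Gamma function \<open>rGamma\<close> is
  entire, so negative integer orders are covered.
\<close>

definition Bessel_I :: "complex \<Rightarrow> complex \<Rightarrow> complex" where
  "Bessel_I \<nu> z = (if \<nu> = 0 then 1 else (z / 2) powr \<nu>) *
     (\<Sum>m. rGamma (\<nu> + of_nat m + 1) / fact m * (z / 2) ^ (2 * m))"

definition Bessel_K :: "complex \<Rightarrow> complex \<Rightarrow> complex" where
  "Bessel_K \<nu> z =
     (let Q = (\<lambda>\<mu>. of_real pi / 2 * (Bessel_I (- \<mu>) z - Bessel_I \<mu> z) / sin (\<mu> * of_real pi))
      in if \<nu> \<in> \<int> then Lim (at \<nu>) Q else Q \<nu>)"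

definition hyp2f1_series :: "complex \<Rightarrow> complex \<Rightarrow> complex \<Rightarrow> complex \<Rightarrow> complex" where
  "hyp2f1_series a b c z = (\<Sum>n. pochhammer a n * pochhammer b n / (pochhammer c n * fact n) * z ^ n)"

text \<open>
  By the identity theorem, all holomorphic extensions of the series to the plane cut along
  $[1,\infty)$ agree at every point of that domain (see \<open>hyp2f1_eqI\<close> below), so the description
  determines at most one value there. On the cut itself \<open>hyp2f1\<close> is unspecified.
\<close>

definition hyp2f1 :: "complex \<Rightarrow> complex \<Rightarrow> complex \<Rightarrow> complex \<Rightarrow> complex" where
  "hyp2f1 a b c z =
     (if norm z < 1 then hyp2f1_series a b c z
      else (THE w. \<exists>f. f holomorphic_on - (of_real ` {1..}) \<and>
                       (\<forall>u\<in>ball 0 1. f u = hyp2f1_series a b c u) \<and> w = f z))"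

lemma hyp2f1_eqI:
  assumes f: "f holomorphic_on - (of_real ` {1..})"
    and eq: "\<And>u. u \<in> ball 0 1 \<Longrightarrow> f u = hyp2f1_series a b c u"
    and z: "z \<notin> of_real ` {1..}"
  shows "hyp2f1 a b c z = f z"
proof (cases "norm z < 1")
  case True
  then show ?thesis using eq[of z] by (simp add: hyp2f1_def)
next
  case False
  let ?S = "- (of_real ` {1..}) :: complex set"
  have cl: "closed (of_real ` {1..} :: complex set)"
  proof -
    have "(of_real ` {1..} :: complex set) = {w. Re w \<ge> 1} \<inter> {w. Im w = 0}"
      by (auto simp: complex_eq_iff image_iff)
    moreover have "closed \<dots>"
      by (intro closed_Int closed_halfspace_Re_ge closed_Collect_eq continuous_intros)
    ultimately show ?thesis by simp
  qed
  have star: "starlike ?S"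
    unfolding starlike_def
  proof (intro bexI[of _ 0] ballI subsetI)
    fix x y :: complex
    assume x: "x \<in> ?S" and "y \<in> closed_segment 0 x"
    then obtain t where t: "0 \<le> t" "t \<le> 1" "y = of_real t * x"
      by (auto simp: in_segment scaleR_conv_of_real)
    show "y \<in> ?S"
    proof
      assume "y \<in> of_real ` {1..}"
      then obtain r where r: "r \<ge> 1" "of_real t * x = of_real r" using t by auto
      hence "t \<noteq> 0" by auto
      hence "x = of_real (r / t)" using r by (simp add: field_simps)
      moreover have "r / t \<ge> 1" using r t \<open>t \<noteq> 0\<close> by (simp add: field_simps)
      ultimately have "x \<in> of_real ` {1..}" by (metis atLeast_iff imageI)
      then show False using x by simp
    qed
  qed auto
  have sub: "ball 0 1 \<subseteq> ?S" by auto
  have uniq: "g z = f z"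
    if g: "g holomorphic_on ?S" "\<forall>u\<in>ball 0 1. g u = hyp2f1_series a b c u" for g
  proof -
    have gf: "g u = f u" if "u \<in> ball 0 1" for u
      using eq[OF that] g(2) that by metis
    show ?thesis
      by (rule analytic_continuation_open[of "ball 0 1" ?S g f z])
        (use cl starlike_imp_connected[OF star] g(1) f z gf sub in \<open>simp_all add: open_Compl\<close>)
  qed
  have "(THE w. \<exists>f. f holomorphic_on ?S \<and>
      (\<forall>u\<in>ball 0 1. f u = hyp2f1_series a b c u) \<and> w = f z) = f z"
  proof (rule the_equality)
    show "\<exists>g. g holomorphic_on ?S \<and> (\<forall>u\<in>ball 0 1. g u = hyp2f1_series a b c u) \<and> f z = g z"
      using f eq by blast
  qed (use uniq in blast)
  then show ?thesis using False by (simp add: hyp2f1_def)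
qed

end

theory Submission
  imports Defs "HOL-Probability.Characteristic_Functions" "HOL-Real_Asymp.Real_Asymp"
begin

text \<open>
  Write \<open>a\<close> and \<open>b\<close> for the square roots of \<open>\<alpha>\<close> and \<open>\<beta>\<close>, and \<open>L(s,x,y)\<close> for the integral
  of \<open>v powr (s - 1) * exp (- x * v - y / v)\<close> over \<open>v > 0\<close>, so that \<open>K\<^sub>s(z) = L(s,z/2,z/2) / 2\<close>.

  The arithmetic input is the inversion formula of the theta function. Its \<open>k\<close>-th power generates
  \<open>r\<^sub>k\<close>, so integrating \<open>theta (1/v) ^ k = v powr (k/2) * theta v ^ k\<close> against
  \<open>v powr (s - 1) * exp (- \<pi> * p * v)\<close> gives (\<open>theta_bessel_sums\<close>), for \<open>p > 0\<close> and \<open>Re s > 0\<close>,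
  that the sum of \<open>r\<^sub>k(n) * L(s, \<pi>p, \<pi>n)\<close> over \<open>n \<ge> 1\<close> equals \<open>\<Gamma>(s + k/2)\<close> times the sum of
  \<open>r\<^sub>k(n) * (\<pi>(n + p)) powr (- s - k/2)\<close> over \<open>n \<ge> 0\<close>, minus \<open>\<Gamma>(s) * (\<pi>p) powr (- s)\<close>.

  Let \<open>p = (a\<^sup>2 + b\<^sup>2) / 2\<close> and \<open>c = (a\<^sup>2 - b\<^sup>2) / 2\<close>. The product of Bessel functions in the \<open>n\<close>-th term
  on the left is a series in \<open>j\<close> of \<open>L(\<nu> + 2j, \<pi>p, \<pi>n)\<close> whose coefficients do not depend on \<open>n\<close>
  (\<open>Bessel_I_Bessel_K_sums\<close>). So the formula above can be applied for each \<open>j\<close>, and what remains are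
  two sums over \<open>j\<close> of the same shape, one for the exponent \<open>k/2\<close> and one for the exponent 0. A
  quadratic transformation (\<open>hyp2f1_quadratic\<close>) evaluates both as hypergeometric functions of the
  square of the quotient \<open>q\<close>. With exponent 0 the hypergeometric factor is 1, which gives the isolated
  term with \<open>1 / (2 * \<nu>)\<close>; with exponent \<open>k/2\<close> Euler's transformation (\<open>hyp2f1_euler\<close>) brings the
  result into the stated form.

  All these rearrangements converge absolutely if \<open>0 < b < a\<close> are real and close to each other
  (\<open>bessel_sum_identity_real\<close>). The general case follows by analytic continuation, first in \<open>a\<close> and
  then in \<open>b\<close>, and by continuity on the boundary \<open>Re a = Re b\<close>. This requires that no \<open>q\<close> meets the
  cut of the power function, that no \<open>q\<^sup>2\<close> meets the cut of the hypergeometric function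
  (\<open>qratio_cut\<close>, \<open>qratio_sq_cut\<close>), and that both series have locally uniform majorants (\<open>lterm_bound\<close>,
  \<open>rterm_bound\<close>). On the left, the exponential growth of \<open>I\<^sub>\<nu>(z)\<close> in \<open>Re z\<close> (\<open>bseries_bound\<close>) is beaten
  by the decay of \<open>K\<^sub>\<nu>\<close>, because the difference of the real parts of the two arguments is a positive
  multiple of \<open>sqrt n\<close>.
\<close>

section \<open>Series and integrals depending holomorphically on a parameter\<close>

lemma uniform_limit_suminf:
  fixes f :: "nat \<Rightarrow> 'a \<Rightarrow> complex"
  assumes "\<And>n x. n \<ge> N \<Longrightarrow> x \<in> A \<Longrightarrow> norm (f n x) \<le> g n" and "summable g"
  shows "uniform_limit A (\<lambda>n x. \<Sum>i<n. f i x) (\<lambda>x. \<Sum>i. f i x) sequentially"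
  using assms(1) by (intro Weierstrass_m_test_ev[OF _ assms(2)] eventually_sequentiallyI[of N]) auto

text \<open>
  The majorant has to work only from some index on, which may depend on the point like
  the majorant itself; this matches the asymptotic bounds to which the lemma is applied.
\<close>

lemma holomorphic_suminf:
  fixes f :: "nat \<Rightarrow> complex \<Rightarrow> complex"
  assumes S: "open S" and hol: "\<And>n. f n holomorphic_on S"
    and dom: "\<And>z. z \<in> S \<Longrightarrow> \<exists>r>0. \<exists>N g. summable g \<and> (\<forall>n\<ge>N. \<forall>w\<in>S. dist w z \<le> r \<longrightarrow> norm (f n w) \<le> g n)"
  shows "(\<lambda>z. \<Sum>n. f n z) holomorphic_on S"
proof (rule holomorphic_uniform_sequence[OF S])
  show "(\<lambda>z. \<Sum>i<n. f i z) holomorphic_on S" for n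
    using hol by (intro holomorphic_intros)
  fix z assume z: "z \<in> S"
  from dom[OF z] obtain r N g where rg: "r > 0" "summable g"
    "\<And>n w. n \<ge> N \<Longrightarrow> w \<in> S \<Longrightarrow> dist w z \<le> r \<Longrightarrow> norm (f n w) \<le> g n" by blast
  from S z obtain e where e: "e > 0" "cball z e \<subseteq> S" using open_contains_cball by blast
  let ?d = "min r e"
  have "uniform_limit (cball z ?d) (\<lambda>n x. \<Sum>i<n. f i x) (\<lambda>x. \<Sum>i. f i x) sequentially"
    by (rule uniform_limit_suminf[of N _ _ g]) (use rg e in \<open>auto simp: dist_commute subset_iff\<close>)
  then show "\<exists>d>0. cball z d \<subseteq> S \<and> uniform_limit (cball z d) (\<lambda>n z. \<Sum>i<n. f i z) (\<lambda>z. \<Sum>n. f n z) sequentially"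
    using rg(1) e by (intro exI[of _ ?d]) auto
qed

lemma continuous_on_suminf:
  fixes f :: "nat \<Rightarrow> complex \<Rightarrow> complex"
  assumes con: "\<And>n. continuous_on S (f n)"
    and dom: "\<And>z. z \<in> S \<Longrightarrow> \<exists>r>0. \<exists>N g. summable g \<and> (\<forall>n\<ge>N. \<forall>w\<in>S. dist w z \<le> r \<longrightarrow> norm (f n w) \<le> g n)"
  shows "continuous_on S (\<lambda>z. \<Sum>n. f n z)"
  unfolding continuous_on_eq_continuous_within
proof
  fix z assume z: "z \<in> S"
  from dom[OF z] obtain r N g where rg: "r > 0" "summable g"
    "\<And>n w. n \<ge> N \<Longrightarrow> w \<in> S \<Longrightarrow> dist w z \<le> r \<Longrightarrow> norm (f n w) \<le> g n" by blast
  let ?T = "S \<inter> ball z r"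
  have "uniform_limit ?T (\<lambda>n x. \<Sum>i<n. f i x) (\<lambda>x. \<Sum>i. f i x) sequentially"
    by (rule uniform_limit_suminf[of N _ _ g]) (use rg in \<open>auto simp: dist_commute\<close>)
  then have "continuous_on ?T (\<lambda>z. \<Sum>n. f n z)"
    by (rule uniform_limit_theorem[rotated])
       (auto intro!: always_eventually continuous_on_sum continuous_on_subset[OF con])
  then have "continuous (at z within ?T) (\<lambda>z. \<Sum>n. f n z)"
    using z rg(1) by (simp add: continuous_on_eq_continuous_within)
  moreover have "at z within ?T = at z within S"
    by (rule at_within_nhd[of _ "ball z r"]) (use rg(1) in auto)
  ultimately show "continuous (at z within S) (\<lambda>z. \<Sum>n. f n z)" by (simp add: continuous_within)
qed

text \<open>
  Cauchy's inequality turns the bound on \<open>f\<close> into the bound \<open>2 * g t / r\<close> on its derivative in the ball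
  of half the radius. So \<open>2 * g t / r\<close> also dominates the difference quotients, and the dominated
  convergence theorem applies along every sequence of increments.
\<close>

lemma has_field_derivative_integral:
  fixes f :: "complex \<Rightarrow> 'a \<Rightarrow> complex"
  assumes r: "r > 0"
    and hol: "\<And>t. (\<lambda>w. f w t) holomorphic_on ball z r"
    and meas: "\<And>w. w \<in> ball z r \<Longrightarrow> f w \<in> borel_measurable M"
    and int: "integrable M g"
    and dom: "\<And>w t. w \<in> ball z r \<Longrightarrow> norm (f w t) \<le> g t"
    and der: "\<And>t. ((\<lambda>w. f w t) has_field_derivative f' t) (at z)"
  shows "((\<lambda>w. LINT t|M. f w t) has_field_derivative (LINT t|M. f' t)) (at z)"
    and "integrable M f'"
proof -
  have fint: "integrable M (f w)" if "w \<in> ball z r" for w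
    using meas[OF that] dom[OF that] by (intro Bochner_Integration.integrable_bound[OF int]) (auto intro!: AE_I2 order.trans[OF _ abs_ge_self])
  have lip: "norm (f w t - f z t) \<le> (2 * g t / r) * norm (w - z)" if w: "w \<in> ball z (r/2)" for w t
  proof (rule field_differentiable_bound[where S = "ball z (r/2)" and f' = "deriv (\<lambda>w. f w t)"])
    fix u assume u: "u \<in> ball z (r/2)"
    have sub: "cball u (r/2) \<subseteq> ball z r"
    proof
      fix x assume "x \<in> cball u (r/2)"
      then show "x \<in> ball z r" using u dist_triangle[of z x u] by (simp add: dist_commute)
    qed
    have uin: "u \<in> ball z r"
      using sub r by (meson centre_in_cball half_gt_zero less_imp_le subsetD)
    show "((\<lambda>w. f w t) has_field_derivative deriv (\<lambda>w. f w t) u) (at u within ball z (r/2))"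
      by (rule has_field_derivative_at_within, rule holomorphic_derivI[of _ "ball z r"])
        (use hol uin in simp_all)
    have "norm ((deriv ^^ 1) (\<lambda>w. f w t) u) \<le> (fact 1) * g t / (r/2) ^ 1"
    proof (rule Cauchy_inequality)
      show "(\<lambda>w. f w t) holomorphic_on ball u (r/2)"
        by (rule holomorphic_on_subset[OF hol order_trans[OF ball_subset_cball sub]])
      show "continuous_on (cball u (r/2)) (\<lambda>w. f w t)"
        by (rule holomorphic_on_imp_continuous_on[OF holomorphic_on_subset[OF hol sub]])
      show "norm (f x t) \<le> g t" if "norm (u - x) = r/2" for x
        by (intro dom subsetD[OF sub]) (simp add: dist_norm that)
    qed (use r in auto)
    then show "norm (deriv (\<lambda>w. f w t) u) \<le> 2 * g t / r" by (simp add: mult.commute)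
  qed (use w r in auto)
  have lim: "(\<lambda>n. LINT t|M. (f (z + h n) t - f z t) / h n) \<longlonglongrightarrow> (LINT t|M. f' t) \<and> integrable M f'"
    if h: "h \<longlonglongrightarrow> 0" "\<And>n. h n \<noteq> 0" "\<And>n. norm (h n) < r/2" for h
  proof -
    have zin: "z + h n \<in> ball z (r/2)" "z + h n \<in> ball z r" for n
      using h(3)[of n] r by (auto simp: dist_norm)
    have m: "(\<lambda>t. (f (z + h n) t - f z t) / h n) \<in> borel_measurable M" for n
      using meas[OF zin(2)] meas[of z] r by auto
    have p: "(\<lambda>n. (f (z + h n) t - f z t) / h n) \<longlonglongrightarrow> f' t" for t
      using der[of t] h(1,2) unfolding DERIV_def tendsto_at_iff_sequentially o_def by auto
    have fm: "f' \<in> borel_measurable M"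
      by (rule borel_measurable_LIMSEQ_metric[of _ M, OF m p])
    have b: "norm ((f (z + h n) t - f z t) / h n) \<le> 2 * g t / r" for n t
      using lip[OF zin(1)[of n], of t] h(2)[of n] by (simp add: norm_divide field_simps)
    have gi: "integrable M (\<lambda>t. 2 * g t / r)" using int by auto
    show ?thesis
      using integral_dominated_convergence[OF fm m gi AE_I2[OF p] AE_I2[OF b]]
        integrable_dominated_convergence[OF fm m gi AE_I2[OF p] AE_I2[OF b]] by auto
  qed
  have "(\<lambda>n. r / 4 * inverse (real (Suc n))) \<longlonglongrightarrow> r / 4 * 0"
    by (intro tendsto_intros LIMSEQ_inverse_real_of_nat)
  then have h0: "(\<lambda>n. of_real (r / 4 / real (Suc n)) :: complex) \<longlonglongrightarrow> 0"
    using tendsto_of_real[of "\<lambda>n. r / 4 * inverse (real (Suc n))" 0] by (simp only: mult_zero_right of_real_0 divide_inverse)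
  have "norm (of_real (r / 4 / real (Suc n)) :: complex) < r / 2" for n
  proof -
    have "r / 4 / real (Suc n) \<le> r / 4" "r / 4 / real (Suc n) > 0"
      using r by (simp_all add: field_simps)
    then show ?thesis using r by (simp only: norm_of_real abs_of_pos)
  qed
  then show "integrable M f'" using lim[OF h0] r by (auto simp del: of_nat_Suc)
  show "((\<lambda>w. LINT t|M. f w t) has_field_derivative (LINT t|M. f' t)) (at z)"
    unfolding DERIV_def tendsto_at_iff_sequentially o_def
  proof (intro allI impI)
    fix h :: "nat \<Rightarrow> complex" assume h: "\<forall>i. h i \<in> UNIV - {0}" "h \<longlonglongrightarrow> 0"
    obtain N where N: "\<And>n. n \<ge> N \<Longrightarrow> norm (h n) < r/2"
      using tendstoD[OF h(2), of "r/2"] r by (auto simp: eventually_sequentially)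
    define k where "k = (\<lambda>n. h (n + N))"
    have k: "k \<longlonglongrightarrow> 0" "\<And>n. k n \<noteq> 0" "\<And>n. norm (k n) < r/2"
      using LIMSEQ_ignore_initial_segment[OF h(2), of N] h(1) N by (auto simp: k_def)
    have "(LINT t|M. (f (z + k n) t - f z t) / k n) = ((LINT t|M. f (z + k n) t) - (LINT t|M. f z t)) / k n" for n
    proof -
      have "z + k n \<in> ball z r" using k(3)[of n] r by (auto simp: dist_norm)
      then show ?thesis using fint[of "z + k n"] fint[of z] r by simp
    qed
    then have "(\<lambda>n. ((LINT t|M. f (z + k n) t) - (LINT t|M. f z t)) / k n) \<longlonglongrightarrow> (LINT t|M. f' t)"
      using lim[OF k] by (simp only:)
    then show "(\<lambda>n. ((LINT t|M. f (z + h n) t) - (LINT t|M. f z t)) / h n) \<longlonglongrightarrow> (LINT t|M. f' t)"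
      unfolding k_def by (rule LIMSEQ_offset)
  qed
qed

lemma norm_integral_le:
  fixes f :: "'a \<Rightarrow> complex"
  assumes "integrable M g" "\<And>t. norm (f t) \<le> g t"
  shows "norm (integral\<^sup>L M f) \<le> integral\<^sup>L M g"
proof -
  have "norm (integral\<^sup>L M f) \<le> (LINT t|M. norm (f t))" by (rule integral_norm_bound)
  also have "\<dots> \<le> integral\<^sup>L M g"
    using assms order_trans[OF norm_ge_zero assms(2)] by (intro integral_mono') auto
  finally show ?thesis .
qed

lemma holomorphic_integral:
  fixes f :: "complex \<Rightarrow> 'a \<Rightarrow> complex"
  assumes S: "open S"
    and hol: "\<And>t. (\<lambda>w. f w t) holomorphic_on S"
    and meas: "\<And>w. w \<in> S \<Longrightarrow> f w \<in> borel_measurable M"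
    and dom: "\<And>z. z \<in> S \<Longrightarrow> \<exists>r>0. \<exists>g. integrable M g \<and> (\<forall>w\<in>S. dist w z < r \<longrightarrow> (\<forall>t. norm (f w t) \<le> g t))"
  shows "(\<lambda>w. LINT t|M. f w t) holomorphic_on S"
proof -
  have "\<exists>f'. ((\<lambda>w. LINT t|M. f w t) has_field_derivative f') (at z)" if z: "z \<in> S" for z
  proof -
    from dom[OF z] obtain r g where rg: "r > 0" "integrable M g"
      "\<And>w t. w \<in> S \<Longrightarrow> dist w z < r \<Longrightarrow> norm (f w t) \<le> g t" by blast
    from S z obtain e where e: "e > 0" "ball z e \<subseteq> S" using open_contains_ball by blast
    have "((\<lambda>w. LINT t|M. f w t) has_field_derivative (LINT t|M. deriv (\<lambda>w. f w t) z)) (at z)"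
    proof (rule has_field_derivative_integral(1)[of "min r e" f z M g])
      show "min r e > 0" using rg e by auto
      show "(\<lambda>w. f w t) holomorphic_on ball z (min r e)" for t
        using e by (intro holomorphic_on_subset[OF hol]) auto
      show "f w \<in> borel_measurable M" if "w \<in> ball z (min r e)" for w
        using that e by (intro meas) auto
      show "norm (f w t) \<le> g t" if "w \<in> ball z (min r e)" for w t
        using that e by (intro rg) (auto simp: dist_commute)
      show "((\<lambda>w. f w t) has_field_derivative deriv (\<lambda>w. f w t) z) (at z)" for t
        by (rule holomorphic_derivI[OF hol S z])
    qed fact
    then show ?thesis by blast
  qed
  then show ?thesis using S by (auto simp: holomorphic_on_open)
qed

text \<open>
  The identity theorem: every point of a real interval is a limit point of the interval.
\<close>

lemma holomorphic_eq_from_reals: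
  assumes "f holomorphic_on S" "g holomorphic_on S" "open S" "connected S"
    and "a < b" "of_real ` {a<..<b} \<subseteq> S"
    and eq: "\<And>x. a < x \<Longrightarrow> x < b \<Longrightarrow> f (of_real x) = g (of_real x)"
    and "w \<in> S"
  shows "f w = (g w :: complex)"
proof -
  let ?c = "(a + b) / 2"
  have c: "complex_of_real ?c \<in> S" using assms(5,6) by (intro subsetD[OF assms(6)] imageI) auto
  have "?c islimpt {a<..<b}" using assms(5) by (intro interior_limit_point) simp
  then have "complex_of_real ?c islimpt of_real ` {a<..<b}"
    unfolding islimpt_approachable
  proof (intro allI impI)
    fix e :: real assume "\<forall>e>0. \<exists>x'\<in>{a<..<b}. x' \<noteq> ?c \<and> dist x' ?c < e" "e > 0"
    then obtain x' where x': "x' \<in> {a<..<b}" "x' \<noteq> ?c" "dist x' ?c < e" by blast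
    have "dist (complex_of_real x') (of_real ?c) = dist x' ?c"
      unfolding dist_norm of_real_diff[symmetric] norm_of_real by (simp add: dist_real_def)
    then show "\<exists>x'\<in>complex_of_real ` {a<..<b}. x' \<noteq> of_real ?c \<and> dist x' (of_real ?c) < e"
      using x' by (intro bexI[of _ "of_real x'"]) (simp_all only: of_real_eq_iff imageI simp_thms)
  qed
  have "(\<lambda>z. f z - g z) w = 0"
    by (rule analytic_continuation[of "\<lambda>z. f z - g z" S "of_real ` {a<..<b}" "of_real ?c"])
       (use assms c \<open>complex_of_real ?c islimpt _\<close> in \<open>auto intro!: holomorphic_intros\<close>)
  then show ?thesis by simp
qed

section \<open>An integral for the modified Bessel function of the second kind\<close>

text \<open>
  For \<open>Re x > 0\<close> and \<open>Re y > 0\<close>, \<open>mint s x y\<close> is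
  \<open>2 * (y / x) powr (s / 2) * K\<^sub>s (2 * sqrt (x * y))\<close>, which is entire in \<open>s\<close>; for \<open>y = 0\<close> and
  \<open>Re s > 0\<close> it is a Gamma integral. The power of \<open>v\<close> is written as an exponential, which makes the
  norm and the derivatives of the kernel immediate. The real versions \<open>rker\<close> and \<open>rint\<close> serve as
  majorants.
\<close>

definition mker :: "complex \<Rightarrow> complex \<Rightarrow> complex \<Rightarrow> real \<Rightarrow> complex" where
  "mker s x y v = (if v > 0 then exp ((s - 1) * of_real (ln v) - x * of_real v - y / of_real v) else 0)"

definition mint :: "complex \<Rightarrow> complex \<Rightarrow> complex \<Rightarrow> complex" where
  "mint s x y = (LINT v|lborel. mker s x y v)"

definition rker :: "real \<Rightarrow> real \<Rightarrow> real \<Rightarrow> real \<Rightarrow> real" where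
  "rker s x y v = (if v > 0 then exp ((s - 1) * ln v - x * v - y / v) else 0)"

definition rint :: "real \<Rightarrow> real \<Rightarrow> real \<Rightarrow> real" where
  "rint s x y = (LINT v|lborel. rker s x y v)"

lemma mker_measurable [measurable]: "mker s x y \<in> borel_measurable borel"
  unfolding mker_def by measurable

lemma mker_outside: "\<not> v > 0 \<Longrightarrow> mker s x y v = 0"
  by (simp add: mker_def)

lemma rker_measurable [measurable]: "rker s x y \<in> borel_measurable borel"
  unfolding rker_def by measurable

lemma norm_mker: "norm (mker s x y v) = rker (Re s) (Re x) (Re y) v"
  by (simp add: mker_def rker_def norm_exp_eq_Re)

lemma mker_of_real: "mker (of_real s) (of_real x) (of_real y) v = of_real (rker s x y v)"
  by (simp add: mker_def rker_def flip: exp_of_real)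

lemma mint_of_real: "mint (of_real s) (of_real x) (of_real y) = of_real (rint s x y)"
  by (simp add: mint_def rint_def mker_of_real)

lemma rker_nonneg: "rker s x y v \<ge> 0"
  by (simp add: rker_def)

lemma rker_mono: "x' \<le> x \<Longrightarrow> y' \<le> y \<Longrightarrow> rker s x y v \<le> rker s x' y' v"
  by (auto simp: rker_def intro!: diff_mono mult_right_mono divide_right_mono)

lemma rint_nonneg: "rint s x y \<ge> 0"
  unfolding rint_def by (intro integral_nonneg_AE AE_I2 rker_nonneg)

lemma mint_scale:
  assumes "l > 0"
  shows "mint s x y = exp (s * of_real (ln l)) * mint s (of_real l * x) (y / of_real l)"
proof -
  have "mint s x y = \<bar>l\<bar> *\<^sub>R (LINT v|lborel. mker s x y (0 + l * v))"
    unfolding mint_def using assms by (intro lborel_integral_real_affine) auto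
  also have "(\<lambda>v. mker s x y (0 + l * v)) = (\<lambda>v. exp ((s - 1) * of_real (ln l)) * mker s (of_real l * x) (y / of_real l) v)"
    using assms by (auto simp: mker_def fun_eq_iff ln_mult zero_less_mult_iff algebra_simps simp flip: exp_add)
  also have "\<bar>l\<bar> *\<^sub>R (LINT v|lborel. exp ((s - 1) * of_real (ln l)) * mker s (of_real l * x) (y / of_real l) v)
     = exp (of_real (ln l)) * exp ((s - 1) * of_real (ln l)) * mint s (of_real l * x) (y / of_real l)"
    using assms by (simp add: mint_def scaleR_conv_of_real exp_of_real)
  finally show ?thesis by (simp add: algebra_simps flip: exp_add)
qed

lemma rker_integrable0:
  assumes "s > 0" "x > 0" shows "integrable lborel (rker s x 0)"
proof -
  have "(\<lambda>t. complex_of_real t powr (of_real s - 1) / of_real (exp (x * t))) absolutely_integrable_on {0<..}"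
    using absolutely_integrable_Gamma_integral[of "of_real s" x] assms by simp
  then have "integrable lebesgue (\<lambda>t. norm (indicator {0<..} t *\<^sub>R (complex_of_real t powr (of_real s - 1) / of_real (exp (x * t)))))"
    unfolding set_integrable_def by (rule integrable_norm)
  also have "(\<lambda>t. norm (indicator {0<..} t *\<^sub>R (complex_of_real t powr (of_real s - 1) / of_real (exp (x * t))))) = rker s x 0"
    by (auto simp: rker_def fun_eq_iff indicator_def norm_divide norm_powr_real_powr powr_def exp_diff)
  finally show ?thesis by (subst (asm) integrable_completion) auto
qed

lemma mint_gamma:
  assumes "Re s > 0" "x > 0" shows "mint s (of_real x) 0 = Gamma s * of_real x powr (- s)"
proof -
  have i: "integrable lborel (mker s 1 0)"
    by (rule Bochner_Integration.integrable_bound[OF rker_integrable0[of "Re s" 1]]) (use assms in \<open>auto simp: norm_mker rker_nonneg\<close>)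
  have e: "(\<lambda>t. indicator {0<..} t *\<^sub>R (complex_of_real t powr (s - 1) / of_real (exp t))) = mker s 1 0"
    by (auto simp: mker_def fun_eq_iff indicator_def powr_def exp_diff exp_of_real Ln_of_real)
  have "((\<lambda>t. indicator {0<..} t *\<^sub>R (complex_of_real t powr (s - 1) / of_real (exp t))) has_integral Gamma s) UNIV"
    using iffD2[OF has_integral_restrict_UNIV Gamma_integral_complex'[OF assms(1)]]
    by (rule has_integral_eq[rotated]) (auto simp: indicator_def)
  then have "(mker s 1 0 has_integral Gamma s) UNIV" unfolding e .
  moreover have "(mker s 1 0 has_integral mint s 1 0) UNIV"
    unfolding mint_def by (rule has_integral_integral_lborel[OF i])
  ultimately have "mint s 1 0 = Gamma s" by (rule has_integral_unique[symmetric])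
  then show ?thesis
    using mint_scale[of "1/x" s "of_real x" 0] assms
    by (simp add: powr_def Ln_of_real ln_div)
qed

text \<open>
  A single term of the exponential series shows \<open>exp (y / v) \<ge> (y / v) ^ N / fact N\<close>. The resulting
  power of \<open>y\<close> in the denominator is the decay in \<open>y\<close> that makes the series over \<open>n\<close> converge.
\<close>

lemma rker_le_power:
  assumes y: "y > 0"
  shows "rker s x y v \<le> fact N / y ^ N * rker (s + real N) x 0 v"
proof (cases "v > 0")
  case True
  have "(y / v) ^ N / fact N \<le> exp (y / v)"
    using True y sum_le_suminf[OF summable_exp_generic, of "{N}" "y / v"]
    by (simp add: exp_def divide_simps mult.commute zero_le_divide_iff)
  then have b: "exp (- (y / v)) \<le> fact N / y ^ N * v ^ N"
    using True y by (simp add: exp_minus field_simps power_divide)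
  have "rker s x y v = exp ((s - 1) * ln v - x * v) * exp (- (y / v))"
    using True by (simp add: rker_def flip: exp_add)
  also have "\<dots> \<le> exp ((s - 1) * ln v - x * v) * (fact N / y ^ N * v ^ N)"
    using b by (intro mult_left_mono) auto
  also have "v ^ N = exp (real N * ln v)"
    using True by (simp add: exp_of_nat_mult)
  also have "exp ((s - 1) * ln v - x * v) * (fact N / y ^ N * exp (real N * ln v)) = fact N / y ^ N * rker (s + real N) x 0 v"
    using True by (simp add: rker_def algebra_simps flip: exp_add)
  finally show ?thesis .
qed (simp add: rker_def)

lemma rker_integrable:
  assumes "x > 0" "y > 0" shows "integrable lborel (rker s x y)"
proof -
  obtain N :: nat where N: "real N > - s" using reals_Archimedean2 by blast
  show ?thesis
    by (intro Bochner_Integration.integrable_bound[OF integrable_mult_right[OF rker_integrable0[of "s + N" x], of "fact N / y ^ N"]])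
       (use N assms rker_le_power in \<open>auto simp: rker_nonneg intro!: order.trans[OF _ abs_ge_self]\<close>)
qed

lemma rint_le_power:
  assumes "x > 0" "y > 0" "s + real N > 0"
  shows "rint s x y \<le> fact N / y ^ N * rint (s + real N) x 0"
proof -
  have "rint s x y \<le> (LINT v|lborel. fact N / y ^ N * rker (s + real N) x 0 v)"
    unfolding rint_def using assms
    by (intro integral_mono rker_integrable integrable_mult_right rker_integrable0 rker_le_power) auto
  then show ?thesis by (simp add: rint_def)
qed

lemma rker_integrable_or:
  assumes "x > 0" "y > 0 \<or> y = 0 \<and> s > 0" shows "integrable lborel (rker s x y)"
  using assms rker_integrable rker_integrable0 by blast

lemma mker_integrable:
  assumes "Re x > 0" "Re y > 0 \<or> Re y = 0 \<and> Re s > 0" shows "integrable lborel (mker s x y)"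
  by (rule Bochner_Integration.integrable_bound[OF rker_integrable_or[OF assms]]) (auto simp: norm_mker rker_nonneg)

lemma norm_mint_le:
  assumes "Re x > 0" "Re y > 0 \<or> Re y = 0 \<and> Re s > 0"
  shows "norm (mint s x y) \<le> rint (Re s) (Re x) (Re y)"
  unfolding mint_def rint_def norm_mker[symmetric] by (rule integral_norm_bound)

lemma rint_mono:
  assumes "x' \<le> x" "y' \<le> y" "x' > 0" "y' > 0 \<or> y' = 0 \<and> s > 0"
  shows "rint s x y \<le> rint s x' y'"
  unfolding rint_def
  by (intro integral_mono rker_integrable_or rker_mono) (use assms in auto)

lemma rint_gamma: "s > 0 \<Longrightarrow> x > 0 \<Longrightarrow> rint s x 0 = Gamma s * x powr (- s)"
proof -
  assume "s > 0" "x > 0"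
  then have "complex_of_real (rint s x 0) = of_real (Gamma s * x powr (- s))"
    using mint_gamma[of "of_real s" x] mint_of_real[of s x 0]
    by (simp add: Gamma_complex_of_real powr_of_real flip: of_real_minus)
  then show ?thesis by (simp only: of_real_eq_iff)
qed

text \<open>
  For \<open>\<bar>d\<bar> \<le> 1\<close> the power \<open>v powr d\<close> is at most \<open>v\<close> or at most \<open>1 / v\<close>. This gives one majorant for all
  small changes of the order.
\<close>

lemma rker_shift_le:
  assumes "\<bar>d\<bar> \<le> 1" shows "rker (s + d) x y v \<le> rker (s + 1) x y v + rker (s - 1) x y v"
proof (cases "v > 0")
  case True
  have "d * ln v \<le> \<bar>ln v\<bar>" using assms mult_right_mono[of "\<bar>d\<bar>" 1 "\<bar>ln v\<bar>"] by (simp add: abs_mult[symmetric])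
  then have "(s + d - 1) * ln v - x * v - y / v \<le> (s + 1 - 1) * ln v - x * v - y / v
    \<or> (s + d - 1) * ln v - x * v - y / v \<le> (s - 1 - 1) * ln v - x * v - y / v"
    by (auto simp: algebra_simps abs_if split: if_splits)
  then show ?thesis using True
    by (auto simp: rker_def intro: add_increasing add_increasing2)
qed (simp add: rker_def)

text \<open>
  Varying all three arguments along a common line covers the derivatives in the order and in
  the arguments by one domination argument.
\<close>

lemma mint_affine_deriv:
  fixes s x y s' x' y' :: complex
  assumes "Re x > 0" "Re y > 0"
  defines "D \<equiv> \<lambda>v. mker s x y v * (s' * of_real (ln v) - x' * of_real v - y' / of_real v)"
  shows "((\<lambda>w. mint (s + w * s') (x + w * x') (y + w * y')) has_field_derivative (LINT v|lborel. D v)) (at 0)"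
    and "integrable lborel D"
proof -
  \<comment> \<open>Within this radius the order moves by at most 1 and the real parts of the arguments at least keep half their size.\<close>
  define r where "r = min (1 / (1 + norm s')) (min (Re x / 2 / (1 + norm x')) (Re y / 2 / (1 + norm y')))"
  have r: "r > 0" unfolding r_def using assms by (auto intro!: divide_pos_pos add_pos_nonneg)
  have rb: "r * norm s' \<le> 1" "r * norm x' \<le> Re x / 2" "r * norm y' \<le> Re y / 2"
  proof -
    have *: "r * norm u \<le> c" if "r \<le> c / (1 + norm u)" "c > 0" for u :: complex and c
    proof -
      have "r * norm u \<le> r * (1 + norm u)" using r by (simp add: algebra_simps)
      also have "\<dots> \<le> c" using that by (simp add: pos_le_divide_eq add_pos_nonneg)
      finally show ?thesis .
    qed
    show "r * norm s' \<le> 1" "r * norm x' \<le> Re x / 2" "r * norm y' \<le> Re y / 2"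
      by (rule *; use assms in \<open>simp add: r_def\<close>)+
  qed
  define g where "g = (\<lambda>v. rker (Re s + 1) (Re x / 2) (Re y / 2) v + rker (Re s - 1) (Re x / 2) (Re y / 2) v)"
  have gi: "integrable lborel g"
    unfolding g_def using assms by (intro Bochner_Integration.integrable_add rker_integrable) auto
  define f where "f = (\<lambda>w. mker (s + w * s') (x + w * x') (y + w * y'))"
  have dom: "norm (f w v) \<le> g v" if w: "w \<in> ball 0 r" for w v
  proof -
    have b: "\<bar>Re (w * u)\<bar> \<le> r * norm u" for u
      using abs_Re_le_cmod[of "w * u"] w mult_right_mono[of "norm w" r "norm u"] by (simp add: norm_mult)
    have "norm (f w v) = rker (Re s + Re (w * s')) (Re x + Re (w * x')) (Re y + Re (w * y')) v"
      unfolding f_def norm_mker by simp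
    also have "\<dots> \<le> rker (Re s + Re (w * s')) (Re x / 2) (Re y / 2) v"
      using b[of x'] b[of y'] rb by (intro rker_mono) linarith+
    also have "\<dots> \<le> g v" unfolding g_def
      using b[of s'] rb by (intro rker_shift_le) linarith
    finally show ?thesis .
  qed
  have der: "((\<lambda>w. f w v) has_field_derivative D v) (at 0)" for v
    unfolding f_def D_def mker_def by (cases "v > 0") (auto intro!: derivative_eq_intros simp: algebra_simps)
  have hol: "(\<lambda>w. f w v) holomorphic_on ball 0 r" for v
    unfolding f_def mker_def by (cases "v > 0") (auto intro!: holomorphic_intros)
  have meas: "f w \<in> borel_measurable lborel" for w unfolding f_def by measurable
  have "((\<lambda>w. LINT v|lborel. f w v) has_field_derivative (LINT v|lborel. D v)) (at 0) \<and> integrable lborel D"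
    using has_field_derivative_integral[OF r hol meas gi dom der] by blast
  then show "((\<lambda>w. mint (s + w * s') (x + w * x') (y + w * y')) has_field_derivative (LINT v|lborel. D v)) (at 0)"
    and "integrable lborel D" unfolding mint_def f_def by auto
qed

lemma mint_deriv:
  assumes "Re x > 0" "Re y > 0"
  shows "((\<lambda>w. mint s (x + w * x') (y + w * y')) has_field_derivative
           (- x' * mint (s + 1) x y - y' * mint (s - 1) x y)) (at 0)"
proof -
  have "(\<lambda>v. mker s x y v * (0 * of_real (ln v) - x' * of_real v - y' / of_real v)) =
      (\<lambda>v. - x' * mker (s + 1) x y v - y' * mker (s - 1) x y v)"
  proof
    fix v :: real
    show "mker s x y v * (0 * of_real (ln v) - x' * of_real v - y' / of_real v) = - x' * mker (s + 1) x y v - y' * mker (s - 1) x y v"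
    proof (cases "v > 0")
      case True
      have *: "complex_of_real v = exp (of_real (ln v))" using True by (simp add: exp_of_real)
      have "mker (s + 1) x y v = mker s x y v * of_real v"
        using True unfolding mker_def by (subst (5) *) (simp add: algebra_simps flip: exp_add)
      moreover have "mker (s - 1) x y v * of_real v = mker s x y v"
        using True unfolding mker_def by (subst (3) *) (simp add: algebra_simps flip: exp_add)
      ultimately show ?thesis using True by (simp add: field_simps)
    qed (simp add: mker_def)
  qed
  then have "(LINT v|lborel. mker s x y v * (0 * of_real (ln v) - x' * of_real v - y' / of_real v)) =
      - x' * mint (s + 1) x y - y' * mint (s - 1) x y"
    using assms by (simp add: mint_def mker_integrable)
  then show ?thesis using mint_affine_deriv(1)[OF assms, of s 0 x' y'] by simp
qed

lemma mint_holomorphic_order: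
  assumes "Re x > 0" "Re y > 0"
  shows "(\<lambda>s. mint s x y) holomorphic_on A"
proof -
  have "((\<lambda>s. mint s x y) has_field_derivative (LINT v|lborel. mker s x y v * (1 * of_real (ln v) - 0 * of_real v - 0 / of_real v))) (at s)" for s
  proof -
    have "((\<lambda>w. mint (s + w * 1) (x + w * 0) (y + w * 0)) has_field_derivative
      (LINT v|lborel. mker s x y v * (1 * of_real (ln v) - 0 * of_real v - 0 / of_real v))) (at 0)"
      by (rule mint_affine_deriv(1)[OF assms])
    then show ?thesis using DERIV_shift[of "\<lambda>w. mint w x y" _ 0 s] by (simp add: add.commute)
  qed
  then show ?thesis
    unfolding holomorphic_on_def using field_differentiable_at_within field_differentiable_def by blast
qed

lemma mint_holomorphic_args:
  "(\<lambda>z. mint s (z * c) (z * d)) holomorphic_on {z. Re (z * c) > 0 \<and> Re (z * d) > 0}"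
  unfolding holomorphic_on_def
proof
  fix z assume z: "z \<in> {z. Re (z * c) > 0 \<and> Re (z * d) > 0}"
  have "((\<lambda>w. mint s (z * c + w * c) (z * d + w * d)) has_field_derivative
           (- c * mint (s + 1) (z * c) (z * d) - d * mint (s - 1) (z * c) (z * d))) (at 0)"
    using z by (intro mint_deriv) auto
  then have "((\<lambda>w. mint s (w * c) (w * d)) has_field_derivative
           (- c * mint (s + 1) (z * c) (z * d) - d * mint (s - 1) (z * c) (z * d))) (at z)"
    using DERIV_shift[of "\<lambda>w. mint s (w * c) (w * d)" _ 0 z] by (simp add: algebra_simps)
  then show "(\<lambda>z. mint s (z * c) (z * d)) field_differentiable at z within {z. Re (z * c) > 0 \<and> Re (z * d) > 0}"
    using field_differentiable_at_within field_differentiable_def by blast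
qed

lemma mint_deriv_right:
  assumes "Re x > 0" "Re y > 0"
  shows "(mint s x has_field_derivative - mint (s - 1) x y) (at y)"
  using mint_deriv[OF assms, of s 0 1] DERIV_shift[of "\<lambda>w. mint s x w" _ 0 y] by (simp add: add.commute)

text \<open>
  The integrand of the difference of both sides is the derivative of
  \<open>v powr s * exp (- x * v - y / v)\<close>, which tends to 0 at both ends.
\<close>

lemma mint_recurrence:
  assumes x: "x > 0" and y: "y > 0"
  shows "s * mint s (of_real x) (of_real y) = of_real x * mint (s + 1) (of_real x) (of_real y) - of_real y * mint (s - 1) (of_real x) (of_real y)"
proof -
  define F where "F = (\<lambda>v. exp (s * of_real (ln v) - of_real x * of_real v - of_real y / of_real v :: complex))"
  define f where "f = (\<lambda>v. s * mker s (of_real x) (of_real y) v - of_real x * mker (s + 1) (of_real x) (of_real y) v + of_real y * mker (s - 1) (of_real x) (of_real y) v)"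
  have i: "integrable lborel (mker s' (of_real x) (of_real y))" for s'
    using x y by (intro mker_integrable) auto
  have int: "integrable lborel f" unfolding f_def
    by (intro Bochner_Integration.integrable_add Bochner_Integration.integrable_diff integrable_mult_right i)
  have f: "f v = F v * (s / of_real v - of_real x + of_real y / of_real v ^ 2)" if "v > 0" for v
  proof -
    have *: "complex_of_real v = exp (of_real (ln v))" using that by (simp add: exp_of_real)
    have a: "mker (s + 1) (of_real x) (of_real y) v = F v" using that by (simp add: mker_def F_def)
    have b: "mker s (of_real x) (of_real y) v * of_real v = F v"
      using that unfolding mker_def F_def by (subst (3) *) (simp add: algebra_simps flip: exp_add)
    have c: "mker (s - 1) (of_real x) (of_real y) v * of_real v * of_real v = F v"
      using that unfolding mker_def F_def by (subst (3 4) *) (simp add: algebra_simps flip: exp_add)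
    show ?thesis unfolding f_def a using b c that by (auto simp: field_simps power2_eq_square)
  qed
  have d: "(F has_vector_derivative f v) (at v)" if "v > 0" for v
  proof -
    have "((\<lambda>v. s * of_real (ln v) - of_real x * of_real v - of_real y / of_real v :: complex) has_vector_derivative
        (s * of_real (1 / v) - of_real x * 1 - of_real y * of_real (- 1 / v ^ 2))) (at v)"
    proof -
      have "((\<lambda>v. 1 / v) has_real_derivative (- 1 / v ^ 2)) (at v)"
        using that by (auto intro!: derivative_eq_intros simp: power2_eq_square)
      then have "((\<lambda>v. complex_of_real (1 / v)) has_vector_derivative of_real (- 1 / v ^ 2)) (at v)"
        using has_vector_derivative_of_real has_real_derivative_iff_has_vector_derivative by blast
      then have 1: "((\<lambda>v. of_real y / complex_of_real v) has_vector_derivative of_real y * of_real (- 1 / v ^ 2)) (at v)"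
        using has_vector_derivative_mult_right[of "\<lambda>v. complex_of_real (1 / v)" "of_real (- 1 / v ^ 2)" "at v" "of_real y"] by (simp add: divide_inverse)
      have "(ln has_real_derivative 1 / v) (at v)" using that by (auto intro!: derivative_eq_intros)
      then have "((\<lambda>v. complex_of_real (ln v)) has_vector_derivative of_real (1 / v)) (at v)"
        using has_vector_derivative_of_real has_real_derivative_iff_has_vector_derivative by blast
      then have 2: "((\<lambda>v. s * complex_of_real (ln v)) has_vector_derivative s * of_real (1 / v)) (at v)"
        by (rule has_vector_derivative_mult_right)
      have "((\<lambda>v. complex_of_real v) has_vector_derivative of_real 1) (at v)"
        by (rule has_vector_derivative_of_real) (rule DERIV_ident)
      then have 3: "((\<lambda>v. of_real x * complex_of_real v) has_vector_derivative of_real x * of_real 1) (at v)"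
        by (rule has_vector_derivative_mult_right)
      show ?thesis using has_vector_derivative_diff[OF has_vector_derivative_diff[OF 2 3] 1] by simp
    qed
    then have "(F has_vector_derivative (s * of_real (1 / v) - of_real x * 1 - of_real y * of_real (- 1 / v ^ 2)) * F v) (at v)"
      unfolding F_def using field_vector_diff_chain_at[of _ _ v exp] by (force simp: o_def intro: DERIV_exp)
    then show ?thesis unfolding f[OF that] by (simp add: algebra_simps)
  qed
  have nF: "norm (F v) = exp (Re s * ln v - x * v - y / v)" for v
    by (simp add: F_def norm_exp_eq_Re)
  have "(LBINT v=0..\<infinity>. f v) = 0 - 0"
  proof (rule interval_integral_FTC_integrable)
    show "(F has_vector_derivative f v) (at v)" if "0 < ereal v" for v using d that by simp
    show "isCont f v" if "0 < ereal v" for v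
    proof -
      have v: "v > 0" using that by simp
      have "isCont (\<lambda>v. F v * (s / of_real v - of_real x + of_real y / of_real v ^ 2)) v"
        unfolding F_def using v by (intro continuous_intros) auto
      moreover have "eventually (\<lambda>v. v > 0) (nhds v)" using v eventually_nhds_in_open[of "{0<..}" v] by auto
      then have "eventually (\<lambda>v. F v * (s / of_real v - of_real x + of_real y / of_real v ^ 2) = f v) (nhds v)"
        by eventually_elim (simp add: f)
      ultimately show ?thesis by (simp add: isCont_cong)
    qed
    show "set_integrable lborel (einterval 0 \<infinity>) f"
      unfolding set_integrable_def by (rule Bochner_Integration.integrable_bound[OF int]) (auto simp: f_def indicator_def einterval_def)
    have "((\<lambda>v. norm (F v)) \<longlongrightarrow> 0) (at_right 0)"
      unfolding nF using x y by real_asymp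
    then show "((F \<circ> real_of_ereal) \<longlongrightarrow> 0) (at_right 0)"
      unfolding zero_ereal_def ereal_tendsto_simps by (rule tendsto_norm_zero_cancel)
    have "((\<lambda>v. norm (F v)) \<longlongrightarrow> 0) at_top"
      unfolding nF using x y by real_asymp
    then show "((F \<circ> real_of_ereal) \<longlongrightarrow> 0) (at_left \<infinity>)"
      unfolding ereal_tendsto_simps by (rule tendsto_norm_zero_cancel)
  qed simp
  moreover have "(LBINT v=0..\<infinity>. f v) = (LINT v|lborel. f v)"
    unfolding interval_lebesgue_integral_0_infty set_lebesgue_integral_def
    by (intro Bochner_Integration.integral_cong) (auto simp: f_def mker_def indicator_def)
  ultimately have "(LINT v|lborel. f v) = 0" by simp
  then show ?thesis unfolding f_def using i by (simp add: mint_def algebra_simps)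
qed

text \<open>
  The substitution of \<open>1 / v\<close> for \<open>v\<close>.
\<close>

lemma mint_inversion:
  assumes "x > 0" "y > 0"
  shows "mint (- s) (of_real x) (of_real y) = mint s (of_real y) (of_real x)"
proof -
  have i: "mker s' (of_real x') (of_real y') absolutely_integrable_on {0<..}
     \<and> integral {0<..} (mker s' (of_real x') (of_real y')) = mint s' (of_real x') (of_real y')" if "x' > 0" "y' > 0" for s' x' y'
  proof -
    have ii: "integrable lborel (mker s' (of_real x') (of_real y'))" using that by (intro mker_integrable) auto
    have e: "(\<lambda>v. indicator {0<..} v *\<^sub>R mker s' (of_real x') (of_real y') v) = mker s' (of_real x') (of_real y')"
      by (auto simp: mker_def fun_eq_iff)
    have "set_integrable lborel {0<..} (mker s' (of_real x') (of_real y'))"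
      using ii unfolding set_integrable_def e .
    then have "integral {0<..} (mker s' (of_real x') (of_real y')) = mint s' (of_real x') (of_real y')"
      using set_borel_integral_eq_integral(2)[of "{0<..}" "mker s' (of_real x') (of_real y')"]
      unfolding mint_def set_lebesgue_integral_def e by simp
    moreover have "mker s' (of_real x') (of_real y') absolutely_integrable_on {0<..}"
      unfolding set_integrable_def e by (subst integrable_completion) (simp_all add: ii)
    ultimately show ?thesis by blast
  qed
  let ?g = "\<lambda>v::real. 1 / v" and ?g' = "\<lambda>v::real. - 1 / v ^ 2"
  have img: "?g ` {0<..} = {0<..}"
  proof -
    have "\<exists>x>0. v = 1 / x" if "v > 0" for v :: real using that by (intro exI[of _ "1 / v"]) auto
    then show ?thesis by (auto simp: image_iff Bex_def)
  qed
  have e: "\<bar>?g' v\<bar> *\<^sub>R mker s (of_real y) (of_real x) (?g v) = mker (- s) (of_real x) (of_real y) v" if "v > 0" for v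
  proof -
    have "\<bar>?g' v\<bar> = exp (- 2 * ln v)" using that by (simp add: exp_minus exp_double power2_eq_square divide_inverse)
    then have "\<bar>?g' v\<bar> *\<^sub>R mker s (of_real y) (of_real x) (?g v)
        = exp (of_real (- 2 * ln v) + ((s - 1) * of_real (- ln v) - of_real y / of_real v - of_real x * of_real v))"
      using that by (simp add: mker_def scaleR_conv_of_real ln_div exp_add exp_of_real del: of_real_mult of_real_minus)
    also have "of_real (- 2 * ln v) + ((s - 1) * of_real (- ln v) - of_real y / of_real v - of_real x * of_real v)
        = (- s - 1) * of_real (ln v) - of_real x * of_real v - of_real y / of_real v"
      by (simp add: algebra_simps)
    finally show ?thesis using that by (simp add: mker_def)
  qed
  have "(\<lambda>v. \<bar>?g' v\<bar> *\<^sub>R mker s (of_real y) (of_real x) (?g v)) absolutely_integrable_on {0<..} \<and>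
     integral {0<..} (\<lambda>v. \<bar>?g' v\<bar> *\<^sub>R mker s (of_real y) (of_real x) (?g v)) = mint s (of_real y) (of_real x)
     \<longleftrightarrow> mker s (of_real y) (of_real x) absolutely_integrable_on (?g ` {0<..}) \<and> integral (?g ` {0<..}) (mker s (of_real y) (of_real x)) = mint s (of_real y) (of_real x)"
    by (rule has_absolute_integral_change_of_variables_real)
       (auto intro!: derivative_eq_intros inj_onI simp: power2_eq_square field_simps)
  then have "integral {0<..} (\<lambda>v. \<bar>?g' v\<bar> *\<^sub>R mker s (of_real y) (of_real x) (?g v)) = mint s (of_real y) (of_real x)"
    unfolding img using i[OF assms(2,1), of s] by simp
  also have "integral {0<..} (\<lambda>v. \<bar>?g' v\<bar> *\<^sub>R mker s (of_real y) (of_real x) (?g v)) = integral {0<..} (mker (- s) (of_real x) (of_real y))"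
    by (rule integral_cong) (use e in auto)
  finally show ?thesis using i[OF assms, of "- s"] by simp
qed

lemma mint_tendsto_gamma:
  assumes "Re s > 0"
  shows "((\<lambda>y. mint s 1 (of_real y)) \<longlongrightarrow> Gamma s) (at_right 0)"
  unfolding tendsto_at_iff_sequentially o_def
proof (intro allI impI)
  fix X :: "nat \<Rightarrow> real" assume X: "\<forall>i. X i \<in> {0<..} - {0}" "X \<longlonglongrightarrow> 0"
  have "(\<lambda>n. mint s 1 (of_real (X n))) \<longlonglongrightarrow> mint s 1 0"
    unfolding mint_def
  proof (rule integral_dominated_convergence)
    show "integrable lborel (rker (Re s) 1 0)" using assms by (intro rker_integrable0) auto
    show "AE v in lborel. (\<lambda>n. mker s 1 (of_real (X n)) v) \<longlonglongrightarrow> mker s 1 0 v"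
    proof (rule AE_I2)
      fix v :: real
      show "(\<lambda>n. mker s 1 (of_real (X n)) v) \<longlonglongrightarrow> mker s 1 0 v"
      proof (cases "v > 0")
        case True
        have "(\<lambda>n. exp ((s - 1) * of_real (ln v) - 1 * of_real v - of_real (X n) / of_real v)) \<longlonglongrightarrow>
            exp ((s - 1) * of_real (ln v) - 1 * of_real v - of_real 0 / of_real v)"
          by (rule tendsto_exp[OF tendsto_diff[OF tendsto_const tendsto_divide[OF tendsto_of_real[OF X(2)] tendsto_const]]]) (use True in auto)
        then show ?thesis using True by (simp add: mker_def)
      qed (simp add: mker_def)
    qed
    show "AE v in lborel. norm (mker s 1 (of_real (X n)) v) \<le> rker (Re s) 1 0 v" for n
      using X(1) by (intro AE_I2) (auto simp: norm_mker less_imp_le intro!: rker_mono)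
  qed measurable
  then show "(\<lambda>n. mint s 1 (of_real (X n))) \<longlonglongrightarrow> Gamma s"
    using mint_gamma[OF assms, of 1] by simp
qed

section \<open>The modified Bessel functions of both kinds\<close>

text \<open>
  The modified Bessel function of the first kind without its factor \<open>(z / 2) powr \<mu>\<close>, as a function of
  \<open>y = (z / 2)\<^sup>2\<close>. In contrast to the Bessel function itself it is entire in \<open>y\<close> as well as in \<open>\<mu>\<close>.
\<close>

definition bseries :: "complex \<Rightarrow> complex \<Rightarrow> complex" where
  "bseries \<mu> y = (\<Sum>m. rGamma (\<mu> + of_nat m + 1) / fact m * y ^ m)"

lemma Bessel_I_bseries: "Bessel_I \<nu> z = (if \<nu> = 0 then 1 else (z / 2) powr \<nu>) * bseries \<nu> ((z / 2)\<^sup>2)"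
  by (simp add: Bessel_I_def bseries_def power_mult)

text \<open>
  From \<open>rGamma w = w * rGamma (w + 1)\<close>, the norm does not increase from \<open>w\<close> to \<open>w + 1\<close> once
  \<open>norm w \<ge> 1\<close>. So a bound at one sufficiently large shift holds for all larger ones.
\<close>

lemma rGamma_shift_bounded:
  "\<exists>C N. C > 0 \<and> (\<forall>\<mu> m. norm \<mu> \<le> R \<longrightarrow> N \<le> m \<longrightarrow> norm (rGamma (\<mu> + of_nat m + 1 :: complex)) \<le> C)"
proof -
  obtain N :: nat where N: "real N \<ge> R" using real_arch_simple by blast
  have "compact ((\<lambda>\<mu>. rGamma (\<mu> + of_nat N + 1 :: complex)) ` cball 0 R)"
    by (intro compact_continuous_image holomorphic_on_imp_continuous_on holomorphic_intros) auto
  then obtain C where C: "C > 0" "\<And>\<mu>. norm \<mu> \<le> R \<Longrightarrow> norm (rGamma (\<mu> + of_nat N + 1 :: complex)) \<le> C"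
    using bounded_pos[of "(\<lambda>\<mu>. rGamma (\<mu> + of_nat N + 1 :: complex)) ` cball 0 R"] compact_imp_bounded by auto
  have "norm (rGamma (\<mu> + of_nat (N + k) + 1 :: complex)) \<le> C" if mu: "norm \<mu> \<le> R" for \<mu> k
  proof (induction k)
    case (Suc k)
    let ?z = "\<mu> + of_nat (N + k) + 1 :: complex"
    have "1 \<le> Re ?z" using abs_Re_le_cmod[of \<mu>] mu N by (simp add: abs_le_iff)
    then have "1 \<le> norm ?z" using complex_Re_le_cmod[of ?z] by linarith
    then have "norm (rGamma (?z + 1)) \<le> norm ?z * norm (rGamma (?z + 1))"
      using mult_right_mono[of 1 "norm ?z" "norm (rGamma (?z + 1))"] by simp
    also have "\<dots> = norm (rGamma ?z)" unfolding norm_mult[symmetric] rGamma_plus1 ..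
    finally show ?case using Suc by (simp add: add_ac)
  qed (use C mu in simp)
  then have "norm (rGamma (\<mu> + of_nat m + 1 :: complex)) \<le> C" if "norm \<mu> \<le> R" "N \<le> m" for \<mu> m
    using that le_Suc_ex by metis
  then show ?thesis using C by blast
qed

lemma summable_exp_real: "summable (\<lambda>n. C * (inverse (fact n) * (x::real) ^ n))"
  by (intro summable_mult summable_exp)

lemma summable_bseries: "summable (\<lambda>m. norm (rGamma (\<mu> + of_nat m + 1) / fact m * (y::complex) ^ m))"
proof -
  obtain C N where C: "\<And>m. N \<le> m \<Longrightarrow> norm (rGamma (\<mu> + of_nat m + 1)) \<le> C"
    using rGamma_shift_bounded[of "norm \<mu>"] by blast
  show ?thesis
  proof (rule summable_comparison_test_ev[OF _ summable_exp_real[of C "norm y"]])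
    show "\<forall>\<^sub>F m in sequentially. norm (norm (rGamma (\<mu> + of_nat m + 1) / fact m * y ^ m)) \<le> C * (inverse (fact m) * norm y ^ m)"
      using eventually_ge_at_top[of N]
      by eventually_elim (use C in \<open>auto simp: norm_mult norm_divide norm_power norm_inverse divide_inverse mult.assoc intro!: mult_right_mono\<close>)
  qed
qed

lemma bseries_0: "bseries \<mu> 0 = rGamma (\<mu> + 1)"
  using powser_zero[of "\<lambda>m. rGamma (\<mu> + of_nat m + 1) / fact m"] by (simp add: bseries_def)

lemma bseries_deriv: "(bseries \<mu> has_field_derivative bseries (\<mu> + 1) y) (at y)"
proof -
  have "((\<lambda>x. \<Sum>m. rGamma (\<mu> + of_nat m + 1) / fact m * x ^ m) has_field_derivative
      (\<Sum>m. diffs (\<lambda>m. rGamma (\<mu> + of_nat m + 1) / fact m) m * y ^ m)) (at y)"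
    by (rule termdiffs_strong_converges_everywhere) (rule summable_norm_cancel[OF summable_bseries])
  moreover have "diffs (\<lambda>m. rGamma (\<mu> + of_nat m + 1) / fact m) = (\<lambda>m. rGamma (\<mu> + 1 + of_nat m + 1) / fact m)"
    by (auto simp: diffs_def fun_eq_iff add_ac divide_simps simp del: of_nat_Suc) (simp add: algebra_simps)
  ultimately show ?thesis unfolding bseries_def[abs_def] by simp
qed

lemma bseries_recurrence: "bseries \<mu> y = y * bseries (\<mu> + 2) y + (\<mu> + 1) * bseries (\<mu> + 1) y"
proof -
  let ?a = "\<lambda>\<mu> m. rGamma (\<mu> + of_nat m + 1) / fact m * y ^ m"
  have s: "summable (?a \<mu>)" for \<mu> by (rule summable_norm_cancel[OF summable_bseries])
  have "(\<lambda>m. ?a \<mu> (Suc m) - (\<mu> + 1) * ?a (\<mu> + 1) (Suc m)) = (\<lambda>m. y * ?a (\<mu> + 2) m)"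
  proof
    fix m
    have "rGamma (\<mu> + of_nat (Suc m) + 1) = (\<mu> + of_nat (Suc m) + 1) * rGamma (\<mu> + of_nat m + 3)"
      using rGamma_plus1[of "\<mu> + of_nat (Suc m) + 1"] by (simp add: add_ac)
    then have "?a \<mu> (Suc m) - (\<mu> + 1) * ?a (\<mu> + 1) (Suc m) = of_nat (Suc m) * rGamma (\<mu> + of_nat m + 3) / fact (Suc m) * y ^ Suc m"
      by (simp add: add_ac field_simps del: fact_Suc)
    also have "\<dots> = y * ?a (\<mu> + 2) m" by (simp add: add_ac del: of_nat_Suc)
    finally show "?a \<mu> (Suc m) - (\<mu> + 1) * ?a (\<mu> + 1) (Suc m) = y * ?a (\<mu> + 2) m" .
  qed
  moreover have "?a \<mu> 0 - (\<mu> + 1) * ?a (\<mu> + 1) 0 = 0"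
    using rGamma_plus1[of "\<mu> + 1"] by (simp add: add_ac)
  moreover have "(\<lambda>m. ?a \<mu> m - (\<mu> + 1) * ?a (\<mu> + 1) m) sums (bseries \<mu> y - (\<mu> + 1) * bseries (\<mu> + 1) y)"
    unfolding bseries_def by (intro sums_diff sums_mult summable_sums s)
  then have "(\<lambda>m. ?a \<mu> (Suc m) - (\<mu> + 1) * ?a (\<mu> + 1) (Suc m)) sums
      (bseries \<mu> y - (\<mu> + 1) * bseries (\<mu> + 1) y - (?a \<mu> 0 - (\<mu> + 1) * ?a (\<mu> + 1) 0))"
    by (subst sums_Suc_iff) simp
  ultimately have "(\<lambda>m. y * ?a (\<mu> + 2) m) sums (bseries \<mu> y - (\<mu> + 1) * bseries (\<mu> + 1) y)"
    by (simp only: diff_zero)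
  moreover have "(\<lambda>m. y * ?a (\<mu> + 2) m) sums (y * bseries (\<mu> + 2) y)"
    unfolding bseries_def by (intro sums_mult summable_sums s)
  ultimately have "bseries \<mu> y - (\<mu> + 1) * bseries (\<mu> + 1) y = y * bseries (\<mu> + 2) y"
    by (rule sums_unique2)
  then show ?thesis by (simp add: algebra_simps)
qed

lemma bseries_holomorphic_order: "(\<lambda>\<mu>. bseries \<mu> y) holomorphic_on UNIV"
  unfolding bseries_def
proof (rule holomorphic_suminf)
  show "(\<lambda>\<mu>. rGamma (\<mu> + of_nat m + 1) / fact m * y ^ m) holomorphic_on UNIV" for m
    by (intro holomorphic_intros) auto
  fix z :: complex
  obtain C N where C: "\<And>(\<mu>::complex) m. norm \<mu> \<le> norm z + 1 \<Longrightarrow> N \<le> m \<Longrightarrow> norm (rGamma (\<mu> + of_nat m + 1)) \<le> C"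
    using rGamma_shift_bounded[of "norm z + 1"] by blast
  have "norm (rGamma (w + of_nat m + 1) / fact m * y ^ m) \<le> C * (inverse (fact m) * norm y ^ m)"
    if "N \<le> m" "dist w z \<le> 1" for w :: complex and m
  proof -
    have "norm w \<le> norm z + 1" using that norm_triangle_ineq2[of w z] by (simp add: dist_norm)
    then show ?thesis using C[of w m] that
      by (auto simp: norm_mult norm_divide norm_power norm_inverse divide_inverse mult.assoc intro!: mult_right_mono)
  qed
  then show "\<exists>r>0. \<exists>N g. summable g \<and> (\<forall>m\<ge>N. \<forall>w\<in>UNIV. dist w z \<le> r \<longrightarrow> norm (rGamma (w + of_nat m + 1) / fact m * y ^ m) \<le> g m)"
    using summable_exp_real[of C "norm y"] by (intro exI[of _ 1] conjI exI[of _ N] exI[of _ "\<lambda>m. C * (inverse (fact m) * norm y ^ m)"]) auto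
qed auto

text \<open>
  The derivative in \<open>y\<close> vanishes by the recurrence, and the value at \<open>y = 0\<close> is Euler's reflection
  formula.
\<close>

lemma bseries_wronskian:
  "bseries (- \<nu>) y * bseries (\<nu> - 1) y - y * bseries (1 - \<nu>) y * bseries \<nu> y = sin (of_real pi * \<nu>) / of_real pi"
proof -
  define E where "E = (\<lambda>y. bseries (- \<nu>) y * bseries (\<nu> - 1) y - y * bseries (1 - \<nu>) y * bseries \<nu> y)"
  have "(E has_field_derivative 0) (at y)" for y
  proof -
    have r: "bseries (\<nu> - 1) y = y * bseries (\<nu> + 1) y + \<nu> * bseries \<nu> y"
      "bseries (- \<nu>) y = y * bseries (2 - \<nu>) y + (1 - \<nu>) * bseries (1 - \<nu>) y"
      using bseries_recurrence[of "\<nu> - 1" y] bseries_recurrence[of "- \<nu>" y] by (simp_all add: add_ac)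
    have d: "(bseries (- \<nu>) has_field_derivative bseries (1 - \<nu>) y) (at y)"
      "(bseries (\<nu> - 1) has_field_derivative bseries \<nu> y) (at y)"
      "(bseries (1 - \<nu>) has_field_derivative bseries (2 - \<nu>) y) (at y)"
      "(bseries \<nu> has_field_derivative bseries (\<nu> + 1) y) (at y)"
      using bseries_deriv[of "- \<nu>" y] bseries_deriv[of "\<nu> - 1" y] bseries_deriv[of "1 - \<nu>" y] bseries_deriv[of \<nu> y]
      by (simp_all add: add_ac)
    show ?thesis unfolding E_def
      by (rule derivative_eq_intros d refl)+ (simp add: r algebra_simps)
  qed
  then obtain c where c: "\<And>y. E y = c"
    using has_field_derivative_zero_constant[of UNIV E] by auto
  have "E y = E 0" using c by simp
  also have "E 0 = sin (of_real pi * \<nu>) / of_real pi"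
    using rGamma_reflection_complex[of \<nu>] by (simp add: E_def bseries_0 mult.commute add_ac)
  finally show ?thesis by (simp add: E_def)
qed

lemma mint_reflect:
  assumes "y > 0"
  shows "mint (- s) 1 (of_real y) = exp (- s * of_real (ln y)) * mint s 1 (of_real y)"
proof -
  have "mint (- s) 1 (of_real y) = mint s (of_real y) 1"
    using mint_inversion[of 1 y s] assms by simp
  also have "\<dots> = exp (s * of_real (ln (1 / y))) * mint s 1 (of_real y)"
    using mint_scale[of "1 / y" s "of_real y" 1] assms by (simp add: divide_inverse)
  finally show ?thesis using assms by (simp add: ln_div)
qed

text \<open>
  The left-hand side is constant in \<open>y\<close> by the recurrences of both functions. The constant is found
  as \<open>y\<close> tends to 0, where \<open>y * mint (\<nu> - 1) 1 y\<close> has to be rewritten by the recurrence because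
  \<open>mint (\<nu> - 1) 1 y\<close> itself may be unbounded.
\<close>

lemma mint_bseries_wronskian:
  assumes nu: "Re \<nu> > 0" and y: "y > 0"
  shows "mint \<nu> 1 (of_real y) * bseries (\<nu> - 1) (of_real y) + of_real y * mint (\<nu> - 1) 1 (of_real y) * bseries \<nu> (of_real y) = 1"
proof -
  define E where "E = (\<lambda>y. mint \<nu> 1 y * bseries (\<nu> - 1) y + y * mint (\<nu> - 1) 1 y * bseries \<nu> y)"
  have d: "((\<lambda>y. E (of_real y)) has_vector_derivative 0) (at y within {0<..})" if "y > 0" for y
  proof (rule has_vector_derivative_real_field)
    let ?y = "complex_of_real y"
    have r: "bseries (\<nu> - 1) ?y = ?y * bseries (\<nu> + 1) ?y + \<nu> * bseries \<nu> ?y"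
      using bseries_recurrence[of "\<nu> - 1" ?y] by (simp add: add_ac)
    have r2: "mint \<nu> 1 ?y = (\<nu> - 1) * mint (\<nu> - 1) 1 ?y + ?y * mint (\<nu> - 2) 1 ?y"
      using mint_recurrence[of 1 y "\<nu> - 1"] that by (simp add: algebra_simps)
    have d: "(bseries (\<nu> - 1) has_field_derivative bseries \<nu> ?y) (at ?y)"
      "(bseries \<nu> has_field_derivative bseries (\<nu> + 1) ?y) (at ?y)"
      "(mint \<nu> 1 has_field_derivative - mint (\<nu> - 1) 1 ?y) (at ?y)"
      "(mint (\<nu> - 1) 1 has_field_derivative - mint (\<nu> - 2) 1 ?y) (at ?y)"
      using bseries_deriv[of "\<nu> - 1" ?y] bseries_deriv[of \<nu> ?y] mint_deriv_right[of 1 ?y \<nu>] mint_deriv_right[of 1 ?y "\<nu> - 1"] that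
      by (simp_all add: add_ac)
    show "(E has_field_derivative 0) (at ?y)" unfolding E_def
      by (rule derivative_eq_intros d refl)+ (simp add: r r2 algebra_simps)
  qed
  then obtain c where c: "\<And>y. y > 0 \<Longrightarrow> E (of_real y) = c"
    using has_vector_derivative_zero_constant[of "{0<..}" "\<lambda>y. E (of_real y)"] by auto
  have cb: "continuous (at_right 0) (\<lambda>y. bseries \<mu> (of_real y))" for \<mu>
  proof -
    have "isCont (bseries \<mu>) (of_real 0)" using bseries_deriv DERIV_isCont by blast
    then have "isCont (\<lambda>y. bseries \<mu> (of_real y)) (0::real)" by (rule isCont_o2[rotated]) (intro continuous_intros)
    then show ?thesis by (rule continuous_at_imp_continuous_at_within)
  qed
  have b: "((\<lambda>y. bseries \<mu> (of_real y)) \<longlongrightarrow> rGamma (\<mu> + 1)) (at_right (0::real))" for \<mu>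
    using cb[of \<mu>] by (simp add: continuous_within bseries_0)
  \<comment> \<open>By the recurrence, this is \<open>y * mint (\<nu> - 1) 1 y\<close>.\<close>
  have m: "((\<lambda>y. mint (\<nu> + 1) 1 (of_real y) - \<nu> * mint \<nu> 1 (of_real y)) \<longlongrightarrow> Gamma (\<nu> + 1) - \<nu> * Gamma \<nu>) (at_right 0)"
    using nu by (intro tendsto_intros mint_tendsto_gamma) auto
  have "((\<lambda>y. mint \<nu> 1 (of_real y) * bseries (\<nu> - 1) (of_real y) + (mint (\<nu> + 1) 1 (of_real y) - \<nu> * mint \<nu> 1 (of_real y)) * bseries \<nu> (of_real y))
    \<longlongrightarrow> Gamma \<nu> * rGamma (\<nu> - 1 + 1) + (Gamma (\<nu> + 1) - \<nu> * Gamma \<nu>) * rGamma (\<nu> + 1)) (at_right 0)"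
    by (intro tendsto_intros m b mint_tendsto_gamma nu)
  moreover have "eventually (\<lambda>y. mint \<nu> 1 (of_real y) * bseries (\<nu> - 1) (of_real y) + (mint (\<nu> + 1) 1 (of_real y) - \<nu> * mint \<nu> 1 (of_real y)) * bseries \<nu> (of_real y) = c) (at_right (0::real))"
    using eventually_at_right_less[of 0]
  proof eventually_elim
    case (elim y)
    then show ?case using c[OF elim] mint_recurrence[of 1 y \<nu>] by (simp add: E_def)
  qed
  ultimately have "Gamma \<nu> * rGamma (\<nu> - 1 + 1) + (Gamma (\<nu> + 1) - \<nu> * Gamma \<nu>) * rGamma (\<nu> + 1) = c"
    using tendsto_unique[OF trivial_limit_at_right_real _ tendsto_eventually] by blast
  moreover have "\<nu> \<notin> \<int>\<^sub>\<le>\<^sub>0" using nu by (auto elim!: nonpos_Ints_cases)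
  ultimately have "c = 1" by (simp add: Gamma_plus1 rGamma_inverse_Gamma Gamma_eq_zero_iff)
  then show ?thesis using c[OF y] by (simp add: E_def)
qed

text \<open>
  For \<open>0 < Re \<nu> < 1\<close> the Wronskian relations for \<open>\<nu>\<close> and \<open>1 - \<nu>\<close> are two linear equations in
  \<open>mint \<nu> 1 y\<close> and \<open>mint (\<nu> - 1) 1 y\<close>, since \<open>mint_reflect\<close> relates the orders \<open>1 - \<nu>\<close> and \<open>- \<nu>\<close> to these.
  Their determinant is given by \<open>bseries_wronskian\<close>. Both sides are entire in \<open>\<nu>\<close>, so the result
  extends to all orders.
\<close>

lemma mint_eq_bseries:
  assumes y: "y > 0"
  shows "mint \<nu> 1 (of_real y) * (sin (of_real pi * \<nu>) / of_real pi) = bseries (- \<nu>) (of_real y) - exp (\<nu> * of_real (ln y)) * bseries \<nu> (of_real y)"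
proof (rule analytic_continuation_open[of "{z. 0 < Re z \<and> Re z < 1}" UNIV "\<lambda>\<nu>. mint \<nu> 1 (of_real y) * (sin (of_real pi * \<nu>) / of_real pi)" "\<lambda>\<nu>. bseries (- \<nu>) (of_real y) - exp (\<nu> * of_real (ln y)) * bseries \<nu> (of_real y)"])
  have "open ({z. 0 < Re z} \<inter> {z. Re z < 1})" by (intro open_Int open_halfspace_Re_gt open_halfspace_Re_lt)
  then show "open {z. 0 < Re z \<and> Re z < 1}" by (simp add: Collect_conj_eq)
  have "complex_of_real (1/2) \<in> {z. 0 < Re z \<and> Re z < 1}" by simp
  then show "{z. 0 < Re z \<and> Re z < 1} \<noteq> {}" by blast
  show "(\<lambda>\<nu>. mint \<nu> 1 (of_real y) * (sin (of_real pi * \<nu>) / of_real pi)) holomorphic_on UNIV"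
    using y by (intro holomorphic_intros mint_holomorphic_order) auto
  have "((\<lambda>\<nu>. bseries \<nu> (of_real y)) \<circ> uminus) holomorphic_on UNIV"
    by (intro holomorphic_on_compose_gen[OF _ bseries_holomorphic_order] holomorphic_intros) auto
  then show "(\<lambda>\<nu>. bseries (- \<nu>) (of_real y) - exp (\<nu> * of_real (ln y)) * bseries \<nu> (of_real y)) holomorphic_on UNIV"
    by (intro holomorphic_intros bseries_holomorphic_order) (simp add: o_def)
  fix \<nu> :: complex assume "\<nu> \<in> {z. 0 < Re z \<and> Re z < 1}"
  then have nu: "0 < Re \<nu>" "Re \<nu> < 1" by auto
  let ?y = "complex_of_real y" and ?E = "exp (\<nu> * of_real (ln y)) :: complex"
  have y0: "?y \<noteq> 0" "?y = exp (of_real (ln y))" using y by (simp_all add: exp_of_real)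
  have 1: "mint \<nu> 1 ?y * bseries (\<nu> - 1) ?y + ?y * mint (\<nu> - 1) 1 ?y * bseries \<nu> ?y = 1"
    by (rule mint_bseries_wronskian) (use nu y in auto)
  have "mint (1 - \<nu>) 1 ?y * bseries (- \<nu>) ?y + ?y * mint (- \<nu>) 1 ?y * bseries (1 - \<nu>) ?y = 1"
    using mint_bseries_wronskian[of "1 - \<nu>" y] nu y by simp
  moreover have "?E * mint (1 - \<nu>) 1 ?y = ?y * mint (\<nu> - 1) 1 ?y"
    using mint_reflect[OF y, of "\<nu> - 1"] y0(1)
    by (subst (2) y0(2)) (simp add: algebra_simps flip: exp_add)
  moreover have "?E * mint (- \<nu>) 1 ?y = mint \<nu> 1 ?y"
    using mint_reflect[OF y, of \<nu>] by (simp flip: exp_add mult.assoc)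
  ultimately have 2: "?y * mint (\<nu> - 1) 1 ?y * bseries (- \<nu>) ?y + ?y * mint \<nu> 1 ?y * bseries (1 - \<nu>) ?y = ?E"
    by algebra
  have "mint \<nu> 1 ?y * (bseries (- \<nu>) ?y * bseries (\<nu> - 1) ?y - ?y * bseries (1 - \<nu>) ?y * bseries \<nu> ?y)
     = (mint \<nu> 1 ?y * bseries (\<nu> - 1) ?y + ?y * mint (\<nu> - 1) 1 ?y * bseries \<nu> ?y) * bseries (- \<nu>) ?y
      - (?y * mint (\<nu> - 1) 1 ?y * bseries (- \<nu>) ?y + ?y * mint \<nu> 1 ?y * bseries (1 - \<nu>) ?y) * bseries \<nu> ?y"
    by (simp add: algebra_simps)
  then show "mint \<nu> 1 ?y * (sin (of_real pi * \<nu>) / of_real pi) = bseries (- \<nu>) ?y - ?E * bseries \<nu> ?y"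
    unfolding 1 2 bseries_wronskian by simp
qed auto

lemma bseries_holomorphic: "bseries \<mu> holomorphic_on A"
  using bseries_deriv by (auto simp: holomorphic_on_def field_differentiable_def intro: has_field_derivative_at_within)

lemma Bessel_I_holomorphic: "Bessel_I \<mu> holomorphic_on - \<real>\<^sub>\<le>\<^sub>0"
proof -
  have b: "(bseries \<mu> \<circ> (\<lambda>z. (z / 2)\<^sup>2)) holomorphic_on - \<real>\<^sub>\<le>\<^sub>0"
    by (intro holomorphic_on_compose holomorphic_intros bseries_holomorphic) auto
  have "(\<lambda>z. (if \<mu> = 0 then 1 else (z / 2) powr \<mu>) * (bseries \<mu> \<circ> (\<lambda>z. (z / 2)\<^sup>2)) z) holomorphic_on - \<real>\<^sub>\<le>\<^sub>0"
  proof (rule holomorphic_on_mult[OF _ b], cases "\<mu> = 0")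
    case False
    have "(\<lambda>z. (z / 2) powr \<mu>) holomorphic_on - \<real>\<^sub>\<le>\<^sub>0"
      by (intro holomorphic_intros) (auto simp: complex_nonpos_Reals_iff)
    then show "(\<lambda>z. if \<mu> = 0 then 1 else (z / 2) powr \<mu>) holomorphic_on - \<real>\<^sub>\<le>\<^sub>0" using False by simp
  qed simp
  then show ?thesis by (simp add: Bessel_I_bseries[abs_def] o_def)
qed

text \<open>
  For positive real \<open>Z\<close>, scaling by \<open>2 / Z\<close> turns \<open>mint \<mu> (Z / 2) (Z / 2)\<close> into a multiple of
  \<open>mint \<mu> 1 ((Z / 2)\<^sup>2)\<close>, to which \<open>mint_eq_bseries\<close> applies.
\<close>

lemma Bessel_K_eq_mint_nonint:
  assumes mu: "\<mu> \<notin> \<int>" and Z: "Re Z > 0"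
  shows "of_real pi / 2 * (Bessel_I (- \<mu>) Z - Bessel_I \<mu> Z) / sin (\<mu> * of_real pi) = mint \<mu> (Z / 2) (Z / 2) / 2"
proof -
  have mu0: "\<mu> \<noteq> 0" using mu by auto
  have sn: "sin (\<mu> * of_real pi) \<noteq> 0"
  proof
    assume "sin (\<mu> * of_real pi) = 0"
    then obtain n :: int where "\<mu> * of_real pi = of_real (of_int n * pi)" unfolding sin_eq_0 by auto
    then have "\<mu> = of_int n" by simp
    then show False using mu by auto
  qed
  show ?thesis
  proof (rule holomorphic_eq_from_reals[where S = "{z. Re z > 0}" and a = 0 and b = 1
      and f = "\<lambda>Z. of_real pi / 2 * (Bessel_I (- \<mu>) Z - Bessel_I \<mu> Z) / sin (\<mu> * of_real pi)"
      and g = "\<lambda>Z. mint \<mu> (Z / 2) (Z / 2) / 2"])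
    show "(\<lambda>Z. of_real pi / 2 * (Bessel_I (- \<mu>) Z - Bessel_I \<mu> Z) / sin (\<mu> * of_real pi)) holomorphic_on {z. Re z > 0}"
      using sn by (intro holomorphic_intros holomorphic_on_subset[OF Bessel_I_holomorphic]) (auto simp: complex_nonpos_Reals_iff)
    show "(\<lambda>Z. mint \<mu> (Z / 2) (Z / 2) / 2) holomorphic_on {z. Re z > 0}"
      using mint_holomorphic_args[of \<mu> "1/2" "1/2"] by (intro holomorphic_intros) auto
    fix x :: real assume x: "0 < x" "x < 1"
    let ?x = "complex_of_real x" and ?y = "(x / 2)\<^sup>2"
    have lny: "ln ?y = 2 * ln (x / 2)" using x by (simp add: ln_realpow)
    have "mint \<mu> (?x / 2) (?x / 2) = exp (\<mu> * of_real (ln (2 / x))) * mint \<mu> 1 (of_real ?y)"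
      using mint_scale[of "2 / x" \<mu> "?x / 2" "?x / 2"] x by (simp add: power2_eq_square)
    moreover have "ln (2 / x) = - ln (x / 2)" using x by (simp add: ln_div)
    ultimately have m: "mint \<mu> (?x / 2) (?x / 2) = exp (- \<mu> * of_real (ln (x / 2))) * mint \<mu> 1 (of_real ?y)" by simp
    have p: "(?x / 2) powr s = exp (s * of_real (ln (x / 2)))" for s
      using x Ln_of_real[of "x / 2"] by (simp add: powr_def)
    have "Bessel_I (- \<mu>) ?x - Bessel_I \<mu> ?x =
       exp (- \<mu> * of_real (ln (x / 2))) * (bseries (- \<mu>) (of_real ?y) - exp (\<mu> * of_real (ln ?y)) * bseries \<mu> (of_real ?y))"
      using mu0 by (simp add: Bessel_I_bseries p lny algebra_simps flip: exp_add)
    also have "\<dots> = exp (- \<mu> * of_real (ln (x / 2))) * (mint \<mu> 1 (of_real ?y) * (sin (of_real pi * \<mu>) / of_real pi))"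
      using mint_eq_bseries[of ?y \<mu>] x by simp
    also have "\<dots> = mint \<mu> (?x / 2) (?x / 2) * (sin (\<mu> * of_real pi) / of_real pi)"
      unfolding m by (simp add: mult_ac)
    finally show "of_real pi / 2 * (Bessel_I (- \<mu>) ?x - Bessel_I \<mu> ?x) / sin (\<mu> * of_real pi) = mint \<mu> (?x / 2) (?x / 2) / 2"
      using sn by simp
  qed (use Z in \<open>auto intro!: convex_connected convex_halfspace_Re_gt open_halfspace_Re_gt\<close>)
qed

text \<open>
  At integer orders the definition takes the limit over the order, and the integral is continuous
  in the order.
\<close>

theorem Bessel_K_eq_mint:
  assumes Z: "Re Z > 0"
  shows "Bessel_K \<nu> Z = mint \<nu> (Z / 2) (Z / 2) / 2"
proof (cases "\<nu> \<in> \<int>")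
  case False
  then show ?thesis using Bessel_K_eq_mint_nonint[OF False Z] by (simp add: Bessel_K_def)
next
  case True
  define Q where "Q = (\<lambda>\<mu>. of_real pi / 2 * (Bessel_I (- \<mu>) Z - Bessel_I \<mu> Z) / sin (\<mu> * of_real pi))"
  have "(\<lambda>\<mu>. mint \<mu> (Z / 2) (Z / 2) / 2) holomorphic_on UNIV"
    using Z by (intro holomorphic_intros mint_holomorphic_order) auto
  then have "isCont (\<lambda>\<mu>. mint \<mu> (Z / 2) (Z / 2) / 2) \<nu>"
    by (metis UNIV_I continuous_on_eq_continuous_at holomorphic_on_imp_continuous_on open_UNIV)
  then have l: "((\<lambda>\<mu>. mint \<mu> (Z / 2) (Z / 2) / 2) \<longlongrightarrow> mint \<nu> (Z / 2) (Z / 2) / 2) (at \<nu>)"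
    by (simp add: isCont_def)
  have "eventually (\<lambda>\<mu>. \<mu> \<notin> \<int>) (at \<nu>)"
    unfolding eventually_at
  proof (intro exI[of _ 1] conjI ballI impI notI)
    fix \<mu> :: complex assume "\<mu> \<noteq> \<nu> \<and> dist \<mu> \<nu> < 1" "\<mu> \<in> \<int>"
    moreover obtain m n where "\<mu> = of_int m" "\<nu> = of_int n" using True \<open>\<mu> \<in> \<int>\<close> by (auto elim!: Ints_cases)
    ultimately have "m \<noteq> n" "norm (of_int (m - n) :: complex) < 1" by (auto simp: dist_norm)
    then show False unfolding norm_of_int by linarith
  qed auto
  then have "eventually (\<lambda>\<mu>. mint \<mu> (Z / 2) (Z / 2) / 2 = Q \<mu>) (at \<nu>)"
    by eventually_elim (unfold Q_def, rule Bessel_K_eq_mint_nonint[OF _ Z, symmetric])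
  then have "(Q \<longlongrightarrow> mint \<nu> (Z / 2) (Z / 2) / 2) (at \<nu>)" using l by (rule Lim_transform_eventually[rotated])
  then have "Lim (at \<nu>) Q = mint \<nu> (Z / 2) (Z / 2) / 2" by (intro tendsto_Lim) auto
  then show ?thesis using True by (simp add: Bessel_K_def Q_def Let_def)
qed

section \<open>Beta integrals and the growth of the modified Bessel function of the first kind\<close>

text \<open>
  The integrand of the Beta integral with complex exponents, extended by 0 to the real line.
\<close>

definition bker :: "complex \<Rightarrow> complex \<Rightarrow> real \<Rightarrow> complex" where
  "bker x y t = (if 0 < t \<and> t < 1 then exp ((x - 1) * of_real (ln t) + (y - 1) * of_real (ln (1 - t))) else 0)"

definition rbker :: "real \<Rightarrow> real \<Rightarrow> real \<Rightarrow> real" where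
  "rbker x y t = (if 0 < t \<and> t < 1 then exp ((x - 1) * ln t + (y - 1) * ln (1 - t)) else 0)"

lemma bker_outside: "\<not> (0 < t \<and> t < 1) \<Longrightarrow> bker x y t = 0"
  by (simp only: bker_def if_False)

lemma rbker_outside: "\<not> (0 < t \<and> t < 1) \<Longrightarrow> rbker x y t = 0"
  by (simp only: rbker_def if_False)

lemma bker_measurable [measurable]: "bker x y \<in> borel_measurable borel"
  unfolding bker_def by measurable

lemma norm_bker: "norm (bker x y t) = rbker (Re x) (Re y) t"
  by (simp add: bker_def rbker_def norm_exp_eq_Re)

lemma bker_of_real: "bker (of_real x) (of_real y) t = of_real (rbker x y t)"
  by (simp add: bker_def rbker_def flip: exp_of_real)

lemma rbker_nonneg: "rbker x y t \<ge> 0" by (simp add: rbker_def)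

lemma rbker_eq: "rbker x y = (\<lambda>t. indicator {0..1} t *\<^sub>R (t powr (x - 1) * (1 - t) powr (y - 1)))"
  by (auto simp: rbker_def fun_eq_iff indicator_def powr_def exp_add)

lemma rbker_integrable: "x > 0 \<Longrightarrow> y > 0 \<Longrightarrow> integrable lborel (rbker x y)"
  using integrable_Beta[of x y] by (simp add: set_integrable_def rbker_eq)

lemma bker_integrable: "Re x > 0 \<Longrightarrow> Re y > 0 \<Longrightarrow> integrable lborel (bker x y)"
  by (rule Bochner_Integration.integrable_bound[OF rbker_integrable[of "Re x" "Re y"]]) (auto simp: norm_bker rbker_nonneg)

lemma integral_rbker: "x > 0 \<Longrightarrow> y > 0 \<Longrightarrow> (LINT t|lborel. rbker x y t) = Beta x y"
  using set_borel_integral_eq_integral(2)[OF integrable_Beta[of x y]] has_integral_Beta_real[of x y]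
  by (simp add: set_lebesgue_integral_def rbker_eq integral_unique)

lemma rbker_mono: "x' \<le> x \<Longrightarrow> y' \<le> y \<Longrightarrow> rbker x y t \<le> rbker x' y' t"
  by (auto simp: rbker_def intro!: add_mono mult_right_mono_neg)

lemma bker_holomorphic:
  "Re y > 0 \<Longrightarrow> (\<lambda>x. LINT t|lborel. bker x y t) holomorphic_on {x. Re x > 0}"
  "Re x > 0 \<Longrightarrow> (\<lambda>y. LINT t|lborel. bker x y t) holomorphic_on {y. Re y > 0}"
proof -
  have re: "Re w \<ge> Re z / 2" if "dist w z < Re z / 2" for w z
    using that abs_Re_le_cmod[of "w - z"] by (simp add: dist_norm abs_le_iff)
  show "(\<lambda>x. LINT t|lborel. bker x y t) holomorphic_on {x. Re x > 0}" if y: "Re y > 0"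
  proof (rule holomorphic_integral)
    fix t show "(\<lambda>x. bker x y t) holomorphic_on {x. Re x > 0}"
      unfolding bker_def by (cases "0 < t \<and> t < 1") (auto intro!: holomorphic_intros)
  next
    fix z :: complex assume "z \<in> {x. Re x > 0}"
    then show "\<exists>r>0. \<exists>g. integrable lborel g \<and> (\<forall>w\<in>{x. Re x > 0}. dist w z < r \<longrightarrow> (\<forall>t. norm (bker w y t) \<le> g t))"
      using y re rbker_integrable[of "Re z / 2" "Re y"]
      by (intro exI[of _ "Re z / 2"] conjI exI[of _ "rbker (Re z / 2) (Re y)"]) (auto simp: norm_bker intro!: rbker_mono)
  qed (auto simp: open_halfspace_Re_gt)
  show "(\<lambda>y. LINT t|lborel. bker x y t) holomorphic_on {y. Re y > 0}" if x: "Re x > 0"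
  proof (rule holomorphic_integral)
    fix t show "(\<lambda>y. bker x y t) holomorphic_on {x. Re x > 0}"
      unfolding bker_def by (cases "0 < t \<and> t < 1") (auto intro!: holomorphic_intros)
  next
    fix z :: complex assume "z \<in> {x. Re x > 0}"
    then show "\<exists>r>0. \<exists>g. integrable lborel g \<and> (\<forall>w\<in>{x. Re x > 0}. dist w z < r \<longrightarrow> (\<forall>t. norm (bker x w t) \<le> g t))"
      using x re rbker_integrable[of "Re x" "Re z / 2"]
      by (intro exI[of _ "Re z / 2"] conjI exI[of _ "rbker (Re x) (Re z / 2)"]) (auto simp: norm_bker intro!: rbker_mono)
  qed (auto simp: open_halfspace_Re_gt)
qed

lemma Re_pos_not_nonpos_Int: "Re z > 0 \<Longrightarrow> z \<notin> \<int>\<^sub>\<le>\<^sub>0"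
  by (auto elim!: nonpos_Ints_cases)

text \<open>
  Analytic continuation from real arguments, first in \<open>x\<close> and then in \<open>y\<close>.
\<close>

lemma integral_bker:
  assumes x: "Re x > 0" and y: "Re y > 0"
  shows "(LINT t|lborel. bker x y t) = Beta x y"
proof -
  have cn: "connected {z. Re z > 0}" by (intro convex_connected convex_halfspace_Re_gt)
  have 1: "(LINT t|lborel. bker x (of_real b) t) = Beta x (of_real b)" if "b > 0" for b
  proof (rule holomorphic_eq_from_reals[where S = "{z. Re z > 0}" and a = 0 and b = 1 and f = "\<lambda>x. LINT t|lborel. bker x (of_real b) t" and g = "\<lambda>x. Beta x (of_real b)"])
    show "(\<lambda>x. Beta x (complex_of_real b)) holomorphic_on {z. Re z > 0}"
      using that by (intro holomorphic_intros) (auto intro!: Re_pos_not_nonpos_Int)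
    show "(LINT t|lborel. bker (of_real a) (of_real b) t) = Beta (complex_of_real a) (of_real b)" if "0 < a" for a
      using integral_rbker[OF that \<open>b > 0\<close>] by (simp add: bker_of_real Beta_complex_of_real)
  qed (use x that cn in \<open>auto intro!: bker_holomorphic open_halfspace_Re_gt\<close>)
  show ?thesis
  proof (rule holomorphic_eq_from_reals[where S = "{z. Re z > 0}" and a = 0 and b = 1 and f = "\<lambda>y. LINT t|lborel. bker x y t" and g = "\<lambda>y. Beta x y"])
    show "(\<lambda>y. Beta x y) holomorphic_on {z. Re z > 0}"
      using x by (intro holomorphic_intros) (auto intro!: Re_pos_not_nonpos_Int)
    show "(LINT t|lborel. bker x (of_real b) t) = Beta x (of_real b)" if "0 < b" for b by (rule 1) fact
  qed (use x y cn in \<open>auto intro!: bker_holomorphic open_halfspace_Re_gt\<close>)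
qed

lemma bker_power:
  "bker x y t * of_real t ^ n = bker (x + of_nat n) y t"
proof (cases "0 < t \<and> t < 1")
  case True
  then have "complex_of_real t ^ n = exp (of_nat n * of_real (ln t))"
    by (simp add: exp_of_nat_mult exp_of_real)
  then show ?thesis using True by (simp add: bker_def algebra_simps flip: exp_add)
qed (auto simp: bker_def)

text \<open>
  Termwise integration. Applied to the series of the hyperbolic cosine it yields Poisson's integral for the Bessel
  function, applied to the binomial series Euler's integral for the hypergeometric function.
\<close>

lemma Beta_series_sums:
  assumes x: "Re x > 0" and y: "Re y > 0" and g: "summable (\<lambda>n. norm (g n))"
  shows "(\<lambda>n. g n * Beta (x + of_nat n) y) sums (LINT t|lborel. bker x y t * (\<Sum>n. g n * of_real t ^ n))"
proof -
  let ?f = "\<lambda>n t. g n * bker (x + of_nat n) y t"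
  have le: "norm (?f n t) \<le> norm (g n) * rbker (Re x) (Re y) t" for n t
    by (auto simp: norm_mult norm_bker intro!: mult_left_mono rbker_mono)
  have int: "integrable lborel (?f n)" for n using x y by (intro integrable_mult_right bker_integrable) auto
  have sm: "summable (\<lambda>n. norm (?f n t))" for t
    by (rule summable_comparison_test[OF _ summable_mult2[OF g, of "rbker (Re x) (Re y) t"]]) (use le in auto)
  have "(\<lambda>n. integral\<^sup>L lborel (?f n)) sums (LINT t|lborel. (\<Sum>n. ?f n t))"
  proof (rule sums_integral[OF int])
    show "AE t in lborel. summable (\<lambda>n. norm (?f n t))" using sm by simp
    have "(LINT t|lborel. norm (?f n t)) \<le> norm (g n) * (LINT t|lborel. rbker (Re x) (Re y) t)" for n
    proof -
      have "(LINT t|lborel. norm (?f n t)) \<le> (LINT t|lborel. norm (g n) * rbker (Re x) (Re y) t)"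
        using x y by (intro integral_mono integrable_norm[OF int] integrable_mult_right[OF rbker_integrable] le) auto
      then show ?thesis by simp
    qed
    then show "summable (\<lambda>n. LINT t|lborel. norm (?f n t))"
      by (intro summable_comparison_test[OF _ summable_mult2[OF g, of "LINT t|lborel. rbker (Re x) (Re y) t"]])
         (auto intro!: exI[of _ 0] integral_nonneg_AE AE_I2)
  qed
  moreover have "(\<Sum>n. ?f n t) = bker x y t * (\<Sum>n. g n * of_real t ^ n)" for t
  proof (cases "0 < t \<and> t < 1")
    case True
    have "summable (\<lambda>n. norm (g n * of_real t ^ n))"
      by (rule summable_comparison_test[OF _ g]) (use True in \<open>auto simp: norm_mult norm_power intro!: exI[of _ 0] mult_left_le power_le_one\<close>)
    then have "summable (\<lambda>n. g n * complex_of_real t ^ n)" by (rule summable_norm_cancel)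
    then have "bker x y t * (\<Sum>n. g n * of_real t ^ n) = (\<Sum>n. bker x y t * (g n * of_real t ^ n))"
      by (rule suminf_mult[symmetric])
    then show ?thesis by (simp add: mult.left_commute bker_power)
  qed (simp add: bker_outside)
  moreover have "integral\<^sup>L lborel (?f n) = g n * Beta (x + of_nat n) y" for n
    using x y by (simp add: integral_bker)
  ultimately show ?thesis by (simp only:)
qed

lemma cosh_sqrt_series:
  fixes z :: "'a :: {real_normed_field, banach}"
  assumes "t \<ge> 0"
  shows "(\<lambda>n. z ^ (2 * n) / fact (2 * n) * of_real t ^ n) sums cosh (z * of_real (sqrt t))"
proof -
  have "(\<lambda>n. if even n then (z * of_real (sqrt t)) ^ n /\<^sub>R fact n else 0) sums cosh (z * of_real (sqrt t))"
    by (rule cosh_converges)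
  then have "(\<lambda>n. if even (2 * n) then (z * of_real (sqrt t)) ^ (2 * n) /\<^sub>R fact (2 * n) else 0) sums cosh (z * of_real (sqrt t))"
    by (subst sums_mono_reindex[of "\<lambda>n. 2 * n"]) (auto simp: strict_mono_def elim!: evenE)
  moreover have "of_real (sqrt t) ^ (2 * n) = (of_real t ^ n :: 'a)" for n
    using assms by (simp add: power_mult flip: of_real_power)
  ultimately show ?thesis
    by (simp add: power_mult_distrib scaleR_conv_of_real divide_inverse mult_ac)
qed

lemma norm_cosh_le: "norm (cosh z :: complex) \<le> exp \<bar>Re z\<bar>"
proof -
  have "norm (cosh z) \<le> (norm (exp z) + norm (exp (- z))) / 2"
    unfolding cosh_def using norm_triangle_ineq[of "exp z" "exp (- z)"] by simp
  also have "\<dots> \<le> exp \<bar>Re z\<bar>" by (simp add: norm_exp_eq_Re) (smt (verit) exp_le_cancel_iff)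
  finally show ?thesis .
qed

lemma pochhammer_nonzero: "Re z > 0 \<Longrightarrow> pochhammer z n \<noteq> 0"
proof
  assume "Re z > 0" "pochhammer z n = 0"
  then obtain k where "z = - of_nat k" by (auto simp: pochhammer_eq_0_iff)
  then show False using \<open>Re z > 0\<close> by simp
qed

text \<open>
  By Poisson's integral, \<open>bseries \<nu> ((z / 2)\<^sup>2)\<close> is an average of \<open>cosh (z * sqrt t)\<close> for \<open>0 < t < 1\<close>
  with respect to a complex Beta weight. A bound in terms of \<open>Re z\<close> instead of \<open>norm z\<close> is what the
  decay of the other Bessel function can compensate.
\<close>

lemma bseries_bound:
  assumes nu: "Re \<nu> > - 1/2"
  shows "\<exists>C>0. \<forall>z. norm (bseries \<nu> ((z / 2)\<^sup>2)) \<le> C * exp \<bar>Re z\<bar>"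
proof -
  define D where "D = Gamma (1/2) * Gamma (\<nu> + 1/2 :: complex)"
  define C where "C = Beta (1/2) (Re \<nu> + 1/2) / norm D"
  have np: "\<nu> + 1/2 \<notin> \<int>\<^sub>\<le>\<^sub>0" "(1/2 :: complex) \<notin> \<int>\<^sub>\<le>\<^sub>0"
    using nu by (auto intro!: Re_pos_not_nonpos_Int)
  then have D0: "D \<noteq> 0" by (simp add: D_def Gamma_eq_zero_iff)
  have "norm (bseries \<nu> ((z / 2)\<^sup>2)) \<le> C * exp \<bar>Re z\<bar>" for z
  proof -
    define g where "g = (\<lambda>n. z ^ (2 * n) / fact (2 * n) :: complex)"
    have "(\<lambda>n. norm z ^ (2 * n) / fact (2 * n) * 1 ^ n) sums cosh (norm z * sqrt 1)"
      using cosh_sqrt_series[of 1 "norm z"] by simp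
    then have "summable (\<lambda>n. norm (g n))" by (auto simp: g_def norm_divide norm_power sums_iff)
    then have "(\<lambda>n. g n * Beta (1/2 + of_nat n) (\<nu> + 1/2)) sums (LINT t|lborel. bker (1/2) (\<nu> + 1/2) t * (\<Sum>n. g n * of_real t ^ n))"
      using nu by (intro Beta_series_sums) auto
    moreover have "g n * Beta (1/2 + of_nat n) (\<nu> + 1/2) = D * (rGamma (\<nu> + of_nat n + 1) / fact n * ((z / 2)\<^sup>2) ^ n)" for n
    proof -
      have "Gamma (1/2 + of_nat n :: complex) = Gamma (1/2) * pochhammer (1/2) n"
        using pochhammer_Gamma[of "1/2 :: complex" n] np(2) by (simp add: Gamma_eq_zero_iff)
      then have "g n * Beta (1/2 + of_nat n) (\<nu> + 1/2) = z ^ (2 * n) / fact (2 * n) * pochhammer (1/2) n * D * rGamma (\<nu> + of_nat n + 1)"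
        by (simp add: g_def D_def Beta_altdef add_ac)
      also have "fact (2 * n) = (2 ^ (2 * n) * pochhammer (1/2) n * fact n :: complex)"
        by (simp add: fact_double)
      also have "z ^ (2 * n) / (2 ^ (2 * n) * pochhammer (1/2) n * fact n) * pochhammer (1/2) n * D * rGamma (\<nu> + of_nat n + 1)
         = D * (rGamma (\<nu> + of_nat n + 1) / fact n * ((z / 2)\<^sup>2) ^ n)"
      proof -
        have "pochhammer (1/2 :: complex) n \<noteq> 0" by (rule pochhammer_nonzero) simp
        moreover have "z ^ (2 * n) = (z\<^sup>2) ^ n" "(2 :: complex) ^ (2 * n) = 4 ^ n" "((z / 2)\<^sup>2) ^ n = (z\<^sup>2) ^ n / 4 ^ n"
          by (simp_all add: power_mult power_divide)
        ultimately show ?thesis by (simp add: mult_ac)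
      qed
      finally show ?thesis .
    qed
    ultimately have "(\<lambda>n. D * (rGamma (\<nu> + of_nat n + 1) / fact n * ((z / 2)\<^sup>2) ^ n)) sums (LINT t|lborel. bker (1/2) (\<nu> + 1/2) t * (\<Sum>n. g n * of_real t ^ n))"
      by simp
    moreover have "(\<lambda>n. D * (rGamma (\<nu> + of_nat n + 1) / fact n * ((z / 2)\<^sup>2) ^ n)) sums (D * bseries \<nu> ((z / 2)\<^sup>2))"
      unfolding bseries_def by (intro sums_mult summable_sums summable_norm_cancel[OF summable_bseries])
    ultimately have e: "D * bseries \<nu> ((z / 2)\<^sup>2) = (LINT t|lborel. bker (1/2) (\<nu> + 1/2) t * (\<Sum>n. g n * of_real t ^ n))"
      using sums_unique2 by blast
    have "norm (LINT t|lborel. bker (1/2) (\<nu> + 1/2) t * (\<Sum>n. g n * of_real t ^ n)) \<le> (LINT t|lborel. rbker (1/2) (Re \<nu> + 1/2) t * exp \<bar>Re z\<bar>)"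
    proof (rule norm_integral_le)
      show "integrable lborel (\<lambda>t. rbker (1/2) (Re \<nu> + 1/2) t * exp \<bar>Re z\<bar>)"
        using nu by (intro integrable_mult_left rbker_integrable) auto
      fix t :: real
      show "norm (bker (1/2) (\<nu> + 1/2) t * (\<Sum>n. g n * of_real t ^ n)) \<le> rbker (1/2) (Re \<nu> + 1/2) t * exp \<bar>Re z\<bar>"
      proof (cases "0 < t \<and> t < 1")
        case True
        have "(\<Sum>n. g n * of_real t ^ n) = cosh (z * of_real (sqrt t))"
          using cosh_sqrt_series[of t z] True by (simp add: g_def sums_iff)
        moreover have "\<bar>Re (z * of_real (sqrt t))\<bar> \<le> \<bar>Re z\<bar>"
          using True by (simp add: abs_mult mult_left_le)
        ultimately have "norm (\<Sum>n. g n * of_real t ^ n) \<le> exp \<bar>Re z\<bar>"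
          using norm_cosh_le[of "z * of_real (sqrt t)"] by (smt (verit) exp_le_cancel_iff)
        then show ?thesis by (auto simp: norm_mult norm_bker rbker_nonneg intro!: mult_left_mono)
      qed (simp add: bker_outside rbker_outside)
    qed
    also have "\<dots> = Beta (1/2) (Re \<nu> + 1/2) * exp \<bar>Re z\<bar>" using nu by (simp add: integral_rbker)
    finally show ?thesis unfolding e[symmetric] using D0 by (simp add: C_def norm_mult field_simps)
  qed
  moreover have "C > 0"
    using nu D0 by (auto simp: C_def Beta_def intro!: divide_pos_pos mult_pos_pos Gamma_real_pos)
  ultimately show ?thesis by blast
qed

section \<open>Analytic continuation of the hypergeometric function\<close>

lemma shift_quotient_tendsto: "(\<lambda>n. (a + of_nat n) / (c + of_nat n)) \<longlonglongrightarrow> (1 :: complex)"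
proof -
  have f: "filterlim (\<lambda>n. c + of_nat n :: complex) at_infinity sequentially"
    by (rule tendsto_add_filterlim_at_infinity[OF tendsto_const tendsto_of_nat])
  have "(\<lambda>n. 1 + (a - c) / (c + of_nat n)) \<longlonglongrightarrow> 1 + 0"
    by (intro tendsto_add tendsto_const tendsto_divide_0[OF tendsto_const f])
  moreover have "eventually (\<lambda>n. c + of_nat n \<noteq> 0) sequentially"
    using f by (simp add: filterlim_at_infinity_imp_eventually_ne)
  then have "eventually (\<lambda>n. 1 + (a - c) / (c + of_nat n) = (a + of_nat n) / (c + of_nat n)) sequentially"
    by eventually_elim (simp add: field_simps)
  ultimately show ?thesis by (simp add: tendsto_cong)
qed

lemma summable_hyp2f1:
  assumes z: "norm z < 1"
  shows "summable (\<lambda>n. norm (pochhammer a n * pochhammer b n / (pochhammer c n * fact n) * z ^ n :: complex))"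
proof -
  define f where "f = (\<lambda>n. pochhammer a n * pochhammer b n / (pochhammer c n * fact n) * z ^ n)"
  obtain r where r: "norm z < r" "r < 1" using z dense by blast
  define q where "q = (\<lambda>n. ((a + of_nat n) / (1 + of_nat n)) * ((b + of_nat n) / (c + of_nat n)) * z)"
  have f: "f (Suc n) = f n * q n" for n
    by (simp add: f_def q_def pochhammer_Suc divide_simps)
  have "(\<lambda>n. norm (q n)) \<longlonglongrightarrow> norm (1 * 1 * z)"
    unfolding q_def by (intro tendsto_intros shift_quotient_tendsto)
  then have "eventually (\<lambda>n. norm (q n) < r) sequentially"
    using r(1) by (intro order_tendstoD(2)) auto
  then obtain N where N: "\<And>n. n \<ge> N \<Longrightarrow> norm (q n) < r" by (auto simp: eventually_sequentially)
  have "summable (\<lambda>n. norm (f n))"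
  proof (rule summable_ratio_test[OF r(2)])
    fix n assume "n \<ge> N"
    then show "norm (norm (f (Suc n))) \<le> r * norm (norm (f n))"
      using N[of n] mult_right_mono[of "norm (q n)" r "norm (f n)"] by (simp add: f norm_mult mult_ac)
  qed
  then show ?thesis by (simp add: f_def)
qed

lemma hyp2f1_series_sums:
  "norm z < 1 \<Longrightarrow> (\<lambda>n. pochhammer a n * pochhammer b n / (pochhammer c n * fact n) * z ^ n) sums hyp2f1_series a b c z"
  unfolding hyp2f1_series_def by (intro summable_sums summable_norm_cancel[OF summable_hyp2f1])

text \<open>
  The relation raises \<open>Re b\<close> and keeps \<open>Re b < Re c\<close>, so that repeated use reaches the range of
  Euler's integral.
\<close>

lemma hyp2f1_contiguous:
  assumes z: "norm z < 1" and c: "Re c > 0"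
  shows "hyp2f1_series a b c z = hyp2f1_series a (b + 1) (c + 1) z
     - a * (c - b) / (c * (c + 1)) * (z * hyp2f1_series (a + 1) (b + 1) (c + 2) z)"
proof -
  let ?t = "\<lambda>a b c n. pochhammer a n * pochhammer b n / (pochhammer c n * fact n) * z ^ n"
  let ?d = "\<lambda>n. ?t a (b + 1) (c + 1) n - ?t a b c n"
  have nz: "c \<noteq> 0" "c + 1 \<noteq> 0" "c + 1 + of_nat m \<noteq> 0" "pochhammer (c + 1) m \<noteq> 0" for m
    using c pochhammer_nonzero[of "c + 1" m] by (auto simp: complex_eq_iff)
  have "?d sums (hyp2f1_series a (b + 1) (c + 1) z - hyp2f1_series a b c z)"
    by (intro sums_diff hyp2f1_series_sums z)
  then have "(\<lambda>n. ?d (Suc n)) sums (hyp2f1_series a (b + 1) (c + 1) z - hyp2f1_series a b c z)"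
    by (subst sums_Suc_iff) simp
  moreover have "?d (Suc m) = a * (c - b) / (c * (c + 1)) * (z * ?t (a + 1) (b + 1) (c + 2) m)" for m
  proof -
    define P where "P = pochhammer (a + 1) m * pochhammer (b + 1) m"
    define Q where "Q = pochhammer (c + 1) m"
    have q: "pochhammer (c + 1) (Suc m) = Q * (c + 1 + of_nat m)" "pochhammer c (Suc m) = c * Q"
      unfolding Q_def by (rule pochhammer_Suc, rule pochhammer_rec)
    have q2: "(c + 1) * pochhammer (c + 2) m = Q * (c + 1 + of_nat m)"
      using q(1) pochhammer_rec[of "c + 1" m] by (simp add: add_ac)
    have "?d (Suc m) = a * P * z ^ Suc m / (Q * (1 + of_nat m) * fact m) * ((b + 1 + of_nat m) / (c + 1 + of_nat m) - b / c)"
      using nz nz(3)[of m] nz(4)[of m] unfolding q pochhammer_Suc[of "b + 1"] pochhammer_rec[of a m] pochhammer_rec[of b m] fact_Suc P_def Q_def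
      by (simp add: divide_simps) (simp add: algebra_simps)
    also have "(b + 1 + of_nat m) / (c + 1 + of_nat m) - b / c = (c - b) * (1 + of_nat m) / (c * (c + 1 + of_nat m))"
      using nz nz(3)[of m] by (simp add: divide_simps) (simp add: algebra_simps)
    also have "a * P * z ^ Suc m / (Q * (1 + of_nat m) * fact m) * ((c - b) * (1 + of_nat m) / (c * (c + 1 + of_nat m)))
       = a * (c - b) * (P * z ^ Suc m) / (c * (Q * (c + 1 + of_nat m)) * fact m)"
      using of_nat_neq_0[of m, where ?'a = complex] by (simp add: divide_simps)
    also have "\<dots> = a * (c - b) / (c * (c + 1)) * (z * ?t (a + 1) (b + 1) (c + 2) m)"
      unfolding q2[symmetric] P_def by (simp add: mult_ac)
    finally show ?thesis .
  qed
  moreover have "(\<lambda>m. a * (c - b) / (c * (c + 1)) * (z * ?t (a + 1) (b + 1) (c + 2) m)) sums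
     (a * (c - b) / (c * (c + 1)) * (z * hyp2f1_series (a + 1) (b + 1) (c + 2) z))"
    by (intro sums_mult hyp2f1_series_sums z)
  ultimately have "hyp2f1_series a (b + 1) (c + 1) z - hyp2f1_series a b c z =
      a * (c - b) / (c * (c + 1)) * (z * hyp2f1_series (a + 1) (b + 1) (c + 2) z)"
    by (simp only: sums_unique2)
  then show ?thesis by (simp add: algebra_simps)
qed

lemma open_cut_plane: "open (- (of_real ` {1..}) :: complex set)"
proof -
  have "(of_real ` {1..} :: complex set) = {w. Re w \<ge> 1} \<inter> {w. Im w = 0}"
    by (auto simp: complex_eq_iff image_iff)
  then show ?thesis
    by (auto intro!: open_Compl closed_Int closed_halfspace_Re_ge closed_Collect_eq continuous_intros)
qed

text \<open>
  The base of the power in Euler's integral stays off the branch cut.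
\<close>

lemma one_minus_mult_cut_plane:
  fixes z :: complex
  assumes "z \<notin> of_real ` {1..}" "0 \<le> t" "t \<le> 1"
  shows "1 - z * of_real t \<notin> \<real>\<^sub>\<le>\<^sub>0"
proof
  assume "1 - z * of_real t \<in> \<real>\<^sub>\<le>\<^sub>0"
  then obtain r where r: "r \<le> 0" "1 - z * of_real t = of_real r" by (auto elim!: nonpos_Reals_cases)
  then have zt: "z * of_real t = of_real (1 - r)" by (simp add: algebra_simps)
  have t0: "t \<noteq> 0" using zt r(1) by (auto simp: complex_eq_iff)
  then have "z = z * of_real t / of_real t" by simp
  then have "z = of_real ((1 - r) / t)" unfolding zt by simp
  moreover have "(1 - r) / t \<ge> 1" using r(1) assms t0 by (simp add: field_simps)
  ultimately show False using assms(1) by (metis atLeast_iff imageI)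
qed

text \<open>
  Euler's integral is holomorphic on the cut plane and has the right power series on the disc, by the
  binomial series for \<open>(1 - z * t) powr (- a)\<close>.
\<close>

lemma hyp2f1_extension_base:
  assumes b: "Re b > 0" and cb: "Re c > Re b"
  shows "\<exists>f. f holomorphic_on - (of_real ` {1..}) \<and> (\<forall>u\<in>ball 0 1. f u = hyp2f1_series a b c u)"
proof -
  define F where "F = (\<lambda>z. (LINT t|lborel. bker b (c - b) t * (1 - z * of_real t) powr (- a)) / Beta b (c - b))"
  have B0: "Beta b (c - b) \<noteq> 0"
    using b cb Re_pos_not_nonpos_Int[of b] Re_pos_not_nonpos_Int[of "c - b"] Re_pos_not_nonpos_Int[of c]
    by (simp add: Beta_def Gamma_eq_zero_iff)
  have cut: "1 - z * of_real t \<notin> \<real>\<^sub>\<le>\<^sub>0" if "z \<in> - (of_real ` {1..})" "0 \<le> t" "t \<le> 1" for z :: complex and t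
    using that by (intro one_minus_mult_cut_plane) auto
  have "(\<lambda>z. LINT t|lborel. bker b (c - b) t * (1 - z * of_real t) powr (- a)) holomorphic_on - (of_real ` {1..})"
  proof (rule holomorphic_integral[OF open_cut_plane])
    fix t :: real
    show "(\<lambda>z. bker b (c - b) t * (1 - z * of_real t) powr (- a)) holomorphic_on - (of_real ` {1..})"
    proof (cases "0 < t \<and> t < 1")
      case True
      then have "1 - z * of_real t \<notin> \<real>\<^sub>\<le>\<^sub>0" if "z \<in> - (of_real ` {1..})" for z :: complex
        using that by (intro cut) auto
      then show ?thesis by (intro holomorphic_intros)
    qed (simp add: bker_outside)
  next
    fix w :: complex
    show "(\<lambda>t. bker b (c - b) t * (1 - w * of_real t) powr (- a)) \<in> borel_measurable lborel"
      unfolding powr_def by measurable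
  next
    fix z :: complex assume "z \<in> - (of_real ` {1..})"
    then obtain r where r: "r > 0" "cball z r \<subseteq> - (of_real ` {1..})"
      using open_cut_plane open_contains_cball by blast
    have n: "1 - fst p * of_real (snd p) \<notin> \<real>\<^sub>\<le>\<^sub>0" if "p \<in> cball z r \<times> {0..1::real}" for p
      using that r(2) by (intro cut) auto
    have "continuous_on (cball z r \<times> {0..1::real}) (\<lambda>p. exp (- a * Ln (1 - fst p * of_real (snd p))))"
      by (intro continuous_intros n)
    moreover have "exp (- a * Ln (1 - fst p * of_real (snd p))) = (1 - fst p * of_real (snd p)) powr (- a)" if "p \<in> cball z r \<times> {0..1::real}" for p
      using n[OF that] by (auto simp: powr_def)
    ultimately have "continuous_on (cball z r \<times> {0..1::real}) (\<lambda>p. (1 - fst p * of_real (snd p)) powr (- a))"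
      by (simp cong: continuous_on_cong)
    then have "bounded ((\<lambda>p. (1 - fst p * of_real (snd p)) powr (- a)) ` (cball z r \<times> {0..1::real}))"
      by (intro compact_imp_bounded compact_continuous_image compact_Times) auto
    then obtain M where M: "\<And>w t. w \<in> cball z r \<Longrightarrow> 0 \<le> t \<Longrightarrow> t \<le> 1 \<Longrightarrow> norm ((1 - w * of_real t) powr (- a)) \<le> M"
      unfolding bounded_iff by fastforce
    have "norm (bker b (c - b) t * (1 - w * of_real t) powr (- a)) \<le> rbker (Re b) (Re (c - b)) t * M" if "w \<in> cball z r" for w t
    proof (cases "0 < t \<and> t < 1")
      case True
      then show ?thesis using M[of w t] that by (auto simp: norm_mult norm_bker rbker_nonneg intro!: mult_left_mono)
    qed (simp add: bker_outside rbker_outside)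
    then show "\<exists>r>0. \<exists>g. integrable lborel g \<and> (\<forall>w\<in>- (of_real ` {1..}). dist w z < r \<longrightarrow>
        (\<forall>t. norm (bker b (c - b) t * (1 - w * of_real t) powr (- a)) \<le> g t))"
      using r(1) b cb
      by (intro exI[of _ r] conjI exI[of _ "\<lambda>t. rbker (Re b) (Re (c - b)) t * M"] integrable_mult_left rbker_integrable) (auto simp: dist_commute)
  qed
  then have hol: "F holomorphic_on - (of_real ` {1..})"
    unfolding F_def using B0 by (intro holomorphic_intros) auto
  have "F z = hyp2f1_series a b c z" if z: "norm z < 1" for z
  proof -
    define g where "g = (\<lambda>n. pochhammer a n / fact n * z ^ n)"
    have "summable (\<lambda>n. norm (g n))"
      using summable_hyp2f1[OF z, of a 1 1] by (simp add: g_def pochhammer_fact flip: pochhammer_fact)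
    then have s: "(\<lambda>n. g n * Beta (b + of_nat n) (c - b)) sums (LINT t|lborel. bker b (c - b) t * (\<Sum>n. g n * of_real t ^ n))"
      using b cb by (intro Beta_series_sums) auto
    have e: "bker b (c - b) t * (\<Sum>n. g n * of_real t ^ n) = bker b (c - b) t * (1 - z * of_real t) powr (- a)" for t
    proof (cases "0 < t \<and> t < 1")
      case True
      have "norm (- (z * of_real t)) < 1"
        using z True by (simp add: norm_mult) (meson le_less_trans less_imp_le mult_left_le norm_ge_zero)
      then have "(\<lambda>n. ((- a) gchoose n) * (- (z * of_real t)) ^ n) sums (1 + - (z * of_real t)) powr (- a)"
        by (rule gen_binomial_complex)
      also have "(\<lambda>n. ((- a) gchoose n) * (- (z * of_real t)) ^ n) = (\<lambda>n. g n * of_real t ^ n)"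
        by (auto simp: g_def gbinomial_pochhammer power_mult_distrib power_minus[of "z * _"] fun_eq_iff)
      finally show ?thesis by (simp add: sums_iff)
    qed (simp add: bker_outside)
    have bt: "Beta (b + of_nat n) (c - b) = Beta b (c - b) * (pochhammer b n / pochhammer c n)" for n
    proof -
      have "b \<notin> \<int>\<^sub>\<le>\<^sub>0" "c \<notin> \<int>\<^sub>\<le>\<^sub>0" using b cb by (auto intro!: Re_pos_not_nonpos_Int)
      then show ?thesis
        by (simp add: Beta_def pochhammer_Gamma Gamma_eq_zero_iff add.commute)
    qed
    have "(\<lambda>n. Beta b (c - b) * (pochhammer a n * pochhammer b n / (pochhammer c n * fact n) * z ^ n)) sums
        (LINT t|lborel. bker b (c - b) t * (1 - z * of_real t) powr (- a))"
      using s unfolding e bt by (simp add: g_def mult_ac)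
    moreover have "(\<lambda>n. Beta b (c - b) * (pochhammer a n * pochhammer b n / (pochhammer c n * fact n) * z ^ n)) sums
        (Beta b (c - b) * hyp2f1_series a b c z)"
      by (intro sums_mult hyp2f1_series_sums z)
    ultimately show ?thesis unfolding F_def using B0 sums_unique2 by (auto simp: field_simps)
  qed
  then show ?thesis using hol by auto
qed

lemma hyp2f1_extension:
  assumes "Re c > 0" "Re c > Re b"
  shows "\<exists>f. f holomorphic_on - (of_real ` {1..}) \<and> (\<forall>u\<in>ball 0 1. f u = hyp2f1_series a b c u)"
proof -
  obtain m :: nat where "Re b > - real m" using reals_Archimedean2[of "- Re b"] by (auto simp: minus_less_iff)
  then show ?thesis using assms
  proof (induction m arbitrary: a b c)
    case 0
    then show ?case by (intro hyp2f1_extension_base) auto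
  next
    case (Suc m)
    obtain f where f: "f holomorphic_on - (of_real ` {1..})" "\<And>u. u \<in> ball 0 1 \<Longrightarrow> f u = hyp2f1_series a (b + 1) (c + 1) u"
      using Suc.IH[of "b + 1" "c + 1" a] Suc.prems by auto
    obtain g where g: "g holomorphic_on - (of_real ` {1..})" "\<And>u. u \<in> ball 0 1 \<Longrightarrow> g u = hyp2f1_series (a + 1) (b + 1) (c + 2) u"
      using Suc.IH[of "b + 1" "c + 2" "a + 1"] Suc.prems by auto
    show ?case
    proof (intro exI conjI ballI)
      show "(\<lambda>u. f u - a * (c - b) / (c * (c + 1)) * (u * g u)) holomorphic_on - (of_real ` {1..})"
        by (intro holomorphic_on_diff holomorphic_on_mult holomorphic_on_const holomorphic_on_ident f g)
      show "f u - a * (c - b) / (c * (c + 1)) * (u * g u) = hyp2f1_series a b c u" if "u \<in> ball 0 1" for u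
        using that Suc.prems f(2)[OF that] g(2)[OF that] hyp2f1_contiguous[of u c a b] by simp
    qed
  qed
qed

lemma hyp2f1_holomorphic:
  assumes "Re c > 0" "Re c > Re b"
  shows "hyp2f1 a b c holomorphic_on - (of_real ` {1..})"
proof -
  obtain f where f: "f holomorphic_on - (of_real ` {1..})" "\<And>u. u \<in> ball 0 1 \<Longrightarrow> f u = hyp2f1_series a b c u"
    using hyp2f1_extension[OF assms] by blast
  show ?thesis
    by (rule holomorphic_transform[OF f(1)]) (use hyp2f1_eqI[OF f] in auto)
qed

section \<open>The inversion formula of the theta function\<close>

text \<open>
  The Gaussian \<open>exp (- \<pi> * u * z\<^sup>2)\<close>, its sum \<open>gper\<close> over all integer translates (grouped in pairs
  \<open>gpair\<close>), and the exponentials \<open>efun m\<close> of period 1. The inversion formula equates the value of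
  \<open>gper\<close> at 0, which is \<open>theta u\<close>, to the sum of its Fourier coefficients, which is
  \<open>theta (1 / u) / sqrt u\<close>. That the Fourier series of \<open>gper\<close> converges at 0 is shown by Chernoff's
  argument.
\<close>

definition gauss :: "real \<Rightarrow> complex \<Rightarrow> complex" where
  "gauss u z = exp (- of_real (pi * u) * z\<^sup>2)"

definition efun :: "int \<Rightarrow> complex \<Rightarrow> complex" where
  "efun m z = exp (of_int m * (2 * of_real pi * \<i>) * z)"

lemma norm_efun_real: "norm (efun m (of_real x)) = 1"
  by (simp add: efun_def norm_exp_eq_Re)

lemma efun_period: "efun m (z + of_int n) = efun m z"
proof -
  have "exp (of_int m * (2 * of_real pi * \<i>) * of_int n) = (1::complex)"
    using exp_integer_2pi[of "of_int (m * n)"] by (simp add: mult_ac)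
  then show ?thesis by (simp add: efun_def distrib_left exp_add)
qed

lemma efun_holomorphic: "efun m holomorphic_on A"
  unfolding efun_def by (intro holomorphic_intros)

lemma gauss_holomorphic: "(\<lambda>z. gauss u (z + c)) holomorphic_on A"
  unfolding gauss_def by (intro holomorphic_intros)

lemma norm_gauss_le:
  assumes u: "u > 0" and z: "norm z \<le> R" and d: "d = 1 \<or> d = - 1" and n: "real n \<ge> R + 1"
  shows "norm (gauss u (z + of_real (d * real n))) \<le> exp (pi * u * (R\<^sup>2 + R)) * exp (- pi * u) ^ n"
proof -
  have re: "Re ((z + of_real (d * real n))\<^sup>2) = (Re z + d * real n)\<^sup>2 - (Im z)\<^sup>2"
    by (simp add: power2_eq_square)
  have a: "\<bar>Re z\<bar> \<le> R" "\<bar>Im z\<bar> \<le> R" using z abs_Re_le_cmod[of z] abs_Im_le_cmod[of z] by linarith+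
  then have "(Im z)\<^sup>2 \<le> R\<^sup>2" by (simp add: abs_le_square_iff[symmetric])
  moreover have "real n - R \<le> (Re z + d * real n)\<^sup>2"
  proof -
    have "real n - R \<le> \<bar>Re z + d * real n\<bar>" using a d by auto
    moreover have "1 \<le> real n - R" using n by simp
    ultimately have "(real n - R) * 1 \<le> \<bar>Re z + d * real n\<bar> * \<bar>Re z + d * real n\<bar>" by (intro mult_mono) auto
    then show ?thesis by (simp add: power2_eq_square)
  qed
  ultimately have "real n - R - R\<^sup>2 \<le> Re ((z + of_real (d * real n))\<^sup>2)" unfolding re by linarith
  then have "pi * u * (real n - R - R\<^sup>2) \<le> pi * u * Re ((z + of_real (d * real n))\<^sup>2)"
    using u by (intro mult_left_mono) auto
  then have "norm (gauss u (z + of_real (d * real n))) \<le> exp (- (pi * u * (real n - R - R\<^sup>2)))"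
    by (simp add: gauss_def norm_exp_eq_Re)
  also have "\<dots> = exp (pi * u * (R\<^sup>2 + R)) * exp (- pi * u) ^ n"
    by (simp add: algebra_simps flip: exp_of_nat_mult exp_add)
  finally show ?thesis .
qed

definition gpair :: "real \<Rightarrow> nat \<Rightarrow> complex \<Rightarrow> complex" where
  "gpair u n z = gauss u (z + of_nat (Suc n)) + gauss u (z - of_nat (Suc n))"

definition gper :: "real \<Rightarrow> complex \<Rightarrow> complex" where
  "gper u z = gauss u z + (\<Sum>n. gpair u n z)"

lemma gpair_bound:
  assumes u: "u > 0"
  shows "\<exists>N g. summable g \<and> (\<forall>n z. n \<ge> N \<longrightarrow> norm z \<le> R \<longrightarrow> norm (gpair u n z) \<le> g n)"
proof -
  obtain N :: nat where N: "real N \<ge> R + 1" using real_arch_simple by blast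
  let ?g = "\<lambda>n. 2 * (exp (pi * u * (R\<^sup>2 + R)) * exp (- pi * u) ^ Suc n)"
  have "summable ?g"
    using u by (intro summable_mult summable_Suc_iff[THEN iffD2] summable_geometric) auto
  moreover have "norm (gpair u n z) \<le> ?g n" if "n \<ge> N" "norm z \<le> R" for n z
  proof -
    have "real (Suc n) \<ge> R + 1" using that N by linarith
    then have "norm (gauss u (z + of_real (d * real (Suc n)))) \<le> exp (pi * u * (R\<^sup>2 + R)) * exp (- pi * u) ^ Suc n"
      if "d = 1 \<or> d = - 1" for d using that \<open>norm z \<le> R\<close> u by (intro norm_gauss_le) auto
    note * = this
    have "norm (gauss u (z + of_nat (Suc n))) \<le> exp (pi * u * (R\<^sup>2 + R)) * exp (- pi * u) ^ Suc n"
      using *[of 1] by simp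
    moreover have "z + of_real (- 1 * real (Suc n)) = z - of_nat (Suc n)" by simp
    then have "norm (gauss u (z - of_nat (Suc n))) \<le> exp (pi * u * (R\<^sup>2 + R)) * exp (- pi * u) ^ Suc n"
      using *[of "- 1"] by (simp only: simp_thms)
    ultimately show ?thesis
      unfolding gpair_def using norm_triangle_ineq[of "gauss u (z + of_nat (Suc n))" "gauss u (z - of_nat (Suc n))"] by linarith
  qed
  ultimately show ?thesis by blast
qed

lemma gper_holomorphic:
  assumes u: "u > 0" shows "gper u holomorphic_on UNIV"
proof -
  have g: "gpair u n holomorphic_on UNIV" for n
    unfolding gpair_def gauss_def by (intro holomorphic_intros)
  have "(\<lambda>z. \<Sum>n. gpair u n z) holomorphic_on UNIV"
  proof (rule holomorphic_suminf[OF open_UNIV g])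
    fix z :: complex
    obtain N g where *: "summable g" "\<And>n w. n \<ge> N \<Longrightarrow> norm w \<le> norm z + 1 \<Longrightarrow> norm (gpair u n w) \<le> g n"
      using gpair_bound[OF u] by blast
    have "norm w \<le> norm z + 1" if "dist w z \<le> 1" for w
      using that norm_triangle_ineq2[of w z] by (simp add: dist_norm)
    then show "\<exists>r>0. \<exists>N g. summable g \<and> (\<forall>n\<ge>N. \<forall>w\<in>UNIV. dist w z \<le> r \<longrightarrow> norm (gpair u n w) \<le> g n)"
      using * by (intro exI[of _ 1] conjI exI[of _ N] exI[of _ g]) auto
  qed
  then show ?thesis unfolding gper_def using gauss_holomorphic[of u 0] by (intro holomorphic_intros) simp
qed

text \<open>
  The characteristic function of the standard normal distribution, after scaling.
\<close>

lemma fourier_gauss: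
  assumes u: "u > 0"
  shows "integrable lborel (\<lambda>x. gauss u (of_real x) * efun m (- of_real x))"
    and "(LINT x|lborel. gauss u (of_real x) * efun m (- of_real x)) = of_real (exp (- pi * (of_int m)\<^sup>2 / u) / sqrt u)"
proof -
  define s where "s = sqrt (2 * pi * u)"
  have s: "s > 0" "s\<^sup>2 = 2 * pi * u" using u by (simp_all add: s_def)
  define t where "t = - 2 * pi * of_int m / s"
  define h where "h = (\<lambda>x. std_normal_density x *\<^sub>R iexp (t * x))"
  have hi: "integrable lborel h"
  proof (rule Bochner_Integration.integrable_bound[OF integrable_normal_density[of 1 0]])
    show "h \<in> borel_measurable lborel" unfolding h_def by measurable
    show "AE x in lborel. norm (h x) \<le> norm (std_normal_density x)"
      by (intro AE_I2) (simp add: h_def)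
  qed simp
  have "char std_normal_distribution t = (LINT x|lborel. h x)"
    unfolding char_def h_def by (subst integral_density) auto
  then have hv: "(LINT x|lborel. h x) = of_real (exp (- (t\<^sup>2) / 2))"
    by (simp add: char_std_normal_distribution)
  have e: "gauss u (of_real x) * efun m (- of_real x) = of_real (sqrt (2 * pi)) * h (0 + s * x)" for x
  proof -
    have 1: "(s * x)\<^sup>2 / 2 = pi * u * x\<^sup>2" using s(2) by (simp add: power_mult_distrib)
    have "std_normal_density (s * x) = exp (- (pi * u * x\<^sup>2)) / sqrt (2 * pi)"
      unfolding std_normal_density_def using 1 by simp
    moreover have "t * (s * x) = - 2 * pi * of_int m * x" using s by (simp add: t_def)
    then have "iexp (t * (s * x)) = efun m (- of_real x)" by (simp only: efun_def) (simp add: mult_ac)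
    ultimately show ?thesis
      unfolding h_def add_0 by (simp add: gauss_def efun_def scaleR_conv_of_real exp_of_real[symmetric] mult_ac)
  qed
  show "integrable lborel (\<lambda>x. gauss u (of_real x) * efun m (- of_real x))"
    unfolding e using s hi by (intro integrable_mult_right lborel_integrable_real_affine) auto
  have "(LINT x|lborel. h x) = \<bar>s\<bar> *\<^sub>R (LINT x|lborel. h (0 + s * x))"
    using s by (intro lborel_integral_real_affine) auto
  then have "(LINT x|lborel. h (0 + s * x)) = of_real (exp (- (t\<^sup>2) / 2)) / of_real s"
    using s hv by (simp add: scaleR_conv_of_real field_simps)
  then have "(LINT x|lborel. gauss u (of_real x) * efun m (- of_real x)) = of_real (sqrt (2 * pi)) * (of_real (exp (- (t\<^sup>2) / 2)) / of_real s)"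
    unfolding e by simp
  also have "t\<^sup>2 / 2 = pi * (of_int m)\<^sup>2 / u"
    using u s by (simp add: t_def power_divide power_mult_distrib) (simp add: power2_eq_square field_simps)
  then have "- (t\<^sup>2) / 2 = - pi * (of_int m)\<^sup>2 / u" by simp
  also have "of_real (sqrt (2 * pi)) * (of_real (exp (- pi * (of_int m)\<^sup>2 / u)) / of_real s) = (of_real (exp (- pi * (of_int m)\<^sup>2 / u) / sqrt u) :: complex)"
    using u by (simp add: s_def real_sqrt_mult)
  finally show "(LINT x|lborel. gauss u (of_real x) * efun m (- of_real x)) = of_real (exp (- pi * (of_int m)\<^sup>2 / u) / sqrt u)" .
qed

text \<open>
  The translates of the unit interval by \<open>- N, \<dots>, N\<close> tile an interval of length \<open>2 * N + 1\<close>, and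
  \<open>efun m\<close> does not see integer translations.
\<close>

lemma gper_partial_integral:
  "((\<lambda>x. (gauss u (of_real x) + (\<Sum>n<N. gpair u n (of_real x))) * efun m (- of_real x)) has_integral
     integral {- real N - 1/2..real N + 1/2} (\<lambda>x. gauss u (of_real x) * efun m (- of_real x))) {-1/2..1/2}"
proof (induction N)
  case 0
  have "(\<lambda>x. gauss u (of_real x) * efun m (- of_real x)) integrable_on {-1/2..1/2}"
    unfolding gauss_def efun_def by (intro integrable_continuous_real continuous_intros)
  then show ?case by (simp add: has_integral_integral)
next
  case (Suc N)
  let ?h = "\<lambda>x::real. gauss u (of_real x) * efun m (- of_real x)"
  have int: "?h integrable_on {a..b}" for a b
    unfolding gauss_def efun_def by (intro integrable_continuous_real continuous_intros)
  have shift: "((\<lambda>x. gauss u (of_real x + of_int k) * efun m (- of_real x)) has_integral integral {of_int k - 1/2..of_int k + 1/2} ?h) {-1/2..1/2}" for k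
  proof -
    have "(?h has_integral integral {of_int k - 1/2..of_int k + 1/2} ?h) (cbox (of_int k - 1/2) (of_int k + 1/2))"
      unfolding cbox_interval using int by (rule integrable_integral)
    from has_integral_affinity[OF this, of 1 "of_int k"]
    have "((\<lambda>x. ?h (1 *\<^sub>R x + of_int k)) has_integral integral {of_int k - 1/2..of_int k + 1/2} ?h) ((\<lambda>x. (1/1) *\<^sub>R x + - ((1/1) *\<^sub>R of_int k)) ` cbox (of_int k - 1/2) (of_int k + 1/2))"
      by simp
    moreover have "(\<lambda>x::real. (1/1) *\<^sub>R x + - ((1/1) *\<^sub>R of_int k)) ` cbox (of_int k - 1/2) (of_int k + 1/2) = {-1/2..1/2}"
    proof -
      have "(\<lambda>x::real. x - of_int k) ` {of_int k - 1/2..of_int k + 1/2} = {-1/2..1/2}"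
        using image_add_atLeastAtMost[of "- of_int k" "of_int k - 1/2" "of_int k + 1/2 :: real"] by (simp add: add.commute)
      then show ?thesis by simp
    qed
    moreover have "efun m (- of_real (x + of_int k)) = efun m (- of_real x)" for x
      using efun_period[of m "- of_real x" "- k"] by simp
    ultimately show ?thesis by simp
  qed
  have c1: "integral {- real N - 1/2..real N + 1/2} ?h + integral {real N + 1/2..real (Suc N) + 1/2} ?h = integral {- real N - 1/2..real (Suc N) + 1/2} ?h"
    by (rule Henstock_Kurzweil_Integration.integral_combine) (use int in auto)
  have c2: "integral {- real (Suc N) - 1/2..- real N - 1/2} ?h + integral {- real N - 1/2..real (Suc N) + 1/2} ?h = integral {- real (Suc N) - 1/2..real (Suc N) + 1/2} ?h"
    by (rule Henstock_Kurzweil_Integration.integral_combine) (use int in auto)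
  have c3: "of_int (int (Suc N)) - 1/2 = real N + 1/2" "of_int (int (Suc N)) + 1/2 = real (Suc N) + 1/2"
    "of_int (- int (Suc N)) - 1/2 = - real (Suc N) - 1/2" "of_int (- int (Suc N)) + 1/2 = - real N - 1/2" by simp_all
  have fe: "(gauss u (of_real x) + (\<Sum>n<N. gpair u n (of_real x))) * efun m (- of_real x)
      + gauss u (of_real x + of_int (int (Suc N))) * efun m (- of_real x)
      + gauss u (of_real x + of_int (- int (Suc N))) * efun m (- of_real x)
      = (gauss u (of_real x) + (\<Sum>n<Suc N. gpair u n (of_real x))) * efun m (- of_real x)" for x
    by (simp add: gpair_def distrib_right del: of_nat_Suc)
  have "((\<lambda>x. (gauss u (of_real x) + (\<Sum>n<N. gpair u n (of_real x))) * efun m (- of_real x)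
      + gauss u (of_real x + of_int (int (Suc N))) * efun m (- of_real x)
      + gauss u (of_real x + of_int (- int (Suc N))) * efun m (- of_real x)) has_integral
     integral {- real N - 1/2..real N + 1/2} ?h + integral {of_int (int (Suc N)) - 1/2..of_int (int (Suc N)) + 1/2} ?h
      + integral {of_int (- int (Suc N)) - 1/2..of_int (- int (Suc N)) + 1/2} ?h) {-1/2..1/2}"
    by (intro has_integral_add Suc.IH shift)
  then show ?case unfolding fe c3 using c1 c2 by (simp only: add.commute)
qed

lemma gper_fourier:
  assumes u: "u > 0"
  shows "((\<lambda>x. gper u (of_real x) * efun m (- of_real x)) has_integral of_real (exp (- pi * (of_int m)\<^sup>2 / u) / sqrt u)) {-1/2..1/2}"
proof -
  let ?h = "\<lambda>x::real. gauss u (of_real x) * efun m (- of_real x)"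
  let ?f = "\<lambda>N x::real. (gauss u (of_real x) + (\<Sum>n<N. gpair u n (of_real x))) * efun m (- of_real x)"
  obtain N0 g where g: "summable g" "\<And>n w. n \<ge> N0 \<Longrightarrow> norm w \<le> 1 \<Longrightarrow> norm (gpair u n w) \<le> g n"
    using gpair_bound[OF u] by blast
  have ul: "uniform_limit (cball 0 1) (\<lambda>N z. \<Sum>n<N. gpair u n z) (\<lambda>z. \<Sum>n. gpair u n z) sequentially"
    by (rule uniform_limit_suminf[of N0 _ _ g]) (use g in auto)
  have ul2: "uniform_limit {-1/2..1/2} (\<lambda>N x. \<Sum>n<N. gpair u n (complex_of_real x)) (\<lambda>x. \<Sum>n. gpair u n (of_real x)) sequentially"
    by (rule uniform_limit_compose'[OF ul]) auto
  have ul3: "uniform_limit {-1/2..1/2} ?f (\<lambda>x. gper u (of_real x) * efun m (- of_real x)) sequentially"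
  proof (rule uniform_limitI)
    fix e :: real assume "e > 0"
    with ul2 have "eventually (\<lambda>N. \<forall>x\<in>{-1/2..1/2}. dist (\<Sum>n<N. gpair u n (complex_of_real x)) (\<Sum>n. gpair u n (of_real x)) < e) sequentially"
      by (rule uniform_limitD)
    then show "eventually (\<lambda>N. \<forall>x\<in>{-1/2..1/2}. dist (?f N x) (gper u (of_real x) * efun m (- of_real x)) < e) sequentially"
    proof eventually_elim
      case (elim N)
      have "dist (?f N x) (gper u (of_real x) * efun m (- of_real x)) = dist (\<Sum>n<N. gpair u n (complex_of_real x)) (\<Sum>n. gpair u n (of_real x))" for x
        using norm_efun_real[of m "- x"] unfolding dist_norm gper_def left_diff_distrib[symmetric] norm_mult by simp
      then show ?case using elim by simp
    qed
  qed
  obtain I J where IJ: "\<And>N. (?f N has_integral I N) {-1/2..1/2}" "((\<lambda>x. gper u (of_real x) * efun m (- of_real x)) has_integral J) {-1/2..1/2}" "I \<longlonglongrightarrow> J"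
  proof (rule uniform_limit_integral[OF ul3])
    show "continuous_on {-1/2..1/2} (?f N)" for N
      unfolding gpair_def gauss_def efun_def by (intro continuous_intros)
  qed (use that in auto)
  have I: "I N = integral {- real N - 1/2..real N + 1/2} ?h" for N
    using has_integral_unique[OF IJ(1) gper_partial_integral] .
  have "(\<lambda>N. LINT x|lborel. indicator {- real N - 1/2..real N + 1/2} x *\<^sub>R ?h x) \<longlonglongrightarrow> (LINT x|lborel. ?h x)"
  proof (rule integral_dominated_convergence)
    show "integrable lborel (\<lambda>x. norm (?h x))" using fourier_gauss(1)[OF u] by (rule integrable_norm)
    show "?h \<in> borel_measurable lborel" using fourier_gauss(1)[OF u] by auto
    show "(\<lambda>x. indicator {- real N - 1/2..real N + 1/2} x *\<^sub>R ?h x) \<in> borel_measurable lborel" for N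
      using fourier_gauss(1)[OF u] by (intro borel_measurable_scaleR borel_measurable_indicator) auto
    show "AE x in lborel. (\<lambda>N. indicator {- real N - 1/2..real N + 1/2} x *\<^sub>R ?h x) \<longlonglongrightarrow> ?h x"
    proof (intro AE_I2 tendsto_eventually)
      fix x :: real
      obtain N :: nat where "\<bar>x\<bar> \<le> real N" using real_arch_simple by blast
      then show "eventually (\<lambda>N. indicator {- real N - 1/2..real N + 1/2} x *\<^sub>R ?h x = ?h x) sequentially"
        by (intro eventually_sequentiallyI[of N]) (auto simp: indicator_def)
    qed
    show "AE x in lborel. norm (indicator {- real N - 1/2..real N + 1/2} x *\<^sub>R ?h x) \<le> norm (?h x)" for N
      by (intro AE_I2) (auto simp: indicator_def)
  qed
  moreover have "(LINT x|lborel. indicator {- real N - 1/2..real N + 1/2} x *\<^sub>R ?h x) = I N" for N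
  proof -
    have "set_integrable lborel {- real N - 1/2..real N + 1/2} ?h"
      using fourier_gauss(1)[OF u] unfolding set_integrable_def by (intro integrable_mult_indicator) auto
    then show ?thesis unfolding I using set_borel_integral_eq_integral(2) by (simp add: set_lebesgue_integral_def)
  qed
  ultimately have "I \<longlonglongrightarrow> of_real (exp (- pi * (of_int m)\<^sup>2 / u) / sqrt u)" by (simp add: fourier_gauss(2)[OF u])
  then show ?thesis using IJ(2,3) LIMSEQ_unique by blast
qed

lemma efun_integral: "((\<lambda>x. efun m (- of_real x)) has_integral (if m = 0 then 1 else 0)) {-1/2..1/2}"
proof (cases "m = 0")
  case False
  define c where "c = - of_int m * (2 * of_real pi * \<i>)"
  have c: "c \<noteq> 0" using False by (simp add: c_def)
  have "((\<lambda>x. exp (c * of_real x)) has_integral exp (c * of_real (1/2)) / c - exp (c * of_real (- 1/2)) / c) {-1/2..1/2::real}"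
  proof (rule fundamental_theorem_of_calculus)
    fix x :: real assume "x \<in> {-1/2..1/2}"
    have "((\<lambda>z. exp (c * z) / c) has_field_derivative exp (c * of_real x)) (at (of_real x))"
      using c by (auto intro!: derivative_eq_intros)
    then show "((\<lambda>x. exp (c * of_real x) / c) has_vector_derivative exp (c * of_real x)) (at x within {-1/2..1/2})"
      by (rule has_vector_derivative_real_field)
  qed simp
  moreover have "exp (c * of_real (1/2)) = exp (c * of_real (- 1/2))"
    using efun_period[of m "- 1/2" 1] by (simp add: efun_def c_def)
  ultimately show ?thesis using False by (simp add: efun_def c_def mult_ac)
qed (auto simp: efun_def intro!: has_integral_const_real[THEN has_integral_eq_rhs])

text \<open>
  In the strip \<open>\<bar>Re z\<bar> < 1\<close> the denominator \<open>efun 1 z - 1\<close> vanishes only at 0, to first order, where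
  the numerator vanishes too.
\<close>

lemma periodised_gauss_quotient:
  assumes u: "u > 0"
  obtains F where "F holomorphic_on {z. \<bar>Re z\<bar> < 1}"
    "\<And>z. \<bar>Re z\<bar> < 1 \<Longrightarrow> gper u z - gper u 0 = (efun 1 z - 1) * F z"
proof -
  let ?S = "{z. \<bar>Re z\<bar> < 1} :: complex set"
  have S: "open ?S"
  proof -
    have "?S = {z. Re z < 1} \<inter> {z. Re z > - 1}" by auto
    then show ?thesis by (simp add: open_Int open_halfspace_Re_gt open_halfspace_Re_lt)
  qed
  have nz: "efun 1 z - 1 \<noteq> 0" if "z \<in> ?S" "z \<noteq> 0" for z
  proof
    assume "efun 1 z - 1 = 0"
    then obtain n :: int where n: "Re (2 * of_real pi * \<i> * z) = 0" "Im (2 * of_real pi * \<i> * z) = of_int (2 * n) * pi"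
      unfolding efun_def by (auto simp: exp_eq_1)
    then have "Im z = 0" "Re z = of_int n" by auto
    moreover from this that have "n = 0" by auto
    ultimately show False using that by (simp add: complex_eq_iff)
  qed
  \<comment> \<open>At 0 the quotient of the derivatives fills the removable singularity.\<close>
  define F where "F = (\<lambda>z. if z = 0 then deriv (gper u) 0 / (2 * of_real pi * \<i>) else (gper u z - gper u 0) / (efun 1 z - 1))"
  have h: "F holomorphic_on ?S - {0}"
  proof -
    have "(\<lambda>z. (gper u z - gper u 0) / (efun 1 z - 1)) holomorphic_on ?S - {0}"
      by (intro holomorphic_intros holomorphic_on_subset[OF gper_holomorphic[OF u]] efun_holomorphic) (use nz in auto)
    then show ?thesis by (rule holomorphic_transform) (auto simp: F_def)
  qed
  have c0: "isCont F 0"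
  proof -
    have 1: "((\<lambda>z. (gper u z - gper u 0) / z) \<longlongrightarrow> deriv (gper u) 0) (at 0)"
      using holomorphic_derivI[OF gper_holomorphic[OF u], of 0] by (simp add: has_field_derivative_iff)
    have "(efun 1 has_field_derivative 2 * of_real pi * \<i>) (at 0)"
      unfolding efun_def by (auto intro!: derivative_eq_intros)
    then have 2: "((\<lambda>z. (efun 1 z - 1) / z) \<longlongrightarrow> 2 * of_real pi * \<i>) (at 0)"
      by (simp add: has_field_derivative_iff efun_def)
    have "((\<lambda>z. ((gper u z - gper u 0) / z) / ((efun 1 z - 1) / z)) \<longlongrightarrow> deriv (gper u) 0 / (2 * of_real pi * \<i>)) (at 0)"
      by (rule tendsto_divide[OF 1 2]) simp
    moreover have "eventually (\<lambda>z. ((gper u z - gper u 0) / z) / ((efun 1 z - 1) / z) = F z) (at 0)"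
      by (auto simp: eventually_at_filter F_def)
    ultimately show ?thesis unfolding isCont_def by (simp add: F_def tendsto_cong)
  qed
  have "continuous_on ?S F"
  proof -
    have "isCont F z" if "z \<in> ?S" for z
    proof (cases "z = 0")
      case False
      have "open (?S - {0})" using S by (intro open_Diff) auto
      then show ?thesis using holomorphic_on_imp_continuous_on[OF h] that False by (auto simp: continuous_on_eq_continuous_at)
    qed (use c0 in simp)
    then show ?thesis by (simp add: continuous_at_imp_continuous_on)
  qed
  then have "F holomorphic_on ?S"
    by (rule no_isolated_singularity[OF _ h S]) auto
  moreover have "gper u z - gper u 0 = (efun 1 z - 1) * F z" if "\<bar>Re z\<bar> < 1" for z
    using nz[of z] that by (cases "z = 0") (auto simp: F_def efun_def)
  ultimately show ?thesis using that by blast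
qed

text \<open>
  Integration by parts.
\<close>

lemma fourier_coeff_decay:
  assumes F: "F holomorphic_on {z. \<bar>Re z\<bar> < 1}"
  obtains K where "\<And>m. m \<noteq> 0 \<Longrightarrow> norm (integral {-1/2..1/2} (\<lambda>x. F (of_real x) * efun m (- of_real x))) \<le> K / \<bar>of_int m\<bar>"
proof -
  let ?S = "{z. \<bar>Re z\<bar> < 1} :: complex set"
  have S: "open ?S"
  proof -
    have "?S = {z. Re z < 1} \<inter> {z. Re z > - 1}" by auto
    then show ?thesis by (simp add: open_Int open_halfspace_Re_gt open_halfspace_Re_lt)
  qed
  have in_S: "complex_of_real x \<in> ?S" if "x \<in> {-1/2..1/2}" for x using that by auto
  have hd: "deriv F holomorphic_on ?S" using F S by (rule holomorphic_deriv)
  have cF: "continuous_on {-1/2..1/2} (\<lambda>x. F (of_real x))" "continuous_on {-1/2..1/2} (\<lambda>x. deriv F (of_real x))"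
    using holomorphic_on_imp_continuous_on[OF F] holomorphic_on_imp_continuous_on[OF hd] in_S
    by (auto intro!: continuous_on_compose2[where g = F and t = ?S] continuous_on_compose2[where g = "deriv F" and t = ?S] continuous_intros)
  obtain A where A: "\<And>x. x \<in> {-1/2..1/2} \<Longrightarrow> norm (F (of_real x)) \<le> A"
    using continuous_on_compact_bound[OF compact_Icc cF(1)] by blast
  obtain B where B: "\<And>x. x \<in> {-1/2..1/2} \<Longrightarrow> norm (deriv F (of_real x)) \<le> B"
    using continuous_on_compact_bound[OF compact_Icc cF(2)] by blast
  have "norm (integral {-1/2..1/2} (\<lambda>x. F (of_real x) * efun m (- of_real x))) \<le> (2 * A + B) / \<bar>of_int m\<bar>" if m: "m \<noteq> 0" for m
  proof -
    define c where "c = - of_int m * (2 * of_real pi * \<i>)"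
    have c: "c \<noteq> 0" using m by (simp add: c_def)
    have ee: "efun m (- z) = exp (c * z)" for z by (simp add: efun_def c_def)
    have ne: "norm (exp (c * of_real x)) = 1" for x using norm_efun_real[of m "- x"] by (simp add: ee)
    define D where "D = (\<lambda>x. deriv F (of_real x) * exp (c * of_real x) + c * (F (of_real x) * exp (c * of_real x)))"
    have "(D has_integral F (of_real (1/2)) * exp (c * of_real (1/2)) - F (of_real (- 1/2)) * exp (c * of_real (- 1/2))) {-1/2..1/2::real}"
    proof (rule fundamental_theorem_of_calculus)
      fix x :: real assume x: "x \<in> {-1/2..1/2}"
      have "(F has_field_derivative deriv F (of_real x)) (at (of_real x))"
        using holomorphic_derivI[OF F S in_S[OF x]] .
      then have "((\<lambda>z. F z * exp (c * z)) has_field_derivative D x) (at (of_real x))"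
        unfolding D_def by (auto intro!: derivative_eq_intros)
      then show "((\<lambda>x. F (of_real x) * exp (c * of_real x)) has_vector_derivative D x) (at x within {-1/2..1/2})"
        by (rule has_vector_derivative_real_field)
    qed simp
    then have 1: "integral {-1/2..1/2} D = F (of_real (1/2)) * exp (c * of_real (1/2)) - F (of_real (- 1/2)) * exp (c * of_real (- 1/2))"
      by (rule integral_unique)
    have i1: "(\<lambda>x. deriv F (of_real x) * exp (c * of_real x)) integrable_on {-1/2..1/2}"
      and i2: "(\<lambda>x. F (of_real x) * exp (c * of_real x)) integrable_on {-1/2..1/2}"
      by (intro integrable_continuous_real continuous_intros cF)+
    have "integral {-1/2..1/2} D = integral {-1/2..1/2} (\<lambda>x. deriv F (of_real x) * exp (c * of_real x)) + c * integral {-1/2..1/2} (\<lambda>x. F (of_real x) * exp (c * of_real x))"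
      unfolding D_def using i1 i2 by (subst integral_add) (auto intro: integrable_on_mult_right)
    then have "c * integral {-1/2..1/2} (\<lambda>x. F (of_real x) * exp (c * of_real x)) =
       F (of_real (1/2)) * exp (c * of_real (1/2)) - F (of_real (- 1/2)) * exp (c * of_real (- 1/2)) - integral {-1/2..1/2} (\<lambda>x. deriv F (of_real x) * exp (c * of_real x))"
      using 1 by (simp only: eq_diff_eq add.commute)
    then have "norm c * norm (integral {-1/2..1/2} (\<lambda>x. F (of_real x) * exp (c * of_real x))) =
       norm (F (of_real (1/2)) * exp (c * of_real (1/2)) - F (of_real (- 1/2)) * exp (c * of_real (- 1/2)) - integral {-1/2..1/2} (\<lambda>x. deriv F (of_real x) * exp (c * of_real x)))"
      by (simp flip: norm_mult)
    also have "\<dots> \<le> A + A + B"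
    proof -
      have "norm (integral {-1/2..1/2} (\<lambda>x. deriv F (of_real x) * exp (c * of_real x))) \<le> B * (1/2 - (- 1/2))"
      proof (rule integral_bound)
        show "continuous_on {-1/2..1/2} (\<lambda>x. deriv F (of_real x) * exp (c * of_real x))" by (intro continuous_intros cF)
        show "norm (deriv F (of_real x) * exp (c * of_real x)) \<le> B" if "x \<in> {-1/2..1/2}" for x
          unfolding norm_mult ne using B[OF that] by simp
      qed simp
      moreover have "norm (F (of_real (1/2)) * exp (c * of_real (1/2))) \<le> A" "norm (F (of_real (- 1/2)) * exp (c * of_real (- 1/2))) \<le> A"
        unfolding norm_mult ne using A[of "1/2"] A[of "- 1/2"] by simp_all
      ultimately show ?thesis
        by (intro order.trans[OF norm_triangle_ineq4] add_mono) auto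
    qed
    finally have *: "norm c * norm (integral {-1/2..1/2} (\<lambda>x. F (of_real x) * exp (c * of_real x))) \<le> 2 * A + B" by simp
    have "\<bar>of_int m\<bar> \<le> norm c" using pi_gt3 mult_left_mono[of 1 "2 * pi" "\<bar>real_of_int m\<bar>"] by (simp add: c_def norm_mult)
    then have "\<bar>of_int m\<bar> * norm (integral {-1/2..1/2} (\<lambda>x. F (of_real x) * exp (c * of_real x))) \<le> 2 * A + B"
      using * mult_right_mono by (meson norm_ge_zero order_trans)
    then show ?thesis using m by (simp add: ee field_simps)
  qed
  then show ?thesis using that by blast
qed

text \<open>
  The theta function on the imaginary axis, that is, the sum of \<open>exp (- \<pi> * n\<^sup>2 * u)\<close> over all
  integers \<open>n\<close>.
\<close>

definition theta :: "real \<Rightarrow> real" where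
  "theta u = 1 + 2 * (\<Sum>n. exp (- pi * (real (Suc n))\<^sup>2 * u))"

lemma gper_0:
  assumes u: "u > 0" shows "gper u 0 = of_real (theta u)" "summable (\<lambda>n. exp (- pi * (real (Suc n))\<^sup>2 * u))"
proof -
  have e: "gpair u n 0 = of_real (2 * exp (- pi * (real (Suc n))\<^sup>2 * u))" for n
  proof -
    have "gauss u (of_nat (Suc n)) = of_real (exp (- pi * (real (Suc n))\<^sup>2 * u))"
      unfolding gauss_def exp_of_real[symmetric] by (simp add: mult_ac del: of_nat_Suc)
    moreover have "gauss u (- z) = gauss u z" for z by (simp add: gauss_def)
    ultimately show ?thesis unfolding gpair_def by (simp del: of_nat_Suc)
  qed
  obtain N0 g where g: "summable g" "\<And>n w. n \<ge> N0 \<Longrightarrow> norm w \<le> 1 \<Longrightarrow> norm (gpair u n w) \<le> g n"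
    using gpair_bound[OF u] by blast
  have "summable (\<lambda>n. gpair u n 0)"
    by (rule summable_comparison_test_ev[OF _ g(1)]) (use g(2) in \<open>auto intro!: eventually_sequentiallyI[of N0]\<close>)
  then have s: "summable (\<lambda>n. 2 * exp (- pi * (real (Suc n))\<^sup>2 * u))"
    unfolding e by (simp only: summable_of_real_iff)
  then show s': "summable (\<lambda>n. exp (- pi * (real (Suc n))\<^sup>2 * u))" using summable_mult[of _ "1/2"] by fastforce
  have "(\<Sum>n. gpair u n 0) = of_real (\<Sum>n. 2 * exp (- pi * (real (Suc n))\<^sup>2 * u))"
    unfolding e using suminf_of_real[OF s, where ?'a = complex] by simp
  also have "(\<Sum>n. 2 * exp (- pi * (real (Suc n))\<^sup>2 * u)) = 2 * (\<Sum>n. exp (- pi * (real (Suc n))\<^sup>2 * u))"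
    by (rule suminf_mult[OF s'])
  finally show "gper u 0 = of_real (theta u)" by (simp add: gper_def theta_def gauss_def)
qed

lemma add_diff_shuffle: "a + (b + c) - d = (a + b - d) + (c :: complex)"
  by simp

text \<open>
  Chernoff's argument: with \<open>gper u z - gper u 0 = (efun 1 z - 1) * F z\<close>, the \<open>m\<close>-th Fourier coefficient
  of the left-hand side is \<open>g (m - 1) - g m\<close> for the Fourier coefficients \<open>g\<close> of \<open>F\<close>. So the symmetric
  partial sums telescope, and they tend to 0 as \<open>g\<close> tends to 0 at both ends.
\<close>

theorem theta_inversion:
  assumes u: "u > 0" shows "theta (1 / u) = sqrt u * theta u"
proof -
  obtain F where F: "F holomorphic_on {z. \<bar>Re z\<bar> < 1}"
    "\<And>z. \<bar>Re z\<bar> < 1 \<Longrightarrow> gper u z - gper u 0 = (efun 1 z - 1) * F z"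
    using periodised_gauss_quotient[OF u] by blast
  obtain K where K: "\<And>m. m \<noteq> 0 \<Longrightarrow> norm (integral {-1/2..1/2} (\<lambda>x. F (of_real x) * efun m (- of_real x))) \<le> K / \<bar>of_int m\<bar>"
    using fourier_coeff_decay[OF F(1)] by blast
  define g where "g = (\<lambda>m. integral {-1/2..1/2} (\<lambda>x. F (of_real x) * efun m (- of_real x)))"
  define c where "c = (\<lambda>m::int. complex_of_real (exp (- pi * (of_int m)\<^sup>2 / u) / sqrt u))"
  have "continuous_on {-1/2..1/2::real} (\<lambda>x. F (of_real x))"
    using holomorphic_on_imp_continuous_on[OF F(1)]
    by (auto intro!: continuous_on_compose2[where g = F and t = "{z. \<bar>Re z\<bar> < 1}"] continuous_intros)
  then have gi: "((\<lambda>x. F (of_real x) * efun m (- of_real x)) has_integral g m) {-1/2..1/2}" for m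
    unfolding g_def efun_def by (intro integrable_integral integrable_continuous_real continuous_intros)
  \<comment> \<open>Multiplication by \<open>efun 1\<close> shifts the Fourier coefficients of \<open>F\<close>.\<close>
  have tel: "c m - gper u 0 * (if m = 0 then 1 else 0) = g (m - 1) - g m" for m
  proof -
    have "((\<lambda>x. gper u (of_real x) * efun m (- of_real x) - gper u 0 * efun m (- of_real x)) has_integral (c m - gper u 0 * (if m = 0 then 1 else 0))) {-1/2..1/2}"
      unfolding c_def by (intro has_integral_diff gper_fourier[OF u] has_integral_mult_right efun_integral)
    moreover have "gper u (of_real x) * efun m (- of_real x) - gper u 0 * efun m (- of_real x) =
        F (of_real x) * efun (m - 1) (- of_real x) - F (of_real x) * efun m (- of_real x)" if "x \<in> {-1/2..1/2}" for x
    proof -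
      have "efun (m - 1) (- of_real x) = efun 1 (of_real x) * efun m (- of_real x)"
        by (simp add: efun_def algebra_simps flip: exp_add)
      then have "F (of_real x) * efun (m - 1) (- of_real x) - F (of_real x) * efun m (- of_real x)
          = (efun 1 (of_real x) - 1) * F (of_real x) * efun m (- of_real x)" by (simp add: left_diff_distrib)
      also have "(efun 1 (of_real x) - 1) * F (of_real x) = gper u (of_real x) - gper u 0"
      proof (rule F(2)[symmetric])
        show "\<bar>Re (complex_of_real x)\<bar> < 1" using that by auto
      qed
      finally show ?thesis by (simp add: left_diff_distrib)
    qed
    ultimately have "((\<lambda>x. F (of_real x) * efun (m - 1) (- of_real x) - F (of_real x) * efun m (- of_real x)) has_integral (c m - gper u 0 * (if m = 0 then 1 else 0))) {-1/2..1/2}"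
      by (rule has_integral_eq[rotated])
    then show ?thesis using has_integral_diff[OF gi[of "m - 1"] gi[of m]] has_integral_unique by blast
  qed
  have S: "c 0 + (\<Sum>n<N. c (int (Suc n)) + c (- int (Suc n))) - gper u 0 = g (- int N - 1) - g (int N)" for N
  proof (induction N)
    case 0
    show ?case using tel[of 0] by simp
  next
    case (Suc N)
    have 1: "c (int (Suc N)) = g (int N) - g (int (Suc N))" using tel[of "int (Suc N)"] by simp
    have e: "- int N - 1 = - int (Suc N)" by simp
    have 2: "c (- int (Suc N)) = g (- int (Suc N) - 1) - g (- int (Suc N))" using tel[of "- int (Suc N)"] by simp
    have "c 0 + (\<Sum>n<Suc N. c (int (Suc n)) + c (- int (Suc n))) - gper u 0
       = (c 0 + (\<Sum>n<N. c (int (Suc n)) + c (- int (Suc n))) - gper u 0) + (c (int (Suc N)) + c (- int (Suc N)))"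
      unfolding sum.lessThan_Suc by (rule add_diff_shuffle)
    also have "\<dots> = g (- int (Suc N) - 1) - g (int (Suc N))" unfolding Suc 1 2 e by simp
    finally show ?case .
  qed
  have z1: "(\<lambda>N. g (int N)) \<longlonglongrightarrow> 0"
  proof (rule Lim_null_comparison)
    show "eventually (\<lambda>N. norm (g (int N)) \<le> K / real N) sequentially"
      using eventually_gt_at_top[of 0] by eventually_elim (use K[of "int _"] in \<open>auto simp: g_def\<close>)
  qed (rule lim_const_over_n)
  have z2: "(\<lambda>N. g (- int N - 1)) \<longlonglongrightarrow> 0"
  proof (rule Lim_null_comparison)
    show "eventually (\<lambda>N. norm (g (- int N - 1)) \<le> K / real (Suc N)) sequentially"
    proof (intro always_eventually allI)
      fix N
      have "\<bar>real_of_int (- int N - 1)\<bar> = real (Suc N)" by simp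
      then show "norm (g (- int N - 1)) \<le> K / real (Suc N)" using K[of "- int N - 1"] by (simp add: g_def)
    qed
    show "(\<lambda>N. K / real (Suc N)) \<longlonglongrightarrow> 0" using LIMSEQ_Suc[OF lim_const_over_n[of K]] .
  qed
  have "(\<lambda>N. c 0 + (\<Sum>n<N. c (int (Suc n)) + c (- int (Suc n))) - gper u 0) \<longlonglongrightarrow> 0 - 0"
    unfolding S by (intro tendsto_diff z1 z2)
  then have lim: "(\<lambda>N. c 0 + (\<Sum>n<N. c (int (Suc n)) + c (- int (Suc n)))) \<longlonglongrightarrow> gper u 0"
    by (simp add: LIM_zero_iff)
  have u': "1 / u > 0" using u by simp
  have "(\<lambda>n. 2 * exp (- pi * (real (Suc n))\<^sup>2 * (1 / u)) / sqrt u) sums ((theta (1 / u) - 1) / sqrt u)"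
    using sums_divide[OF sums_mult[OF summable_sums[OF gper_0(2)[OF u']], of 2]] by (simp add: theta_def)
  then have "(\<lambda>N. 1 / sqrt u + (\<Sum>n<N. 2 * exp (- pi * (real (Suc n))\<^sup>2 * (1 / u)) / sqrt u)) \<longlonglongrightarrow> 1 / sqrt u + (theta (1 / u) - 1) / sqrt u"
    unfolding sums_def by (intro tendsto_intros)
  then have "(\<lambda>N. complex_of_real (1 / sqrt u + (\<Sum>n<N. 2 * exp (- pi * (real (Suc n))\<^sup>2 * (1 / u)) / sqrt u))) \<longlonglongrightarrow> of_real (1 / sqrt u + (theta (1 / u) - 1) / sqrt u)"
    by (rule tendsto_of_real)
  also have "(\<lambda>N. complex_of_real (1 / sqrt u + (\<Sum>n<N. 2 * exp (- pi * (real (Suc n))\<^sup>2 * (1 / u)) / sqrt u))) =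
      (\<lambda>N. c 0 + (\<Sum>n<N. c (int (Suc n)) + c (- int (Suc n))))"
    by (simp add: c_def del: of_nat_Suc)
  finally have "gper u 0 = of_real (1 / sqrt u + (theta (1 / u) - 1) / sqrt u)"
    using lim LIMSEQ_unique by blast
  then have "theta u = 1 / sqrt u + (theta (1 / u) - 1) / sqrt u"
    unfolding gper_0(1)[OF u] of_real_eq_iff .
  then show ?thesis using u by (simp add: field_simps)
qed

section \<open>Powers of the theta function and sums of squares\<close>

text \<open>
  This turns the \<open>k\<close>-th power of a sum over the integers into a sum over integer vectors, for the theta
  function as well as for a majorant of \<open>r\<^sub>k\<close>.
\<close>

lemma has_sum_lists_prod:
  fixes w :: "'a \<Rightarrow> real"
  assumes S: "(w has_sum S) UNIV" and nn: "\<And>x. w x \<ge> 0"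
  shows "((\<lambda>xs. prod_list (map w xs)) has_sum S ^ k) {xs. length xs = k}"
proof (induction k)
  case 0
  have "{xs :: 'a list. length xs = 0} = {[]}" by auto
  then show ?case by (intro has_sum_finiteI) auto
next
  case (Suc k)
  let ?P = "\<lambda>xs. prod_list (map w xs)" and ?L = "{xs :: 'a list. length xs = k}"
  let ?f = "\<lambda>p. w (fst p) * ?P (snd p)"
  have Pnn: "?P xs \<ge> 0" for xs by (induction xs) (simp_all add: nn)
  have img: "{xs :: 'a list. length xs = Suc k} = (\<lambda>(x, xs). x # xs) ` (UNIV \<times> ?L)"
    by (auto simp: image_iff length_Suc_conv)
  have P: "?P summable_on ?L" "infsum ?P ?L = S ^ k" using Suc by (auto simp: has_sum_iff)
  have W: "w summable_on UNIV" "infsum w UNIV = S" using S by (auto simp: has_sum_iff)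
  have s: "?f summable_on (UNIV \<times> ?L)"
  proof (rule Infinite_Sum.abs_summable_summable, subst Infinite_Sum.abs_summable_on_Sigma_iff, intro conjI ballI)
    show "(\<lambda>y. norm (?f (x, y))) summable_on ?L" for x
      using P by (simp add: nn Pnn abs_mult summable_on_cmult_right)
    show "(\<lambda>x. norm (infsum (\<lambda>y. norm (?f (x, y))) ?L)) summable_on UNIV"
      using W P nn Pnn by (simp add: abs_mult infsum_cmult_right' summable_on_cmult_left infsum_nonneg abs_of_nonneg)
  qed
  have "infsum ?f (UNIV \<times> ?L) = infsum (\<lambda>x. infsum (\<lambda>y. ?f (x, y)) ?L) UNIV"
    using infsum_Sigma_banach[OF s] by simp
  also have "\<dots> = S ^ Suc k" using P W by (simp add: infsum_cmult_right' infsum_cmult_left')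
  finally have "(?f has_sum S ^ Suc k) (UNIV \<times> ?L)" using s by (simp add: has_sum_iff)
  then show ?case unfolding img
    by (subst has_sum_reindex) (auto simp: inj_on_def o_def case_prod_unfold)
qed

definition sqsum :: "int list \<Rightarrow> nat" where "sqsum xs = nat (\<Sum>x\<leftarrow>xs. x ^ 2)"

lemma int_sqsum: "int (sqsum xs) = (\<Sum>x\<leftarrow>xs. x ^ 2)"
  by (auto simp: sqsum_def intro!: sum_list_nonneg)

lemma sqsum_simps [simp]: "sqsum [] = 0" "sqsum (x # xs) = nat (x ^ 2) + sqsum xs"
proof -
  show "sqsum [] = 0" by (simp add: sqsum_def)
  have "int (sqsum (x # xs)) = int (nat (x ^ 2) + sqsum xs)" by (simp add: int_sqsum)
  then show "sqsum (x # xs) = nat (x ^ 2) + sqsum xs" by (simp only: of_nat_eq_iff)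
qed

lemma sum_squares_reps_eq: "sum_squares_reps k n = card {xs. length xs = k \<and> sqsum xs = n}"
proof -
  have "(\<Sum>x\<leftarrow>xs. x ^ 2) = int n \<longleftrightarrow> sqsum xs = n" for xs :: "int list"
    unfolding int_sqsum[symmetric] by simp
  then show ?thesis by (simp add: sum_squares_reps_def)
qed

lemma le_sqsum: "x \<in> set xs \<Longrightarrow> x\<^sup>2 \<le> int (sqsum xs)"
  by (induction xs) (auto simp: add_increasing add_increasing2)

lemma finite_sqsum: "finite {xs. length xs = k \<and> sqsum xs = n}"
proof (rule finite_subset)
  show "{xs. length xs = k \<and> sqsum xs = n} \<subseteq> {xs. set xs \<subseteq> {- int n..int n} \<and> length xs = k}"
  proof safe
    fix xs x assume "x \<in> set xs" "n = sqsum xs"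
    then have "x\<^sup>2 \<le> int n" using le_sqsum by simp
    moreover have "\<bar>x\<bar> \<le> x\<^sup>2" by (cases "x = 0") (auto simp: power2_eq_square abs_mult_self_eq[of x, symmetric] mult_le_cancel_left1 simp del: abs_mult_self_eq)
    ultimately show "x \<in> {- int (sqsum xs)..int (sqsum xs)}" using \<open>n = sqsum xs\<close> by auto
  qed
qed (intro finite_lists_length_eq, simp)

text \<open>
  Lists of length \<open>k\<close> are grouped by their sums of squares.
\<close>

lemma sums_reps:
  fixes F :: "nat \<Rightarrow> real"
  assumes "((\<lambda>xs. F (sqsum xs)) has_sum S) {xs. length xs = k}"
  shows "(\<lambda>n. real (sum_squares_reps k n) * F n) sums S"
proof -
  let ?B = "\<lambda>n. {xs. length xs = k \<and> sqsum xs = n}"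
  have "snd ` (Sigma UNIV ?B) = {xs. length xs = k}" by force
  then have "((\<lambda>xs. F (sqsum xs)) has_sum S) (snd ` (Sigma UNIV ?B))" using assms by simp
  then have "(((\<lambda>xs. F (sqsum xs)) \<circ> snd) has_sum S) (Sigma UNIV ?B)"
    by (subst (asm) has_sum_reindex) (auto simp: inj_on_def)
  moreover have "((\<lambda>xs. ((\<lambda>xs. F (sqsum xs)) \<circ> snd) (n, xs)) has_sum (real (sum_squares_reps k n) * F n)) (?B n)" for n
    by (rule has_sum_finiteI[OF finite_sqsum]) (simp add: sum_squares_reps_eq)
  ultimately have "((\<lambda>n. real (sum_squares_reps k n) * F n) has_sum S) UNIV"
    by (rule has_sum_SigmaD)
  then show ?thesis by (rule has_sum_imp_sums)
qed

lemma has_sum_int_even: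
  fixes w :: "int \<Rightarrow> real"
  assumes ev: "\<And>x. w (- x) = w x" and nn: "\<And>x. w x \<ge> 0" and s: "summable (\<lambda>n. w (int (Suc n)))"
  shows "(w has_sum (w 0 + 2 * (\<Sum>n. w (int (Suc n))))) UNIV"
proof -
  let ?p = "\<lambda>n. int (Suc n)" and ?n = "\<lambda>n. - int (Suc n)" and ?T = "\<Sum>n. w (int (Suc n))"
  have T: "((\<lambda>n. w (int (Suc n))) has_sum ?T) UNIV"
    using s nn by (intro sums_nonneg_imp_has_sum summable_sums)
  have a: "(w has_sum ?T) (range ?p)" using T by (subst has_sum_reindex) (auto simp: inj_def o_def)
  have b: "(w has_sum ?T) (range ?n)" using T ev by (subst has_sum_reindex) (auto simp: inj_def o_def simp del: of_nat_Suc)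
  have c: "(w has_sum w 0) {0}" by (rule has_sum_finiteI) auto
  have "(w has_sum (w 0 + (?T + ?T))) ({0} \<union> (range ?p \<union> range ?n))"
    by (intro has_sum_Un_disjoint a b c) auto
  moreover have "{0} \<union> (range ?p \<union> range ?n) = UNIV"
  proof -
    have "x \<in> {0} \<union> (range ?p \<union> range ?n)" for x :: int
    proof -
      consider "x = 0" | "x = ?p (nat (x - 1))" | "x = ?n (nat (- x - 1))" by linarith
      then show ?thesis by cases blast+
    qed
    then show ?thesis by blast
  qed
  ultimately show ?thesis by (simp only: mult_2)
qed

lemma theta_has_sum:
  assumes "u > 0"
  shows "((\<lambda>x::int. exp (- pi * (of_int x)\<^sup>2 * u)) has_sum theta u) UNIV"
  using has_sum_int_even[of "\<lambda>x. exp (- pi * (of_int x)\<^sup>2 * u)"] gper_0(2)[OF assms]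
  by (simp add: theta_def)

lemma reps_theta_sums:
  assumes u: "u > 0"
  shows "(\<lambda>n. real (sum_squares_reps k n) * exp (- pi * u * real n)) sums theta u ^ k"
proof (rule sums_reps)
  have "prod_list (map (\<lambda>x. exp (- pi * (of_int x)\<^sup>2 * u)) xs) = exp (- pi * u * real (sqsum xs))" for xs
  proof (induction xs)
    case (Cons x xs)
    have "real (nat (x\<^sup>2)) = (of_int x)\<^sup>2" by (simp flip: of_int_power)
    then show ?case using Cons by (simp add: algebra_simps flip: exp_add)
  qed simp
  then show "((\<lambda>xs. exp (- pi * u * real (sqsum xs))) has_sum theta u ^ k) {xs. length xs = k}"
    using has_sum_lists_prod[OF theta_has_sum[OF u], of k] by simp
qed

lemma prod_le_sqsum: "prod_list (map (\<lambda>x. 1 + (of_int x)\<^sup>2) xs) \<le> (1 + real (sqsum xs)) ^ length xs"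
proof (induction xs)
  case (Cons x xs)
  let ?s = "real (sqsum (x # xs))"
  have r: "real (nat (x\<^sup>2)) = (of_int x)\<^sup>2" by (simp flip: of_int_power)
  have "(1 + (of_int x)\<^sup>2) * prod_list (map (\<lambda>x. 1 + (of_int x)\<^sup>2) xs) \<le> (1 + ?s) * (1 + ?s) ^ length xs"
  proof (intro mult_mono)
    have "prod_list (map (\<lambda>x. 1 + (of_int x)\<^sup>2) xs) \<le> (1 + real (sqsum xs)) ^ length xs" by (rule Cons)
    also have "\<dots> \<le> (1 + ?s) ^ length xs" by (intro power_mono) auto
    finally show "prod_list (map (\<lambda>x. 1 + (of_int x)\<^sup>2) xs) \<le> (1 + ?s) ^ length xs" .
    show "0 \<le> prod_list (map (\<lambda>x::int. 1 + (real_of_int x)\<^sup>2) xs)" by (induction xs) auto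
  qed (auto simp: r)
  then show ?case by simp
qed simp

text \<open>
  Since \<open>(1 + n) ^ k\<close> is at least the product of all \<open>1 + x\<^sub>i\<^sup>2\<close> if \<open>n\<close> is the sum of the \<open>x\<^sub>i\<^sup>2\<close>, the
  sum over all integer vectors is at most the \<open>k\<close>-th power of the sum of \<open>(1 + x\<^sup>2) powr (- p)\<close> over the
  integers, where \<open>p = 1 / 2 + s / k\<close>.
\<close>

lemma summable_reps_powr:
  assumes s: "s > 0"
  shows "summable (\<lambda>n. real (sum_squares_reps k n) * (1 + real n) powr (- (real k / 2 + s)))"
proof (cases "k = 0")
  case True
  have "((\<lambda>xs. (1 + real (sqsum xs)) powr (- (real k / 2 + s))) has_sum 1) {xs. length xs = k}"
    using True by (intro has_sum_finiteI) (auto simp: finite_subset[of _ "{[]}"])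
  then show ?thesis by (rule sums_summable[OF sums_reps[of "\<lambda>n. (1 + real n) powr (- (real k / 2 + s))"]])
next
  case False
  \<comment> \<open>So that \<open>k * p\<close> is the exponent \<open>k / 2 + s\<close>.\<close>
  define p where "p = 1 / 2 + s / real k"
  define w where "w = (\<lambda>x::int. (1 + (of_int x)\<^sup>2) powr (- p))"
  have p: "p > 1/2" using s False by (simp add: p_def)
  have "summable (\<lambda>n. real (Suc n) powr (- (2 * p)))"
    using summable_Suc_iff[of "\<lambda>n. real n powr (- (2 * p))"] p by (simp add: summable_real_powr_iff del: of_nat_Suc)
  moreover have "norm (w (int (Suc n))) \<le> real (Suc n) powr (- (2 * p))" for n
  proof -
    have "w (int (Suc n)) \<le> ((real (Suc n))\<^sup>2) powr (- p)"
      unfolding w_def using p by (intro powr_mono2') (auto simp del: of_nat_Suc)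
    also have "((real (Suc n))\<^sup>2) powr (- p) = real (Suc n) powr (- (2 * p))"
    proof -
      have e: "(real (Suc n))\<^sup>2 = real (Suc n) powr 2" by simp
      show ?thesis unfolding e powr_powr by simp
    qed
    finally show ?thesis by (simp add: w_def)
  qed
  ultimately have "summable (\<lambda>n. w (int (Suc n)))"
    by (intro summable_comparison_test[of "\<lambda>n. w (int (Suc n))" "\<lambda>n. real (Suc n) powr (- (2 * p))"] exI[of _ 0]) auto
  then have "(w has_sum (w 0 + 2 * (\<Sum>n. w (int (Suc n))))) UNIV"
    by (intro has_sum_int_even) (auto simp: w_def)
  from has_sum_lists_prod[OF this, of k]
  have "(\<lambda>xs. prod_list (map w xs)) summable_on {xs. length xs = k}" by (auto simp: w_def summable_on_def)
  moreover have "(1 + real (sqsum xs)) powr (- (real k / 2 + s)) \<le> prod_list (map w xs)" if "length xs = k" for xs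
  proof -
    have pos: "prod_list (map (\<lambda>x::int. 1 + (real_of_int x)\<^sup>2) ys) > 0" for ys
      by (induction ys) (auto intro!: mult_pos_pos add_pos_nonneg)
    have "prod_list (map w xs) = prod_list (map (\<lambda>x::int. 1 + (real_of_int x)\<^sup>2) xs) powr (- p)"
    proof (induction xs)
      case (Cons x xs)
      show ?case using pos[of xs] unfolding list.map prod_list.Cons Cons.IH
        by (simp add: w_def powr_mult less_imp_le)
    qed simp
    moreover have "((1 + real (sqsum xs)) ^ k) powr (- p) \<le> prod_list (map (\<lambda>x::int. 1 + (real_of_int x)\<^sup>2) xs) powr (- p)"
      using prod_le_sqsum[of xs] that p pos by (intro powr_mono2') auto
    moreover have "((1 + real (sqsum xs)) ^ k) powr (- p) = (1 + real (sqsum xs)) powr (- (real k / 2 + s))"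
    proof -
      have "real k * (- p) = - (real k / 2 + s)" using False by (simp add: p_def algebra_simps)
      moreover have "(1 + real (sqsum xs)) ^ k = (1 + real (sqsum xs)) powr real k" by (simp add: powr_realpow add_pos_nonneg)
      ultimately show ?thesis by (simp only: powr_powr)
    qed
    ultimately show ?thesis by simp
  qed
  ultimately have "(\<lambda>xs. (1 + real (sqsum xs)) powr (- (real k / 2 + s))) summable_on {xs. length xs = k}"
    by (rule summable_on_comparison_test) auto
  from has_sum_infsum[OF this] show ?thesis
    by (rule sums_summable[OF sums_reps[of "\<lambda>n. (1 + real n) powr (- (real k / 2 + s))"]])
qed

lemma reps_0: "sum_squares_reps k 0 = 1"
proof -
  have z: "sqsum xs = 0 \<longleftrightarrow> (\<forall>x\<in>set xs. x = 0)" for xs by (induction xs) auto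
  have "{xs. length xs = k \<and> sqsum xs = 0} = {replicate k 0}"
    unfolding z by (auto simp: replicate_length_same intro!: replicate_eqI)
  then show ?thesis by (simp add: sum_squares_reps_eq)
qed

section \<open>The Bessel series of the theta inversion formula\<close>

lemma summable_reps_shift_powr:
  assumes s: "s > 0" and p: "p > 0"
  shows "summable (\<lambda>n. real (sum_squares_reps k n) * (pi * (real n + p)) powr (- (real k / 2 + s)))"
proof -
  let ?e = "- (real k / 2 + s)" and ?d = "pi * min 1 p"
  have d: "?d > 0" using p by simp
  show ?thesis
  proof (rule summable_comparison_test)
    show "\<exists>N. \<forall>n\<ge>N. norm (real (sum_squares_reps k n) * (pi * (real n + p)) powr ?e) \<le>
        ?d powr ?e * (real (sum_squares_reps k n) * (1 + real n) powr ?e)"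
    proof (intro exI[of _ 0] allI impI)
      fix n
      have "min 1 p * (1 + real n) \<le> real n + p"
        using p mult_right_mono[of "min 1 p" 1 "real n"] by (simp add: algebra_simps)
      then have "pi * (min 1 p * (1 + real n)) \<le> pi * (real n + p)"
        by (intro mult_left_mono) auto
      then have "(pi * (real n + p)) powr ?e \<le> (?d * (1 + real n)) powr ?e"
      proof (intro powr_mono2')
        show "0 < ?d * (1 + real n)" by (rule mult_pos_pos[OF d]) simp
      qed (use s in \<open>auto simp: mult.assoc\<close>)
      also have "\<dots> = ?d powr ?e * (1 + real n) powr ?e"
        by (rule powr_mult)
      finally have "real (sum_squares_reps k n) * (pi * (real n + p)) powr ?e \<le> real (sum_squares_reps k n) * (?d powr ?e * (1 + real n) powr ?e)"
        by (rule mult_left_mono) simp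
      then show "norm (real (sum_squares_reps k n) * (pi * (real n + p)) powr ?e) \<le> ?d powr ?e * (real (sum_squares_reps k n) * (1 + real n) powr ?e)"
        unfolding real_norm_def abs_of_nonneg[OF mult_nonneg_nonneg[OF of_nat_0_le_iff powr_ge_zero]] by (simp only: mult.left_commute)
    qed
    show "summable (\<lambda>n. ?d powr ?e * (real (sum_squares_reps k n) * (1 + real n) powr ?e))"
      by (intro summable_mult summable_reps_powr s)
  qed
qed

lemma summable_reps_inverse_power:
  assumes k: "k > 0"
  shows "summable (\<lambda>n. real (sum_squares_reps k (Suc n)) / (pi * real (Suc n)) ^ k)"
proof (rule summable_comparison_test)
  have "summable (\<lambda>n. real (sum_squares_reps k (Suc n)) * (1 + real (Suc n)) powr (- (real k / 2 + real k / 2)))"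
    using summable_reps_powr[of "real k / 2" k] k by (subst summable_Suc_iff) auto
  then show "summable (\<lambda>n. real (sum_squares_reps k (Suc n)) * (1 / (1 + real (Suc n)) ^ k))"
    by (simp add: powr_minus_divide powr_realpow add_pos_nonneg del: of_nat_Suc)
  have "real (sum_squares_reps k (Suc n)) * (1 / (pi * real (Suc n)) ^ k) \<le> real (sum_squares_reps k (Suc n)) * (1 / (1 + real (Suc n)) ^ k)" for n
  proof -
    have "1 + real (Suc n) \<le> 2 * real (Suc n)" by simp
    also have "\<dots> \<le> pi * real (Suc n)" using pi_gt3 by (intro mult_right_mono) auto
    finally show ?thesis by (intro mult_left_mono frac_le power_mono) (auto intro: add_pos_nonneg)
  qed
  then show "\<exists>N. \<forall>n\<ge>N. norm (real (sum_squares_reps k (Suc n)) / (pi * real (Suc n)) ^ k)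
      \<le> real (sum_squares_reps k (Suc n)) * (1 / (1 + real (Suc n)) ^ k)"
    by (simp del: of_nat_Suc)
qed

text \<open>
  By \<open>rint_le_power\<close> with \<open>N = k\<close>, the integral decays like the \<open>k\<close>-th power of \<open>1 / n\<close>.
\<close>

lemma summable_reps_rint:
  assumes k: "k > 0" and p: "p > 0" and s: "s > 0"
  shows "summable (\<lambda>n. real (sum_squares_reps k (Suc n)) * rint s (pi * p) (pi * real (Suc n)))"
proof (rule summable_comparison_test)
  let ?C = "fact k * rint (s + real k) (pi * p) 0"
  show "summable (\<lambda>n. ?C * (real (sum_squares_reps k (Suc n)) / (pi * real (Suc n)) ^ k))"
    by (rule summable_mult[OF summable_reps_inverse_power[OF k]])
  show "\<exists>N. \<forall>n\<ge>N. norm (real (sum_squares_reps k (Suc n)) * rint s (pi * p) (pi * real (Suc n)))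
     \<le> ?C * (real (sum_squares_reps k (Suc n)) / (pi * real (Suc n)) ^ k)"
  proof (intro exI[of _ 0] allI impI)
    fix n
    have "rint s (pi * p) (pi * real (Suc n)) \<le> fact k / (pi * real (Suc n)) ^ k * rint (s + real k) (pi * p) 0"
      using p s by (intro rint_le_power) auto
    then have "real (sum_squares_reps k (Suc n)) * rint s (pi * p) (pi * real (Suc n))
        \<le> real (sum_squares_reps k (Suc n)) * (fact k / (pi * real (Suc n)) ^ k * rint (s + real k) (pi * p) 0)"
      by (rule mult_left_mono) simp
    then show "norm (real (sum_squares_reps k (Suc n)) * rint s (pi * p) (pi * real (Suc n)))
        \<le> ?C * (real (sum_squares_reps k (Suc n)) / (pi * real (Suc n)) ^ k)"
      by (simp add: abs_mult rint_nonneg mult_ac del: of_nat_Suc)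
  qed
qed

text \<open>
  Both series have the same sum up to one kernel: the first one is \<open>theta v ^ k\<close> times \<open>v powr (k / 2)\<close>, the
  second one is \<open>theta (1 / v) ^ k\<close> without its constant term, each multiplied by
  \<open>v powr (s - 1) * exp (- \<pi> * p * v)\<close>.
\<close>

lemma mker_theta:
  assumes "v > 0"
  shows "(\<lambda>n. of_nat (sum_squares_reps k n) * mker (s + of_nat k / 2) (of_real (pi * (real n + p))) 0 v) sums
      (mker s (of_real (pi * p)) 0 v * of_real (theta (1 / v) ^ k))"
    and "(\<lambda>n. of_nat (sum_squares_reps k (Suc n)) * mker s (of_real (pi * p)) (of_real (pi * real (Suc n))) v) sums
      (mker s (of_real (pi * p)) 0 v * of_real (theta (1 / v) ^ k - 1))"
proof -
  have v': "1 / v > 0" using assms by simp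
  have th: "theta (1 / v) ^ k = exp (real k / 2 * ln v) * theta v ^ k"
  proof -
    have "sqrt v ^ k = exp (real k / 2 * ln v)"
    proof -
      have "exp (ln (sqrt v)) = sqrt v" using assms by simp
      then have "sqrt v = exp (ln v / 2)" using assms by (simp add: ln_sqrt)
      then show ?thesis by (simp flip: exp_of_nat_mult)
    qed
    then show ?thesis using theta_inversion[OF assms] by (simp add: power_mult_distrib)
  qed
  have "(\<lambda>n. mker (s + of_nat k / 2) (of_real (pi * p)) 0 v * of_real (real (sum_squares_reps k n) * exp (- pi * v * real n))) sums
      (mker (s + of_nat k / 2) (of_real (pi * p)) 0 v * of_real (theta v ^ k))"
    by (intro sums_mult sums_of_real reps_theta_sums assms)
  also have "mker (s + of_nat k / 2) (of_real (pi * p)) 0 v * of_real (theta v ^ k) = mker s (of_real (pi * p)) 0 v * of_real (theta (1 / v) ^ k)"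
    unfolding th using assms by (simp add: mker_def algebra_simps exp_of_real[symmetric] flip: exp_add)
  also have "(\<lambda>n. mker (s + of_nat k / 2) (of_real (pi * p)) 0 v * of_real (real (sum_squares_reps k n) * exp (- pi * v * real n)))
     = (\<lambda>n. of_nat (sum_squares_reps k n) * mker (s + of_nat k / 2) (of_real (pi * (real n + p))) 0 v)"
    using assms by (simp add: fun_eq_iff mker_def algebra_simps exp_of_real[symmetric] flip: exp_add)
  finally show "(\<lambda>n. of_nat (sum_squares_reps k n) * mker (s + of_nat k / 2) (of_real (pi * (real n + p))) 0 v) sums
      (mker s (of_real (pi * p)) 0 v * of_real (theta (1 / v) ^ k))" .
  have "(\<lambda>n. real (sum_squares_reps k n) * exp (- pi * (1 / v) * real n)) sums theta (1 / v) ^ k"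
    by (rule reps_theta_sums[OF v'])
  then have "(\<lambda>n. real (sum_squares_reps k (Suc n)) * exp (- pi * (1 / v) * real (Suc n))) sums (theta (1 / v) ^ k - 1)"
    by (subst sums_Suc_iff) (simp add: reps_0)
  then have "(\<lambda>n. mker s (of_real (pi * p)) 0 v * of_real (real (sum_squares_reps k (Suc n)) * exp (- pi * (1 / v) * real (Suc n)))) sums
      (mker s (of_real (pi * p)) 0 v * of_real (theta (1 / v) ^ k - 1))"
    by (intro sums_mult sums_of_real)
  also have "(\<lambda>n. mker s (of_real (pi * p)) 0 v * of_real (real (sum_squares_reps k (Suc n)) * exp (- pi * (1 / v) * real (Suc n)))) =
      (\<lambda>n. of_nat (sum_squares_reps k (Suc n)) * mker s (of_real (pi * p)) (of_real (pi * real (Suc n))) v)"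
    using assms by (simp add: fun_eq_iff mker_def algebra_simps exp_of_real[symmetric] flip: exp_add del: of_nat_Suc)
  finally show "(\<lambda>n. of_nat (sum_squares_reps k (Suc n)) * mker s (of_real (pi * p)) (of_real (pi * real (Suc n))) v) sums
      (mker s (of_real (pi * p)) 0 v * of_real (theta (1 / v) ^ k - 1))" .
qed

text \<open>
  The two expansions in \<open>mker_theta\<close> are integrated term by term; the terms of the first one give
  Gamma integrals.
\<close>

theorem theta_bessel_sums:
  assumes k: "k > 0" and p: "p > 0" and s: "Re s > 0"
  shows "(\<lambda>n. of_nat (sum_squares_reps k (Suc n)) * mint s (of_real (pi * p)) (of_real (pi * real (Suc n)))) sums
    ((\<Sum>n. of_nat (sum_squares_reps k n) * (Gamma (s + of_nat k / 2) * of_real (pi * (real n + p)) powr (- (s + of_nat k / 2))))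
      - Gamma s * of_real (pi * p) powr (- s))"
proof -
  let ?s = "s + of_nat k / 2"
  let ?f = "\<lambda>n v. of_nat (sum_squares_reps k n) * mker ?s (of_real (pi * (real n + p))) 0 v"
  let ?g = "\<lambda>n v. of_nat (sum_squares_reps k (Suc n)) * mker s (of_real (pi * p)) (of_real (pi * real (Suc n))) v"
  let ?m = "mker s (of_real (pi * p)) 0"
  have s': "Re ?s > 0" using s by (simp add: add_pos_nonneg)
  have pn: "pi * (real n + p) > 0" for n using p by (simp add: add_nonneg_pos)
  have fi: "integrable lborel (?f n)" for n
    using s' pn by (intro integrable_mult_right mker_integrable) auto
  have gi: "integrable lborel (?g n)" for n
    using s p by (intro integrable_mult_right mker_integrable) auto
  have mi: "integrable lborel ?m" using s p by (intro mker_integrable) auto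
  have nf: "(LINT v|lborel. norm (?f n v)) = real (sum_squares_reps k n) * rint (Re ?s) (pi * (real n + p)) 0" for n
    by (simp add: norm_mult norm_mker rint_def)
  have ng: "(LINT v|lborel. norm (?g n v)) = real (sum_squares_reps k (Suc n)) * rint (Re s) (pi * p) (pi * real (Suc n))" for n
    by (simp add: norm_mult norm_mker rint_def del: of_nat_Suc)
  have f1: "AE v in lborel. summable (\<lambda>n. norm (?f n v))"
  proof (rule AE_I2)
    fix v :: real
    show "summable (\<lambda>n. norm (?f n v))"
    proof (cases "v > 0")
      case True
      have "of_nat (sum_squares_reps k n) * mker (of_real (Re s) + of_nat k / 2) (of_real (pi * (real n + p))) 0 v = of_real (norm (?f n v))" for n
        unfolding norm_mult norm_mker using mker_of_real[of "Re s + real k / 2" "pi * (real n + p)" 0 v] by simp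
      then have "summable (\<lambda>n. complex_of_real (norm (?f n v)))"
        using mker_theta(1)[OF True, of k "of_real (Re s)" p] by (simp only: sums_iff)
      then show ?thesis by (simp only: summable_of_real_iff)
    qed (simp add: mker_outside)
  qed
  have f2: "summable (\<lambda>n. LINT v|lborel. norm (?f n v))"
  proof -
    have "real (sum_squares_reps k n) * rint (Re ?s) (pi * (real n + p)) 0 = Gamma (Re ?s) * (real (sum_squares_reps k n) * (pi * (real n + p)) powr (- (real k / 2 + Re s)))" for n
      unfolding rint_gamma[OF s' pn] by (simp add: add.commute)
    then show ?thesis
      unfolding nf by (simp only: summable_mult[OF summable_reps_shift_powr[OF s p, of k]])
  qed
  have fe: "(\<Sum>n. ?f n v) = ?m v * of_real (theta (1 / v) ^ k)" for v
  proof (cases "v > 0")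
    case True
    then show ?thesis using mker_theta(1)[of v k s p] by (simp only: sums_iff)
  qed (simp add: mker_outside)
  have fI: "integral\<^sup>L lborel (?f n) = of_nat (sum_squares_reps k n) * (Gamma ?s * of_real (pi * (real n + p)) powr (- ?s))" for n
    using mint_gamma[OF s' pn[of n]] by (simp add: mint_def)
  have f: "(\<lambda>n. of_nat (sum_squares_reps k n) * (Gamma ?s * of_real (pi * (real n + p)) powr (- ?s))) sums (LINT v|lborel. ?m v * of_real (theta (1 / v) ^ k))"
    using sums_integral[OF fi f1 f2] unfolding fe fI .
  have fint: "integrable lborel (\<lambda>v. ?m v * of_real (theta (1 / v) ^ k))"
    using integrable_suminf[OF fi f1 f2] unfolding fe .
  have g1: "AE v in lborel. summable (\<lambda>n. norm (?g n v))"
  proof (rule AE_I2)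
    fix v :: real
    show "summable (\<lambda>n. norm (?g n v))"
    proof (cases "v > 0")
      case True
      have "of_nat (sum_squares_reps k (Suc n)) * mker (of_real (Re s)) (of_real (pi * p)) (of_real (pi * real (Suc n))) v = of_real (norm (?g n v))" for n
        unfolding norm_mult norm_mker mker_of_real by simp
      then have "summable (\<lambda>n. complex_of_real (norm (?g n v)))"
        using mker_theta(2)[OF True, of k "of_real (Re s)" p] by (simp only: sums_iff)
      then show ?thesis by (simp only: summable_of_real_iff)
    qed (simp add: mker_outside)
  qed
  have g2: "summable (\<lambda>n. LINT v|lborel. norm (?g n v))"
    unfolding ng by (rule summable_reps_rint[OF k p s])
  have ge: "(\<Sum>n. ?g n v) = ?m v * of_real (theta (1 / v) ^ k - 1)" for v
  proof (cases "v > 0")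
    case True
    then show ?thesis using mker_theta(2)[of v k s p] by (simp only: sums_iff)
  qed (simp add: mker_outside)
  have gI: "integral\<^sup>L lborel (?g n) = of_nat (sum_squares_reps k (Suc n)) * mint s (of_real (pi * p)) (of_real (pi * real (Suc n)))" for n
    by (simp add: mint_def)
  have d: "(LINT v|lborel. ?m v * of_real (theta (1 / v) ^ k - 1)) = (LINT v|lborel. ?m v * of_real (theta (1 / v) ^ k)) - integral\<^sup>L lborel ?m"
    using Bochner_Integration.integral_diff[OF fint mi] by (simp add: right_diff_distrib)
  have mI: "integral\<^sup>L lborel ?m = Gamma s * of_real (pi * p) powr (- s)"
    using mint_gamma[OF s, of "pi * p"] p by (simp add: mint_def)
  show ?thesis
    using sums_integral[OF gi g1 g2] unfolding ge gI d mI sums_unique[OF f, symmetric] .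
qed

section \<open>Double series\<close>

text \<open>
  Fubini's theorem for series. Rows against columns will exchange the sums over \<open>n\<close> and \<open>j\<close>; rows
  against diagonals sort an expansion by total degree.
\<close>

lemma double_series:
  fixes f :: "nat \<Rightarrow> nat \<Rightarrow> complex"
  assumes s: "(\<lambda>p. norm (f (fst p) (snd p))) summable_on UNIV"
  defines "S \<equiv> infsum (\<lambda>p. f (fst p) (snd p)) UNIV"
  shows "(\<lambda>j. \<Sum>i. f j i) sums S" "(\<lambda>i. \<Sum>j. f j i) sums S" "(\<lambda>N. \<Sum>j\<le>N. f j (N - j)) sums S"
    and "\<And>j. summable (\<lambda>i. norm (f j i))" "\<And>i. summable (\<lambda>j. norm (f j i))"
proof -
  let ?F = "\<lambda>p. f (fst p) (snd p)"
  have hs: "(?F has_sum S) (UNIV \<times> UNIV)"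
    unfolding S_def using Infinite_Sum.abs_summable_summable[OF s] by simp
  have s': "(\<lambda>p. norm (?F p)) summable_on (UNIV \<times> UNIV)" using s by simp
  have row: "(\<lambda>i. norm (f j i)) summable_on UNIV" for j
    using s' unfolding Infinite_Sum.abs_summable_on_Sigma_iff by simp
  have sw: "(\<lambda>p. norm (f (snd p) (fst p))) summable_on (UNIV \<times> UNIV)"
    using s' summable_on_reindex[of prod.swap "UNIV \<times> UNIV" "\<lambda>p. norm (f (snd p) (fst p))"] by (simp add: o_def)
  have col: "(\<lambda>j. norm (f j i)) summable_on UNIV" for i
    using sw unfolding Infinite_Sum.abs_summable_on_Sigma_iff[of "\<lambda>p. f (snd p) (fst p)"] by simp
  show rs: "summable (\<lambda>i. norm (f j i))" for j using row by (rule summable_on_imp_summable)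
  show cs: "summable (\<lambda>j. norm (f j i))" for i using col by (rule summable_on_imp_summable)
  have "((\<lambda>i. f j i) has_sum (\<Sum>i. f j i)) UNIV" for j
    by (rule norm_summable_imp_has_sum[OF rs summable_sums[OF summable_norm_cancel[OF rs]]])
  then have "((\<lambda>j. \<Sum>i. f j i) has_sum S) UNIV" by (intro has_sum_SigmaD[OF hs]) simp
  then show "(\<lambda>j. \<Sum>i. f j i) sums S" by (rule has_sum_imp_sums)
  have hsw: "((\<lambda>p. f (snd p) (fst p)) has_sum S) (UNIV \<times> UNIV)"
    using hs has_sum_reindex[of prod.swap "UNIV \<times> UNIV" "\<lambda>p. f (snd p) (fst p)"] by (simp add: o_def)
  have "((\<lambda>j. f j i) has_sum (\<Sum>j. f j i)) UNIV" for i
    by (rule norm_summable_imp_has_sum[OF cs summable_sums[OF summable_norm_cancel[OF cs]]])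
  then have "((\<lambda>i. \<Sum>j. f j i) has_sum S) UNIV" by (intro has_sum_SigmaD[OF hsw]) simp
  then show "(\<lambda>i. \<Sum>j. f j i) sums S" by (rule has_sum_imp_sums)
  let ?D = "Sigma UNIV (\<lambda>N::nat. {..N})"
  have img: "(\<lambda>(N, j). (j, N - j)) ` ?D = UNIV \<times> UNIV"
  proof -
    have "(j, i) \<in> (\<lambda>(N, j). (j, N - j)) ` ?D" for j i :: nat by (rule image_eqI[of _ _ "(j + i, j)"]) auto
    then show ?thesis by auto
  qed
  have inj: "inj_on (\<lambda>(N, j). (j, N - j)) ?D" by (auto simp: inj_on_def)
  have hd: "((\<lambda>p. f (snd p) (fst p - snd p)) has_sum S) ?D"
    using hs unfolding img[symmetric] has_sum_reindex[OF inj] by (simp add: o_def case_prod_unfold)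
  have "((\<lambda>N. \<Sum>j\<le>N. f j (N - j)) has_sum S) UNIV"
    by (rule has_sum_SigmaD[OF hd]) (auto intro: has_sum_finiteI)
  then show "(\<lambda>N. \<Sum>j\<le>N. f j (N - j)) sums S" by (rule has_sum_imp_sums)
qed

lemma product_pairs_summable:
  fixes u w :: "nat \<Rightarrow> real"
  assumes "summable u" "\<And>n. u n \<ge> 0" "summable w" "\<And>n. w n \<ge> 0"
  shows "(\<lambda>p. u (fst p) * w (snd p)) summable_on UNIV"
proof -
  have u: "u summable_on UNIV" and w: "w summable_on UNIV"
    using assms by (auto intro: summable_nonneg_imp_summable_on)
  have "(\<lambda>p. norm (u (fst p) * w (snd p))) summable_on (UNIV \<times> UNIV)"
    unfolding Infinite_Sum.abs_summable_on_Sigma_iff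
  proof (intro conjI ballI)
    show "(\<lambda>y. norm (u (fst (j, y)) * w (snd (j, y)))) summable_on UNIV" for j
      using w assms by (simp add: abs_mult summable_on_cmult_right)
    show "(\<lambda>j. norm (infsum (\<lambda>y. norm (u (fst (j, y)) * w (snd (j, y)))) UNIV)) summable_on UNIV"
      using u w assms by (simp add: abs_mult infsum_cmult_right' infsum_nonneg abs_of_nonneg summable_on_cmult_left)
  qed
  then show ?thesis using assms by simp
qed

lemma norm_pochhammer_le:
  assumes "norm (b :: complex) \<le> B" "1 \<le> B"
  shows "norm (pochhammer b n) \<le> B ^ n * fact n"
proof (induction n)
  case (Suc n)
  have "norm (b + of_nat n) \<le> norm b + real n" using norm_triangle_ineq[of b "of_nat n"] by simp
  also have "\<dots> \<le> B + B * real n" using assms mult_right_mono[of 1 B "real n"] by (intro add_mono) auto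
  finally have "norm (b + of_nat n) \<le> B * real (Suc n)" by (simp add: algebra_simps)
  then have "norm (pochhammer b n) * norm (b + of_nat n) \<le> (B ^ n * fact n) * (B * real (Suc n))"
    using Suc assms by (intro mult_mono) auto
  then show ?case by (simp add: pochhammer_Suc norm_mult mult_ac)
qed simp

lemma norm_pochhammer_ge:
  assumes "Re \<nu> \<ge> 0"
  shows "fact n \<le> norm (pochhammer (\<nu> + 1 :: complex) n)"
proof (induction n)
  case (Suc n)
  have "real (Suc n) \<le> Re (\<nu> + 1 + of_nat n)" using assms by simp
  also have "\<dots> \<le> norm (\<nu> + 1 + of_nat n)" by (rule complex_Re_le_cmod)
  finally have "fact n * real (Suc n) \<le> norm (pochhammer (\<nu> + 1) n) * norm (\<nu> + 1 + of_nat n)"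
    using Suc by (intro mult_mono) auto
  then show ?case by (simp add: pochhammer_Suc norm_mult mult_ac)
qed simp

lemma fact_trinomial_le: "fact (2 * j + i) \<le> (16 :: real) ^ (j + i) * (fact i * fact j * fact j)"
proof -
  have "fact (2 * j + i) = fact i * fact (2 * j) * real ((2 * j + i) choose i)"
    using arg_cong[OF binomial_fact_lemma[of i "2 * j + i"], of real] by simp
  moreover have "fact (2 * j) = fact j * fact j * real ((2 * j) choose j)"
    using arg_cong[OF binomial_fact_lemma[of j "2 * j"], of real] by (simp add: mult_2)
  ultimately have "fact (2 * j + i) = fact i * (fact j * fact j * real ((2 * j) choose j)) * real ((2 * j + i) choose i)"
    by simp
  also have "\<dots> \<le> fact i * (fact j * fact j * 2 ^ (2 * j)) * (2 :: real) ^ (2 * j + i)"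
    using of_nat_mono[OF binomial_le_pow2[of "2 * j + i" i], where ?'a = real] of_nat_mono[OF binomial_le_pow2[of "2 * j" j], where ?'a = real]
    by (intro mult_mono mult_left_mono) auto
  also have "\<dots> = (2 :: real) ^ (4 * j + i) * (fact i * fact j * fact j)"
    by (simp add: power_add mult_ac flip: power_mult) (simp add: power_mult power_add[symmetric] mult_2[symmetric] mult.commute[of j])
  also have "\<dots> \<le> (2 :: real) ^ (4 * (j + i)) * (fact i * fact j * fact j)"
    by (intro mult_right_mono power_increasing) auto
  also have "(2 :: real) ^ (4 * (j + i)) = 16 ^ (j + i)" unfolding power_mult by simp
  finally show ?thesis .
qed

text \<open>
  The growth of \<open>pochhammer b (2 * j + i)\<close> is compensated by the factorials up to a geometric factor.
  This is the origin of all conditions of the form \<open>16 * B\<^sup>2 * r < 1\<close> below.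
\<close>

lemma pochhammer_pair_bound:
  fixes b \<nu> :: complex
  assumes b: "norm b \<le> B" "1 \<le> B" and nu: "Re \<nu> \<ge> 0" and r: "0 \<le> r"
  shows "norm (pochhammer b (2 * j + i)) / (fact i * fact j * norm (pochhammer (\<nu> + 1) j)) * r ^ (j + i) \<le> (16 * B\<^sup>2 * r) ^ (j + i)"
proof -
  have "norm (pochhammer b (2 * j + i)) \<le> B ^ (2 * j + i) * fact (2 * j + i)" by (rule norm_pochhammer_le[OF b])
  also have "\<dots> \<le> B ^ (2 * (j + i)) * (16 ^ (j + i) * (fact i * fact j * fact j))"
    using b fact_trinomial_le[of j i] by (intro mult_mono power_increasing) auto
  also have "\<dots> \<le> B ^ (2 * (j + i)) * (16 ^ (j + i) * (fact i * fact j * norm (pochhammer (\<nu> + 1) j)))"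
    using b norm_pochhammer_ge[OF nu, of j] by (intro mult_left_mono) auto
  also have "\<dots> = (16 * B\<^sup>2) ^ (j + i) * (fact i * fact j * norm (pochhammer (\<nu> + 1) j))"
    unfolding power_mult power_mult_distrib by (simp only: mult_ac)
  finally have "norm (pochhammer b (2 * j + i)) / (fact i * fact j * norm (pochhammer (\<nu> + 1) j)) \<le> (16 * B\<^sup>2) ^ (j + i)"
  proof (subst pos_divide_le_eq)
    show "0 < fact i * fact j * norm (pochhammer (\<nu> + 1) j)"
      using less_le_trans[OF fact_gt_zero norm_pochhammer_ge[OF nu, of j]] by simp
  qed
  then have "norm (pochhammer b (2 * j + i)) / (fact i * fact j * norm (pochhammer (\<nu> + 1) j)) * r ^ (j + i) \<le> (16 * B\<^sup>2) ^ (j + i) * r ^ (j + i)"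
    using r by (intro mult_right_mono) auto
  then show ?thesis by (simp add: power_mult_distrib)
qed

lemma pochhammer_pairs_summable:
  fixes b \<nu> :: complex
  assumes b: "norm b \<le> B" "1 \<le> B" and nu: "Re \<nu> \<ge> 0" and r: "0 \<le> r" "16 * B\<^sup>2 * r < 1"
  shows "(\<lambda>p. C * (norm (pochhammer b (2 * fst p + snd p)) / (fact (snd p) * fact (fst p) * norm (pochhammer (\<nu> + 1) (fst p))) * r ^ (fst p + snd p)))
     summable_on (UNIV :: (nat \<times> nat) set)"
proof (rule summable_on_cmult_right, rule summable_on_comparison_test)
  show "(\<lambda>p. (16 * B\<^sup>2 * r) ^ fst p * (16 * B\<^sup>2 * r) ^ snd p) summable_on (UNIV :: (nat \<times> nat) set)"
    using r by (intro product_pairs_summable) auto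
qed (use r pochhammer_pair_bound[OF b nu r(1)] in \<open>auto simp flip: power_add\<close>)

lemma pochhammer_even_summable:
  fixes b \<nu> :: complex
  assumes b: "norm b \<le> B" "1 \<le> B" and nu: "Re \<nu> \<ge> 0" and r: "0 \<le> r" "16 * B\<^sup>2 * r < 1"
  shows "summable (\<lambda>j. norm (pochhammer b (2 * j)) / (fact j * norm (pochhammer (\<nu> + 1) j)) * r ^ j)"
  by (rule summable_comparison_test[OF _ summable_geometric[of "16 * B\<^sup>2 * r"]])
     (use r pochhammer_pair_bound[OF b nu r(1), of _ 0] in auto)

section \<open>Two transformations of hypergeometric series\<close>

text \<open>
  The Chu-Vandermonde identity, after \<open>pochhammer b (N + j)\<close> and \<open>1 / fact (N - j)\<close> are written as
  multiples of \<open>pochhammer (b + N) j\<close> and \<open>pochhammer (- N) j\<close>.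
\<close>

lemma vandermonde_quadratic:
  fixes \<nu> a :: complex
  assumes nu: "Re \<nu> > - 1"
  defines "b \<equiv> \<nu> + a"
  shows "(\<Sum>j\<le>N. (-1) ^ (N - j) * pochhammer b (N + j) / (fact (N - j) * fact j * pochhammer (\<nu> + 1) j))
     = pochhammer b N * pochhammer a N / (pochhammer (\<nu> + 1) N * fact N)"
proof -
  have nz: "\<forall>i\<in>{0..<N}. \<nu> + 1 \<noteq> - of_nat i" using nu by (auto simp: complex_eq_iff)
  have t: "(-1) ^ (N - j) * pochhammer b (N + j) / (fact (N - j) * fact j * pochhammer (\<nu> + 1) j)
     = (-1) ^ N * pochhammer b N / fact N * (pochhammer (b + of_nat N) j * pochhammer (- of_nat N) j / (of_nat (fact j) * pochhammer (\<nu> + 1) j))"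
    if "j \<le> N" for j
  proof -
    have "pochhammer (- of_nat N :: complex) j = (-1) ^ j * (fact N / fact (N - j))"
    proof -
      have "pochhammer (- of_nat N :: complex) j = (-1) ^ j * pochhammer (of_nat N - of_nat j + 1) j" by (rule pochhammer_minus)
      also have "pochhammer (of_nat N - of_nat j + 1 :: complex) j = fact N / fact (N - j)"
      proof -
        have "fact N = (pochhammer 1 ((N - j) + j) :: complex)" using that by (simp add: pochhammer_fact)
        also have "\<dots> = pochhammer 1 (N - j) * pochhammer (1 + of_nat (N - j)) j" by (rule pochhammer_product')
        finally show ?thesis using that by (simp add: pochhammer_fact[symmetric] of_nat_diff add_ac)
      qed
      finally show ?thesis .
    qed
    moreover have "pochhammer b (N + j) = pochhammer b N * pochhammer (b + of_nat N) j" by (rule pochhammer_product')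
    moreover have "(-1 :: complex) ^ (N - j) = (-1) ^ N * (-1) ^ j" using that
      by (auto simp: minus_one_power_iff)
    ultimately show ?thesis by (simp add: divide_simps)
  qed
  have "(\<Sum>j\<le>N. (-1) ^ (N - j) * pochhammer b (N + j) / (fact (N - j) * fact j * pochhammer (\<nu> + 1) j))
    = (-1) ^ N * pochhammer b N / fact N * (\<Sum>j = 0..N. pochhammer (b + of_nat N) j * pochhammer (- of_nat N) j / (of_nat (fact j) * pochhammer (\<nu> + 1) j))"
    unfolding sum_distrib_left atMost_atLeast0 by (rule sum.cong[OF refl], rule t) simp
  also have "\<dots> = (-1) ^ N * pochhammer b N / fact N * (pochhammer (\<nu> + 1 - (b + of_nat N)) N / pochhammer (\<nu> + 1) N)"
    by (subst Vandermonde_pochhammer[OF nz]) simp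
  also have "pochhammer (\<nu> + 1 - (b + of_nat N)) N = (-1) ^ N * pochhammer a N"
    using pochhammer_minus[of "a + of_nat N - 1" N] by (simp add: b_def algebra_simps)
  finally show ?thesis by (simp add: minus_one_power_iff mult.commute)
qed

text \<open>
  A quadratic transformation of the hypergeometric function: expand the powers of \<open>1 + x\<close> by the
  binomial series, collect the powers of \<open>x\<close> and apply \<open>vandermonde_quadratic\<close>.
\<close>

theorem hyp2f1_quadratic:
  fixes \<nu> a x :: complex
  assumes nu: "Re \<nu> \<ge> 0" and B: "norm (\<nu> + a) \<le> B" "1 \<le> B" and x: "16 * B\<^sup>2 * norm x < 1"
  shows "(\<lambda>j. pochhammer (\<nu> + a) (2 * j) / (fact j * pochhammer (\<nu> + 1) j) * x ^ j * (1 + x) powr (- (\<nu> + a + 2 * of_nat j)))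
     sums hyp2f1_series (\<nu> + a) a (\<nu> + 1) x"
proof -
  define b where "b = \<nu> + a"
  define f where "f = (\<lambda>j i. (-1) ^ i * pochhammer b (2 * j + i) / (fact i * fact j * pochhammer (\<nu> + 1) j) * x ^ (j + i))"
  have x1: "norm x < 1"
  proof -
    have "1 * norm x \<le> 16 * B\<^sup>2 * norm x"
      by (rule mult_right_mono) (use B one_le_power[of B 2] in linarith, simp)
    then show ?thesis using x by linarith
  qed
  have "(\<lambda>p. norm (f (fst p) (snd p))) summable_on UNIV"
    using pochhammer_pairs_summable[OF B nu, of "norm x" 1] x by (simp add: f_def b_def norm_mult norm_divide norm_power)
  note ds = double_series[OF this]
  have row: "(\<Sum>i. f j i) = pochhammer b (2 * j) / (fact j * pochhammer (\<nu> + 1) j) * x ^ j * (1 + x) powr (- (b + 2 * of_nat j))" for j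
  proof -
    let ?c = "pochhammer b (2 * j) / (fact j * pochhammer (\<nu> + 1) j) * x ^ j"
    have "(\<lambda>i. ?c * ((- (b + 2 * of_nat j) gchoose i) * x ^ i)) sums (?c * (1 + x) powr (- (b + 2 * of_nat j)))"
      by (intro sums_mult gen_binomial_complex x1)
    moreover have "?c * ((- (b + 2 * of_nat j) gchoose i) * x ^ i) = f j i" for i
      unfolding f_def pochhammer_product' gbinomial_pochhammer power_add minus_minus by (simp add: add.commute mult_ac)
    ultimately show ?thesis by (simp add: sums_iff)
  qed
  have diag: "(\<Sum>j\<le>N. f j (N - j)) = pochhammer b N * pochhammer a N / (pochhammer (\<nu> + 1) N * fact N) * x ^ N" for N
  proof -
    have "(\<Sum>j\<le>N. f j (N - j)) = (\<Sum>j\<le>N. (-1) ^ (N - j) * pochhammer b (N + j) / (fact (N - j) * fact j * pochhammer (\<nu> + 1) j)) * x ^ N"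
      unfolding sum_distrib_right f_def by (intro sum.cong refl) (simp add: add.commute mult_2)
    also have "\<dots> = pochhammer b N * pochhammer a N / (pochhammer (\<nu> + 1) N * fact N) * x ^ N"
      unfolding b_def using nu by (subst vandermonde_quadratic) auto
    finally show ?thesis .
  qed
  have "(\<lambda>N. pochhammer b N * pochhammer a N / (pochhammer (\<nu> + 1) N * fact N) * x ^ N) sums infsum (\<lambda>p. f (fst p) (snd p)) UNIV"
    using ds(3) unfolding diag .
  then have "infsum (\<lambda>p. f (fst p) (snd p)) UNIV = hyp2f1_series b a (\<nu> + 1) x"
    using hyp2f1_series_sums[OF x1] sums_unique2 by blast
  then show ?thesis using ds(1) unfolding row b_def by simp
qed

text \<open>
  The left-hand side of the hypergeometric differential equation.
\<close>

definition hyp_ode :: "complex \<Rightarrow> complex \<Rightarrow> complex \<Rightarrow> complex fps \<Rightarrow> complex fps" where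
  "hyp_ode a b c F = fps_X * (1 - fps_X) * fps_deriv (fps_deriv F)
     + (fps_const c - fps_const (a + b + 1) * fps_X) * fps_deriv F - fps_const (a * b) * F"

lemma fps_X_deriv_nth: "fps_nth (fps_X * fps_deriv F) n = of_nat n * fps_nth F n"
  by (cases n) auto

lemma hyp_ode_nth:
  "fps_nth (hyp_ode a b c F) n = of_nat (Suc n) * (of_nat n + c) * fps_nth F (Suc n) - (of_nat n + a) * (of_nat n + b) * fps_nth F n"
proof -
  have "fps_X * (fps_X * fps_deriv (fps_deriv F)) = fps_X * fps_deriv (fps_X * fps_deriv F) - fps_X * fps_deriv F"
    by (simp add: algebra_simps)
  then have "hyp_ode a b c F = fps_X * fps_deriv (fps_deriv F) - (fps_X * fps_deriv (fps_X * fps_deriv F) - fps_X * fps_deriv F)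
     + fps_const c * fps_deriv F - fps_const (a + b + 1) * (fps_X * fps_deriv F) - fps_const (a * b) * F"
    by (simp add: hyp_ode_def algebra_simps)
  also have "fps_nth \<dots> n = of_nat n * (of_nat (Suc n) * fps_nth F (Suc n)) - (of_nat n * (of_nat n * fps_nth F n) - of_nat n * fps_nth F n)
     + c * (of_nat (Suc n) * fps_nth F (Suc n)) - (a + b + 1) * (of_nat n * fps_nth F n) - a * b * fps_nth F n"
    by (simp only: fps_sub_nth fps_add_nth fps_mult_left_const_nth fps_X_deriv_nth fps_deriv_nth Suc_eq_plus1)
  finally show ?thesis by (simp add: algebra_simps)
qed

lemma fps_hyp_coeff:
  assumes c: "Re c > 0" and g0: "fps_nth G 0 = 1" and ode: "hyp_ode a b c G = 0"
  shows "fps_nth G n = pochhammer a n * pochhammer b n / (pochhammer c n * fact n)"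
proof (induction n)
  case (Suc n)
  have "of_nat (Suc n) * (of_nat n + c) * fps_nth G (Suc n) = (of_nat n + a) * (of_nat n + b) * fps_nth G n"
    using hyp_ode_nth[of a b c G n] unfolding ode by (simp del: of_nat_Suc)
  moreover have "of_nat n + c \<noteq> 0" using c by (auto simp: complex_eq_iff)
  moreover have "of_nat (Suc n) \<noteq> (0 :: complex)" by (rule of_nat_neq_0)
  ultimately have "fps_nth G (Suc n) = (of_nat n + a) * (of_nat n + b) * fps_nth G n / (of_nat (Suc n) * (of_nat n + c))"
    by (intro eq_divide_imp) (auto simp: mult_ac simp del: of_nat_Suc)
  then show ?case unfolding Suc by (simp add: pochhammer_Suc add.commute mult_ac)
qed (use g0 in simp)

lemma fps_hyp_ode:
  assumes c: "Re c > 0"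
  shows "hyp_ode a b c (Abs_fps (\<lambda>n. pochhammer a n * pochhammer b n / (pochhammer c n * fact n))) = 0"
proof (rule fps_ext)
  fix n
  have cn: "of_nat n + c \<noteq> 0" "of_nat (Suc n) \<noteq> (0 :: complex)" "pochhammer c n \<noteq> 0"
    using c pochhammer_nonzero[of c n] of_nat_neq_0[of n, where ?'a = complex] by (auto simp: complex_eq_iff simp del: of_nat_Suc)
  have "of_nat (Suc n) * (of_nat n + c) * (pochhammer a (Suc n) * pochhammer b (Suc n) / (pochhammer c (Suc n) * fact (Suc n)))
     = (of_nat n + a) * (of_nat n + b) * (pochhammer a n * pochhammer b n / (pochhammer c n * fact n))"
    using cn unfolding pochhammer_Suc fact_Suc of_nat_mult by (simp add: divide_simps add.commute del: of_nat_Suc)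
  then show "fps_nth (hyp_ode a b c (Abs_fps (\<lambda>n. pochhammer a n * pochhammer b n / (pochhammer c n * fact n)))) n = fps_nth 0 n"
    unfolding hyp_ode_nth fps_nth_Abs_fps by simp
qed

text \<open>
  The series is the formal power \<open>(1 - X)\<^sup>e\<close>.
\<close>

lemma fps_one_minus_power_deriv:
  "(1 - fps_X) * fps_deriv (Abs_fps (\<lambda>n. pochhammer (- e) n / fact n)) = - fps_const e * Abs_fps (\<lambda>n. pochhammer (- e) n / fact n :: complex)"
proof (rule fps_ext)
  fix n
  have nth: "fps_nth ((1 - fps_X) * fps_deriv E) n = of_nat (Suc n) * fps_nth E (Suc n) - of_nat n * fps_nth E n" for E :: "complex fps"
  proof -
    have "(1 - fps_X) * fps_deriv E = fps_deriv E - fps_X * fps_deriv E" by (simp add: algebra_simps)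
    then show ?thesis by (simp only: fps_sub_nth fps_X_deriv_nth fps_deriv_nth Suc_eq_plus1)
  qed
  have "of_nat (Suc n) * (pochhammer (- e) (Suc n) / fact (Suc n)) = (of_nat n - e) * (pochhammer (- e) n / fact n)"
    using of_nat_neq_0[of n, where ?'a = complex] unfolding pochhammer_Suc fact_Suc of_nat_mult by (simp del: of_nat_Suc)
  then show "fps_nth ((1 - fps_X) * fps_deriv (Abs_fps (\<lambda>n. pochhammer (- e) n / fact n))) n = fps_nth (- fps_const e * Abs_fps (\<lambda>n. pochhammer (- e) n / fact n)) n"
    unfolding nth fps_nth_Abs_fps by (simp add: algebra_simps diff_divide_distrib del: of_nat_Suc fact_Suc)
qed

text \<open>
  The algebraic core of Euler's transformation. The variables stand for \<open>F\<close>, for the power \<open>E\<close> of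
  \<open>1 - X\<close> with exponent \<open>A + B - C\<close>, for \<open>G = E * F\<close> and for their derivatives. As \<open>E'\<close> is not a
  polynomial multiple of \<open>E\<close>, the derivatives of \<open>G\<close> are known only after multiplication with
  \<open>1 - X\<close>, through \<open>(1 - X) * G' = E * H\<close>.
\<close>

lemma euler_ode_algebra:
  fixes X A B C E F F1 F2 G G1 G2 H H1 :: "'a :: idom"
  assumes "X * (1 - X) * F2 + (C - (A + B + 1) * X) * F1 - A * B * F = 0"
    and "H = - (A + B - C) * F + (1 - X) * F1"
    and "H1 = - (A + B - C) * F1 - F1 + (1 - X) * F2"
    and "G = E * F"
    and "(1 - X) * G1 = E * H"
    and "(1 - X) * ((1 - X) * G2 - G1) = - (A + B - C) * E * H + (1 - X) * (E * H1)"
  shows "(1 - X) * (X * (1 - X) * G2 + (C - (C - A + (C - B) + 1) * X) * G1 - (C - A) * (C - B) * G) = 0"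
  using assms by algebra

text \<open>
  Both sides are power series with constant term 1 that solve the hypergeometric equation with
  parameters \<open>c - a\<close>, \<open>c - b\<close> and \<open>c\<close>, which determines all coefficients.
\<close>

lemma hyp2f1_euler:
  fixes a b c x :: complex
  assumes c: "Re c > 0" and x: "norm x < 1"
  shows "(1 - x) powr (a + b - c) * hyp2f1_series a b c x = hyp2f1_series (c - a) (c - b) c x"
proof -
  define e where "e = a + b - c"
  define E where "E = Abs_fps (\<lambda>n. pochhammer (- e) n / fact n :: complex)"
  define F where "F = Abs_fps (\<lambda>n. pochhammer a n * pochhammer b n / (pochhammer c n * fact n) :: complex)"
  define G where "G = E * F"
  define H where "H = - fps_const e * F + (1 - fps_X) * fps_deriv F"
  have E1: "(1 - fps_X) * fps_deriv E = - fps_const e * E"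
    unfolding E_def by (rule fps_one_minus_power_deriv)
  have G1: "(1 - fps_X) * fps_deriv G = E * H"
  proof -
    have "(1 - fps_X) * fps_deriv G = ((1 - fps_X) * fps_deriv E) * F + E * ((1 - fps_X) * fps_deriv F)"
      by (simp add: G_def algebra_simps)
    then show ?thesis unfolding E1 H_def by (simp add: algebra_simps)
  qed
  have G2: "(1 - fps_X) * ((1 - fps_X) * fps_deriv (fps_deriv G) - fps_deriv G) = - fps_const e * E * H + (1 - fps_X) * (E * fps_deriv H)"
  proof -
    have "fps_deriv ((1 - fps_X) * fps_deriv G) = fps_deriv (E * H)" unfolding G1 ..
    then have "(1 - fps_X) * fps_deriv (fps_deriv G) - fps_deriv G = fps_deriv E * H + E * fps_deriv H"
      by (simp add: algebra_simps)
    then have "(1 - fps_X) * ((1 - fps_X) * fps_deriv (fps_deriv G) - fps_deriv G) = ((1 - fps_X) * fps_deriv E) * H + (1 - fps_X) * (E * fps_deriv H)"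
      by (simp only: distrib_left mult.assoc)
    then show ?thesis unfolding E1 .
  qed
  have H1: "fps_deriv H = - fps_const e * fps_deriv F - fps_deriv F + (1 - fps_X) * fps_deriv (fps_deriv F)"
    unfolding H_def by (simp add: algebra_simps)
  have e: "fps_const e = fps_const a + fps_const b - fps_const c" by (simp add: e_def)
  have cc: "fps_const (a + b + 1) = fps_const a + fps_const b + (1 :: complex fps)" "fps_const (a * b) = fps_const a * fps_const b"
    by (simp_all flip: fps_const_1_eq_1)
  have "(1 - fps_X) * (fps_X * (1 - fps_X) * fps_deriv (fps_deriv G) + (fps_const c - (fps_const c - fps_const a + (fps_const c - fps_const b) + 1) * fps_X) * fps_deriv G
      - (fps_const c - fps_const a) * (fps_const c - fps_const b) * G) = 0"
    by (rule euler_ode_algebra[OF fps_hyp_ode[OF c, of a b, folded F_def, unfolded hyp_ode_def cc] H_def[unfolded e] H1[unfolded e] G_def G1 G2[unfolded e]])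
  moreover have "(1 - fps_X :: complex fps) \<noteq> 0"
    using fps_nonzeroI[of "1 - fps_X :: complex fps" 0] by simp
  ultimately have "fps_X * (1 - fps_X) * fps_deriv (fps_deriv G) + (fps_const c - (fps_const c - fps_const a + (fps_const c - fps_const b) + 1) * fps_X) * fps_deriv G
      - (fps_const c - fps_const a) * (fps_const c - fps_const b) * G = 0"
    by simp
  moreover have "fps_const (c - a + (c - b) + 1) = fps_const c - fps_const a + (fps_const c - fps_const b) + (1 :: complex fps)"
    "fps_const ((c - a) * (c - b)) = (fps_const c - fps_const a) * (fps_const c - fps_const b)"
    by (simp_all flip: fps_const_1_eq_1)
  ultimately have "fps_X * (1 - fps_X) * fps_deriv (fps_deriv G) + (fps_const c - fps_const (c - a + (c - b) + 1) * fps_X) * fps_deriv G - fps_const ((c - a) * (c - b)) * G = 0"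
    by (simp only:)
  then have ode: "hyp_ode (c - a) (c - b) c G = 0" unfolding hyp_ode_def .
  have G0: "fps_nth G 0 = 1" by (simp add: G_def E_def F_def)
  have Gn: "fps_nth G n = pochhammer (c - a) n * pochhammer (c - b) n / (pochhammer c n * fact n)" for n
    by (rule fps_hyp_coeff[OF c G0 ode])
  have sE: "summable (\<lambda>n. norm (fps_nth E n * x ^ n))"
    using summable_hyp2f1[OF x, of "- e" 1 1] by (simp add: E_def flip: pochhammer_fact)
  have sF: "summable (\<lambda>n. norm (fps_nth F n * x ^ n))"
    using summable_hyp2f1[OF x, of a b c] by (simp add: F_def)
  have vE: "(\<Sum>n. fps_nth E n * x ^ n) = (1 - x) powr e"
  proof -
    have "(\<lambda>n. (e gchoose n) * (- x) ^ n) sums (1 + - x) powr e" using x by (intro gen_binomial_complex) simp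
    moreover have "(e gchoose n) * (- x) ^ n = fps_nth E n * x ^ n" for n
      by (simp add: E_def gbinomial_pochhammer power_minus[of x])
    ultimately show ?thesis by (simp add: sums_iff)
  qed
  have "(\<lambda>n. \<Sum>i\<le>n. (fps_nth E i * x ^ i) * (fps_nth F (n - i) * x ^ (n - i))) sums ((\<Sum>n. fps_nth E n * x ^ n) * (\<Sum>n. fps_nth F n * x ^ n))"
    by (rule Cauchy_product_sums[OF sE sF])
  also have "(\<lambda>n. \<Sum>i\<le>n. (fps_nth E i * x ^ i) * (fps_nth F (n - i) * x ^ (n - i))) = (\<lambda>n. fps_nth G n * x ^ n)"
  proof
    fix n
    have "(fps_nth E i * x ^ i) * (fps_nth F (n - i) * x ^ (n - i)) = fps_nth E i * fps_nth F (n - i) * x ^ n" if "i \<le> n" for i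
    proof -
      have "x ^ n = x ^ i * x ^ (n - i)" using that by (simp flip: power_add)
      then show ?thesis by (simp add: mult_ac)
    qed
    then show "(\<Sum>i\<le>n. (fps_nth E i * x ^ i) * (fps_nth F (n - i) * x ^ (n - i))) = fps_nth G n * x ^ n"
      unfolding G_def fps_mult_nth sum_distrib_right atMost_atLeast0 by (intro sum.cong refl) auto
  qed
  finally have "(\<lambda>n. fps_nth G n * x ^ n) sums ((1 - x) powr e * hyp2f1_series a b c x)"
    unfolding vE by (simp add: F_def hyp2f1_series_def)
  moreover have "(\<lambda>n. fps_nth G n * x ^ n) sums hyp2f1_series (c - a) (c - b) c x"
    unfolding Gn by (rule hyp2f1_series_sums[OF x])
  ultimately show ?thesis unfolding e_def by (rule sums_unique2)
qed

section \<open>The product of the two Bessel functions as a series\<close>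

lemma Gamma_add_nat_real:
  fixes s :: real
  assumes "s > 0" shows "Gamma (s + real n) = Gamma s * pochhammer s n"
proof -
  have "pochhammer s n = Gamma (s + real n) / Gamma s"
    using assms by (intro pochhammer_Gamma) (auto elim!: nonpos_Ints_cases)
  then show ?thesis using Gamma_real_pos[OF assms] by simp
qed

lemma Gamma_add_nat:
  fixes s :: complex
  assumes "Re s > 0" shows "Gamma (s + of_nat n) = Gamma s * pochhammer s n"
  using pochhammer_Gamma[of s n] Re_pos_not_nonpos_Int[OF assms] by (simp add: Gamma_eq_zero_iff)

lemma norm_rGamma_shift:
  assumes "Re \<nu> \<ge> 0"
  shows "norm (rGamma (\<nu> + of_nat j + 1 :: complex)) = norm (rGamma (\<nu> + 1)) / norm (pochhammer (\<nu> + 1) j)"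
proof -
  have "rGamma (\<nu> + 1) = pochhammer (\<nu> + 1) j * rGamma (\<nu> + 1 + of_nat j)" by (rule pochhammer_rGamma)
  moreover have "\<nu> + 1 + of_nat j = \<nu> + of_nat j + 1" by simp
  ultimately show ?thesis using pochhammer_nonzero[of "\<nu> + 1" j] assms by (simp only: norm_mult) simp
qed

text \<open>
  For \<open>y = 0\<close> this is a binomial series in \<open>h / X\<close>, and \<open>rint\<close> decreases in \<open>y\<close>.
\<close>

lemma summable_rint_series:
  assumes X: "X > 0" and y: "y \<ge> 0" and h: "0 \<le> h" "h < X" and s: "s > 0"
  shows "summable (\<lambda>i. h ^ i / fact i * rint (s + real i) X y)"
proof (rule summable_comparison_test)
  have r: "norm (complex_of_real (h / X)) < 1" using X h by (simp add: norm_divide)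
  have "summable (\<lambda>i. norm (pochhammer (of_real s) i * pochhammer 1 i / (pochhammer 1 i * fact i) * complex_of_real (h / X) ^ i))"
    by (rule summable_hyp2f1[OF r])
  also have "(\<lambda>i. norm (pochhammer (of_real s) i * pochhammer 1 i / (pochhammer 1 i * fact i) * complex_of_real (h / X) ^ i)) = (\<lambda>i. pochhammer s i / fact i * (h / X) ^ i)"
    using X h s by (auto simp: fun_eq_iff norm_mult norm_divide norm_power pochhammer_of_real pochhammer_pos less_imp_le simp flip: pochhammer_fact)
  finally have "summable (\<lambda>i. Gamma s * X powr (- s) * (pochhammer s i / fact i * (h / X) ^ i))" by (rule summable_mult)
  also have "(\<lambda>i. Gamma s * X powr (- s) * (pochhammer s i / fact i * (h / X) ^ i)) = (\<lambda>i. h ^ i / fact i * rint (s + real i) X 0)"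
  proof
    fix i
    have "Gamma (s + real i) = Gamma s * pochhammer s i"
      by (rule Gamma_add_nat_real[OF s])
    moreover have "X powr (- (s + real i)) = X powr (- s) / X ^ i"
      using X by (simp add: powr_diff powr_realpow minus_add_distrib[symmetric] flip: powr_realpow)
    ultimately show "Gamma s * X powr (- s) * (pochhammer s i / fact i * (h / X) ^ i) = h ^ i / fact i * rint (s + real i) X 0"
      using s X by (simp add: rint_gamma power_divide)
  qed
  finally show "summable (\<lambda>i. h ^ i / fact i * rint (s + real i) X 0)" .
  show "\<exists>N. \<forall>i\<ge>N. norm (h ^ i / fact i * rint (s + real i) X y) \<le> h ^ i / fact i * rint (s + real i) X 0"
    using X y h s by (intro exI[of _ 0] allI impI) (auto simp: rint_nonneg abs_mult intro!: mult_left_mono rint_mono divide_right_mono)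
qed

text \<open>
  Expand \<open>exp (- h * v)\<close> under the integral.
\<close>

lemma mint_shift_sums:
  assumes X: "X > 0" and y: "y > 0" and h: "0 \<le> h" "h < X" and s: "Re s > 0"
  shows "(\<lambda>i. (- of_real h) ^ i / fact i * mint (s + of_nat i) (of_real X) (of_real y)) sums mint s (of_real (X + h)) (of_real y)"
proof -
  let ?f = "\<lambda>i v. (- of_real h) ^ i / fact i * mker (s + of_nat i) (of_real X) (of_real y) v"
  have fi: "integrable lborel (?f i)" for i using X y by (intro integrable_mult_right mker_integrable) auto
  have e: "?f i v = mker s (of_real X) (of_real y) v * ((of_real (- h * v)) ^ i /\<^sub>R fact i)" for i v
  proof (cases "v > 0")
    case True
    then have "complex_of_real v ^ i = exp (of_nat i * of_real (ln v))" by (simp add: exp_of_nat_mult exp_of_real)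
    then have "mker (s + of_nat i) (of_real X) (of_real y) v = mker s (of_real X) (of_real y) v * of_real v ^ i"
      using True by (simp add: mker_def algebra_simps flip: exp_add)
    then show ?thesis by (simp add: scaleR_conv_of_real divide_inverse power_mult_distrib[symmetric] mult_ac)
  qed (simp add: mker_outside)
  have sm: "summable (\<lambda>i. norm (?f i v))" for v
    unfolding e norm_mult by (intro summable_mult summable_norm_exp)
  have sv: "(\<Sum>i. ?f i v) = mker s (of_real (X + h)) (of_real y) v" for v
  proof -
    have "(\<Sum>i. ?f i v) = mker s (of_real X) (of_real y) v * exp (of_real (- h * v))"
      unfolding e exp_def by (intro suminf_mult summable_exp_generic)
    then show ?thesis by (cases "v > 0") (auto simp: mker_def algebra_simps simp flip: exp_add)
  qed
  have n: "(LINT v|lborel. norm (?f i v)) = h ^ i / fact i * rint (Re s + real i) X y" for i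
    using h by (simp add: norm_mult norm_divide norm_power norm_mker rint_def)
  have "(\<lambda>i. integral\<^sup>L lborel (?f i)) sums (LINT v|lborel. (\<Sum>i. ?f i v))"
    by (rule sums_integral[OF fi AE_I2[OF sm]]) (unfold n, rule summable_rint_series, use assms in auto)
  then show ?thesis unfolding sv by (simp add: mint_def)
qed

text \<open>
  Induction on \<open>J\<close>. Let \<open>S J\<close> be the left-hand side. The recurrence of \<open>mint\<close>, applied to each term of
  \<open>y * S (J - 1)\<close>, gives terms of \<open>S J\<close>, with the total factor \<open>m * (\<nu> + m) + (\<nu> + J + m) * (J - m) = J * (J + \<nu>)\<close>
  in front of the \<open>m\<close>-th one.
\<close>

lemma bessel_diagonal:
  fixes \<nu> :: complex
  assumes X: "X > 0" and y: "y > 0" and nu: "Re \<nu> > 0"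
  shows "(\<Sum>m\<le>J. rGamma (\<nu> + of_nat m + 1) / fact m * of_real X ^ m * ((-1) ^ (J - m) / fact (J - m)) * mint (\<nu> + of_nat (J + m)) (of_real X) (of_real y))
     = of_real y ^ J * (rGamma (\<nu> + of_nat J + 1) / fact J) * mint \<nu> (of_real X) (of_real y)"
proof (induction J)
  case (Suc K)
  define J where "J = Suc K"
  define A where "A = (\<lambda>J m. rGamma (\<nu> + of_nat m + 1) / fact m * of_real X ^ m * ((-1) ^ (J - m) / fact (J - m)) :: complex)"
  define M where "M = (\<lambda>n. mint (\<nu> + of_nat n) (of_real X) (of_real y))"
  have rec: "of_real y * M (K + m) = of_real X * M (J + m + 1) - (\<nu> + of_nat (J + m)) * M (J + m)" for m
    using mint_recurrence[OF X y, of "\<nu> + of_nat (J + m)"] by (simp add: M_def J_def algebra_simps)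
  \<comment> \<open>The coefficients for \<open>K\<close> in terms of those for \<open>J\<close>, in the two ways that match the two terms of the recurrence.\<close>
  have P: "of_nat (Suc m) * (\<nu> + of_nat (Suc m)) * A J (Suc m) = of_real X * A K m" if "m \<le> K" for m
  proof -
    have "rGamma (\<nu> + of_nat m + 1) = (\<nu> + of_nat (Suc m)) * rGamma (\<nu> + of_nat (Suc m) + 1)"
      using rGamma_plus1[of "\<nu> + of_nat m + 1"] by (simp add: add_ac)
    moreover have "J - Suc m = K - m" by (simp add: J_def)
    ultimately show ?thesis using of_nat_neq_0[of m, where ?'a = complex] unfolding A_def fact_Suc of_nat_mult power_Suc
      by (simp add: divide_simps del: of_nat_Suc)
  qed
  have Q: "- of_nat (J - m) * A J m = A K m" if "m \<le> K" for m
  proof -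
    have "J - m = Suc (K - m)" using that by (simp add: J_def)
    then show ?thesis using of_nat_neq_0[of "K - m", where ?'a = complex] unfolding A_def
      by (simp add: divide_simps del: of_nat_Suc)
  qed
  have nz: "of_nat J * (of_nat J + \<nu>) \<noteq> 0" using nu by (auto simp: J_def complex_eq_iff)
  have "of_real y * (\<Sum>m\<le>K. A K m * M (K + m)) = (\<Sum>m\<le>K. A K m * (of_real X * M (J + m + 1) - (\<nu> + of_nat (J + m)) * M (J + m)))"
    unfolding sum_distrib_left by (intro sum.cong refl) (simp only: mult.left_commute[of "of_real y"] rec)
  also have "\<dots> = (\<Sum>m\<le>K. (of_real X * A K m) * M (J + Suc m)) - (\<Sum>m\<le>K. (\<nu> + of_nat (J + m)) * A K m * M (J + m))"
    unfolding sum_subtractf[symmetric] by (intro sum.cong refl) (simp add: algebra_simps)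
  also have "(\<Sum>m\<le>K. (of_real X * A K m) * M (J + Suc m)) = (\<Sum>m\<le>K. of_nat (Suc m) * (\<nu> + of_nat (Suc m)) * A J (Suc m) * M (J + Suc m))"
    by (intro sum.cong refl) (simp only: P atMost_iff)
  also have "\<dots> = (\<Sum>m\<le>J. of_nat m * (\<nu> + of_nat m) * A J m * M (J + m))"
    unfolding J_def by (subst sum.atMost_Suc_shift) simp
  also have "(\<Sum>m\<le>K. (\<nu> + of_nat (J + m)) * A K m * M (J + m)) = (\<Sum>m\<le>K. (\<nu> + of_nat (J + m)) * (- of_nat (J - m) * A J m) * M (J + m))"
    by (intro sum.cong refl) (simp only: Q atMost_iff)
  also have "\<dots> = (\<Sum>m\<le>J. (\<nu> + of_nat (J + m)) * (- of_nat (J - m) * A J m) * M (J + m))"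
    unfolding J_def by simp
  also have "(\<Sum>m\<le>J. of_nat m * (\<nu> + of_nat m) * A J m * M (J + m)) - \<dots> = (\<Sum>m\<le>J. of_nat J * (of_nat J + \<nu>) * (A J m * M (J + m)))"
    unfolding sum_subtractf[symmetric]
    by (intro sum.cong refl) (simp add: of_nat_diff algebra_simps)
  also have "\<dots> = of_nat J * (of_nat J + \<nu>) * (\<Sum>m\<le>J. A J m * M (J + m))"
    by (simp add: sum_distrib_left)
  finally have main: "of_nat J * (of_nat J + \<nu>) * (\<Sum>m\<le>J. A J m * M (J + m)) = of_real y * (\<Sum>m\<le>K. A K m * M (K + m))" ..
  have IH: "(\<Sum>m\<le>K. A K m * M (K + m)) = of_real y ^ K * (rGamma (\<nu> + of_nat K + 1) / fact K) * M 0"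
    using Suc.IH by (simp add: A_def M_def)
  have g: "rGamma (\<nu> + of_nat K + 1) = (of_nat J + \<nu>) * rGamma (\<nu> + of_nat J + 1)"
    using rGamma_plus1[of "\<nu> + of_nat K + 1"] by (simp add: J_def add_ac)
  have fJ: "(fact J :: complex) = of_nat J * fact K" by (simp add: J_def)
  have "of_nat J * (of_nat J + \<nu>) * (of_real y ^ J * (rGamma (\<nu> + of_nat J + 1) / fact J) * M 0)
     = of_real y * (of_real y ^ K * (rGamma (\<nu> + of_nat K + 1) / fact K) * M 0)"
    unfolding g fJ using nz by (simp add: J_def del: of_nat_Suc)
  then have "of_nat J * (of_nat J + \<nu>) * (\<Sum>m\<le>J. A J m * M (J + m)) = of_nat J * (of_nat J + \<nu>) * (of_real y ^ J * (rGamma (\<nu> + of_nat J + 1) / fact J) * M 0)"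
    unfolding main IH by simp
  then have "(\<Sum>m\<le>J. A J m * M (J + m)) = of_real y ^ J * (rGamma (\<nu> + of_nat J + 1) / fact J) * M 0"
    using nz by (simp only: mult_cancel_left) simp
  then show ?case by (simp add: A_def M_def J_def)
qed simp

text \<open>
  Expand \<open>mint (\<nu> + 2 * j) (X + h) y\<close> on the left in powers of \<open>h\<close>. The terms of total degree \<open>N\<close> in \<open>h\<close>
  add up to the \<open>N\<close>-th term of the Bessel series by \<open>bessel_diagonal\<close>.
\<close>

theorem bessel_addition_sums:
  fixes \<nu> :: complex
  assumes X: "X > 0" and y: "y > 0" and nu: "Re \<nu> > 0" and B: "Re \<nu> \<le> B" "1 \<le> B"
    and h: "0 \<le> h" "16 * B\<^sup>2 * (h / X) < 1"
  shows "(\<lambda>j. rGamma (\<nu> + of_nat j + 1) / fact j * of_real (h * X) ^ j * mint (\<nu> + 2 * of_nat j) (of_real (X + h)) (of_real y)) sums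
     (bseries \<nu> (of_real (h * y)) * mint \<nu> (of_real X) (of_real y))"
proof -
  define f where "f = (\<lambda>j i. rGamma (\<nu> + of_nat j + 1) / fact j * of_real (h * X) ^ j * ((- of_real h) ^ i / fact i * mint (\<nu> + 2 * of_nat j + of_nat i) (of_real X) (of_real y)))"
  define C where "C = norm (rGamma (\<nu> + 1)) * (Gamma (Re \<nu>) * X powr (- Re \<nu>))"
  have hX: "h < X"
  proof -
    have "1 * (h / X) \<le> 16 * B\<^sup>2 * (h / X)"
    proof (rule mult_right_mono)
      have "1 \<le> B\<^sup>2" using B(2) by (rule one_le_power)
      then show "1 \<le> 16 * B\<^sup>2" by linarith
    qed (use h X in auto)
    then have "h / X < 1" using h by linarith
    then show ?thesis using X by simp
  qed
  have bound: "norm (f j i) \<le> C * (norm (pochhammer (of_real (Re \<nu>) :: complex) (2 * j + i)) / (fact i * fact j * norm (pochhammer (\<nu> + 1) j)) * (h / X) ^ (j + i))" for j i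
  proof -
    have r: "norm (rGamma (\<nu> + of_nat j + 1)) = norm (rGamma (\<nu> + 1)) / norm (pochhammer (\<nu> + 1) j)"
      by (rule norm_rGamma_shift) (use nu in simp)
    have "norm (mint (\<nu> + 2 * of_nat j + of_nat i) (of_real X) (of_real y)) \<le> rint (Re \<nu> + real (2 * j + i)) X y"
      using norm_mint_le[of "of_real X" "of_real y" "\<nu> + 2 * of_nat j + of_nat i"] X y by (simp add: add_ac)
    also have "\<dots> \<le> rint (Re \<nu> + real (2 * j + i)) X 0" using X y nu by (intro rint_mono) auto
    also have "\<dots> = Gamma (Re \<nu> + real (2 * j + i)) * X powr (- (Re \<nu> + real (2 * j + i)))"
      using nu X by (intro rint_gamma) auto
    also have "Gamma (Re \<nu> + real (2 * j + i)) = Gamma (Re \<nu>) * norm (pochhammer (of_real (Re \<nu>) :: complex) (2 * j + i))"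
    proof -
      have "Gamma (Re \<nu> + real (2 * j + i)) = Gamma (Re \<nu>) * pochhammer (Re \<nu>) (2 * j + i)"
        by (rule Gamma_add_nat_real[OF nu])
      then show ?thesis using nu by (simp add: pochhammer_of_real pochhammer_pos less_imp_le)
    qed
    also have "X powr (- (Re \<nu> + real (2 * j + i))) = X powr (- Re \<nu>) / X ^ (2 * j + i)"
    proof -
      have e: "- (Re \<nu> + real (2 * j + i)) = - Re \<nu> - real (2 * j + i)" by simp
      show ?thesis unfolding e powr_diff powr_realpow[OF X] ..
    qed
    finally have m: "norm (mint (\<nu> + 2 * of_nat j + of_nat i) (of_real X) (of_real y)) \<le>
       Gamma (Re \<nu>) * norm (pochhammer (of_real (Re \<nu>) :: complex) (2 * j + i)) * (X powr (- Re \<nu>) / X ^ (2 * j + i))" .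
    have "norm (f j i) = norm (rGamma (\<nu> + 1)) / norm (pochhammer (\<nu> + 1) j) / fact j * (h * X) ^ j * (h ^ i / fact i) * norm (mint (\<nu> + 2 * of_nat j + of_nat i) (of_real X) (of_real y))"
      using h X unfolding f_def norm_mult norm_divide norm_power r norm_minus_cancel norm_of_real norm_fact by simp
    also have "\<dots> \<le> norm (rGamma (\<nu> + 1)) / norm (pochhammer (\<nu> + 1) j) / fact j * (h * X) ^ j * (h ^ i / fact i) *
       (Gamma (Re \<nu>) * norm (pochhammer (of_real (Re \<nu>) :: complex) (2 * j + i)) * (X powr (- Re \<nu>) / X ^ (2 * j + i)))"
      using h X by (intro mult_left_mono m) auto
    also have "\<dots> = C * (norm (pochhammer (of_real (Re \<nu>) :: complex) (2 * j + i)) / (fact i * fact j * norm (pochhammer (\<nu> + 1) j)) * (((h * X) ^ j * h ^ i) / X ^ (2 * j + i)))"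
      by (simp add: C_def mult_ac)
    also have "((h * X) ^ j * h ^ i) / X ^ (2 * j + i) = (h / X) ^ (j + i)"
      using X by (simp add: power_add power_mult_distrib power_divide mult_2)
    finally show ?thesis .
  qed
  have "(\<lambda>p. norm (f (fst p) (snd p))) summable_on UNIV"
  proof (rule summable_on_comparison_test)
    show "(\<lambda>p. C * (norm (pochhammer (of_real (Re \<nu>) :: complex) (2 * fst p + snd p)) / (fact (snd p) * fact (fst p) * norm (pochhammer (\<nu> + 1) (fst p))) * (h / X) ^ (fst p + snd p)))
        summable_on UNIV"
      using nu B h X by (intro pochhammer_pairs_summable) auto
  qed (use bound in auto)
  note ds = double_series[OF this]
  have row: "(\<Sum>i. f j i) = rGamma (\<nu> + of_nat j + 1) / fact j * of_real (h * X) ^ j * mint (\<nu> + 2 * of_nat j) (of_real (X + h)) (of_real y)" for j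
  proof -
    have "(\<lambda>i. f j i) sums (rGamma (\<nu> + of_nat j + 1) / fact j * of_real (h * X) ^ j * mint (\<nu> + 2 * of_nat j) (of_real (X + h)) (of_real y))"
      unfolding f_def using X y h hX nu by (intro sums_mult mint_shift_sums) (auto intro: add_pos_nonneg)
    then show ?thesis by (simp add: sums_iff)
  qed
  have diag: "(\<Sum>j\<le>N. f j (N - j)) = rGamma (\<nu> + of_nat N + 1) / fact N * of_real (h * y) ^ N * mint \<nu> (of_real X) (of_real y)" for N
  proof -
    have t: "f j (N - j) = of_real h ^ N * (rGamma (\<nu> + of_nat j + 1) / fact j * of_real X ^ j * ((-1) ^ (N - j) / fact (N - j)) * mint (\<nu> + of_nat (N + j)) (of_real X) (of_real y))"
      if "j \<le> N" for j
    proof -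
      have "complex_of_real h ^ N = of_real h ^ j * of_real h ^ (N - j)" using that by (simp flip: power_add)
      moreover have e: "\<nu> + 2 * of_nat j + of_nat (N - j) = \<nu> + of_nat (N + j)" using that by (simp add: of_nat_diff)
      ultimately show ?thesis unfolding f_def e by (simp add: power_mult_distrib power_minus[of "of_real h"] mult_ac)
    qed
    have "(\<Sum>j\<le>N. f j (N - j)) = of_real h ^ N * (\<Sum>j\<le>N. rGamma (\<nu> + of_nat j + 1) / fact j * of_real X ^ j * ((-1) ^ (N - j) / fact (N - j)) * mint (\<nu> + of_nat (N + j)) (of_real X) (of_real y))"
      unfolding sum_distrib_left by (rule sum.cong[OF refl], rule t) simp
    then show ?thesis unfolding bessel_diagonal[OF X y nu] by (simp add: power_mult_distrib mult_ac)
  qed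
  have "(\<lambda>N. rGamma (\<nu> + of_nat N + 1) / fact N * of_real (h * y) ^ N * mint \<nu> (of_real X) (of_real y)) sums (bseries \<nu> (of_real (h * y)) * mint \<nu> (of_real X) (of_real y))"
    unfolding bseries_def by (intro sums_mult2 summable_sums summable_norm_cancel[OF summable_bseries])
  then have "infsum (\<lambda>p. f (fst p) (snd p)) UNIV = bseries \<nu> (of_real (h * y)) * mint \<nu> (of_real X) (of_real y)"
    using ds(3) unfolding diag by (rule sums_unique2[rotated])
  then show ?thesis using ds(1) unfolding row by simp
qed

lemma powr_of_real_pos: "x > 0 \<Longrightarrow> complex_of_real x powr s = exp (s * of_real (ln x))"
  by (simp add: powr_def Ln_of_real)

text \<open>
  Scaling writes the second factor as a multiple of \<open>mint \<nu> X y\<close> with \<open>X = Z\<^sup>2 / (4 * y)\<close>, and the first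
  one contains \<open>bseries \<nu> (h * y)\<close> with \<open>h = z\<^sup>2 / (4 * y)\<close>. The free parameter \<open>y\<close> will be \<open>\<pi> * n\<close>, and both
  \<open>z * Z / y\<close> and \<open>(z\<^sup>2 + Z\<^sup>2) / y\<close> will then be independent of \<open>n\<close>.
\<close>

theorem Bessel_I_Bessel_K_sums:
  fixes \<nu> :: complex
  assumes z: "z > 0" and Z: "Z > 0" and y: "y > 0" and nu: "Re \<nu> > 0" and B: "Re \<nu> \<le> B" "1 \<le> B" and q: "16 * B\<^sup>2 * (z / Z)\<^sup>2 < 1"
  shows "(\<lambda>j. of_real (z * Z / (4 * y)) powr (\<nu> + 2 * of_nat j) * (rGamma (\<nu> + of_nat j + 1) / fact j) *
      mint (\<nu> + 2 * of_nat j) (of_real ((z\<^sup>2 + Z\<^sup>2) / (4 * y))) (of_real y) / 2)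
    sums (Bessel_I \<nu> (of_real z) * Bessel_K \<nu> (of_real Z))"
proof -
  define X h where "X = Z\<^sup>2 / (4 * y)" and "h = z\<^sup>2 / (4 * y)"
  have Xh: "X > 0" "h \<ge> 0" "h / X = (z / Z)\<^sup>2" using Z y by (simp_all add: X_def h_def power_divide)
  have nu0: "\<nu> \<noteq> 0" using nu by auto
  let ?p = "of_real (z * Z / (4 * y)) powr \<nu> / 2"
  have K: "Bessel_K \<nu> (of_real Z) = of_real (Z / (2 * y)) powr \<nu> * mint \<nu> (of_real X) (of_real y) / 2"
  proof -
    have "mint \<nu> (of_real Z / 2) (of_real Z / 2) = exp (\<nu> * of_real (ln (Z / (2 * y)))) * mint \<nu> (of_real (Z / (2 * y)) * (of_real Z / 2)) (of_real Z / 2 / of_real (Z / (2 * y)))"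
      using Z y by (intro mint_scale) simp
    moreover have "of_real (Z / (2 * y)) * (of_real Z / 2) = complex_of_real X" by (simp add: X_def power2_eq_square)
    moreover have "of_real Z / 2 / of_real (Z / (2 * y)) = complex_of_real y" using Z y by simp
    ultimately show ?thesis using Bessel_K_eq_mint[of "of_real Z" \<nu>] Z y powr_of_real_pos[of "Z / (2 * y)" \<nu>] by simp
  qed
  have I: "Bessel_I \<nu> (of_real z) = of_real (z / 2) powr \<nu> * bseries \<nu> (of_real (h * y))"
    using nu0 y by (simp add: Bessel_I_bseries h_def power_divide)
  have pp: "of_real (z / 2) powr \<nu> * of_real (Z / (2 * y)) powr \<nu> = of_real (z * Z / (4 * y)) powr \<nu>"
  proof -
    have "z * Z / (4 * y) = (z / 2) * (Z / (2 * y))" by simp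
    then have "ln (z * Z / (4 * y)) = ln (z / 2) + ln (Z / (2 * y))" using z Z y by (simp only: ln_mult_pos divide_pos_pos zero_less_numeral mult_pos_pos)
    then show ?thesis using z Z y powr_of_real_pos[of "z / 2"] powr_of_real_pos[of "Z / (2 * y)"] powr_of_real_pos[of "z * Z / (4 * y)"]
      by (simp add: distrib_left flip: exp_add)
  qed
  have IK: "Bessel_I \<nu> (of_real z) * Bessel_K \<nu> (of_real Z) = ?p * (bseries \<nu> (of_real (h * y)) * mint \<nu> (of_real X) (of_real y))"
    unfolding K I pp[symmetric] by simp
  have "(\<lambda>j. ?p * (rGamma (\<nu> + of_nat j + 1) / fact j * of_real (h * X) ^ j * mint (\<nu> + 2 * of_nat j) (of_real (X + h)) (of_real y))) sums (Bessel_I \<nu> (of_real z) * Bessel_K \<nu> (of_real Z))"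
    unfolding IK using Xh q B nu y by (intro sums_mult bessel_addition_sums) auto
  moreover have "of_real (z * Z / (4 * y)) powr (\<nu> + 2 * of_nat j) = of_real (z * Z / (4 * y)) powr \<nu> * of_real (h * X) ^ j" for j
  proof -
    have "h * X = (z * Z / (4 * y))\<^sup>2" by (simp add: h_def X_def power_divide power_mult_distrib power2_eq_square)
    moreover have "complex_of_real (z * Z / (4 * y)) powr (2 * of_nat j) = (of_real (z * Z / (4 * y)))\<^sup>2 ^ j"
      using powr_nat'[of "complex_of_real (z * Z / (4 * y))" "2 * j"] z Z y by (simp add: power_mult)
    ultimately show ?thesis by (simp add: powr_add)
  qed
  moreover have "X + h = (z\<^sup>2 + Z\<^sup>2) / (4 * y)" by (simp add: X_def h_def add_divide_distrib)
  ultimately show ?thesis by (simp add: mult_ac)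
qed

section \<open>The identity for real parameters close to each other\<close>

text \<open>
  The coefficients in \<open>Bessel_I_Bessel_K_sums\<close> if \<open>z * Z / y = \<pi> * (2 * c)\<close>.
\<close>

definition coef :: "complex \<Rightarrow> real \<Rightarrow> nat \<Rightarrow> complex" where
  "coef \<nu> c j = of_real (pi * c / 2) powr (\<nu> + 2 * of_nat j) * (rGamma (\<nu> + of_nat j + 1) / fact j) / 2"

lemma norm_powr_of_real: "x > 0 \<Longrightarrow> norm (of_real x powr s :: complex) = x powr Re s"
  by (simp add: norm_powr_real_powr)

lemma norm_coef:
  assumes "c > 0" "Re \<nu> \<ge> 0"
  shows "norm (coef \<nu> c j) = (pi * c / 2) powr Re \<nu> * norm (rGamma (\<nu> + 1)) / 2 * (((pi * c / 2)\<^sup>2) ^ j / (fact j * norm (pochhammer (\<nu> + 1) j)))"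
proof -
  have p: "pi * c / 2 > 0" using assms by simp
  have "(pi * c / 2) powr (Re \<nu> + 2 * real j) = (pi * c / 2) powr Re \<nu> * ((pi * c / 2)\<^sup>2) ^ j"
    using powr_realpow[OF p, of "2 * j"] by (simp add: powr_add power_mult)
  then show ?thesis
    unfolding coef_def norm_mult norm_divide norm_powr_of_real[OF p] norm_rGamma_shift[OF assms(2)] by (simp add: norm_fact mult_ac)
qed

text \<open>
  The majorant in \<open>j\<close> for the exchange of the sums over \<open>n\<close> and \<open>j\<close>.
\<close>

lemma coef_gamma_summable:
  assumes c: "c > 0" and P: "P > 0" and nu: "Re \<nu> > 0" and mu: "Re \<mu> > 0"
    and B: "norm \<mu> \<le> B" "1 \<le> B" and r: "16 * B\<^sup>2 * (c / (2 * P))\<^sup>2 < 1"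
  shows "summable (\<lambda>j. norm (coef \<nu> c j * Gamma (\<mu> + 2 * of_nat j)) * (1 / (pi * P)\<^sup>2) ^ j)"
proof -
  have "norm (coef \<nu> c j * Gamma (\<mu> + 2 * of_nat j)) * (1 / (pi * P)\<^sup>2) ^ j =
     ((pi * c / 2) powr Re \<nu> * norm (rGamma (\<nu> + 1)) / 2 * norm (Gamma \<mu>))
      * (norm (pochhammer \<mu> (2 * j)) / (fact j * norm (pochhammer (\<nu> + 1) j)) * ((c / (2 * P))\<^sup>2) ^ j)" for j
  proof -
    have 1: "Gamma (\<mu> + 2 * of_nat j) = Gamma \<mu> * pochhammer \<mu> (2 * j)"
      using Gamma_add_nat[OF mu, of "2 * j"] by simp
    have 2: "((pi * c / 2)\<^sup>2) ^ j * (1 / (pi * P)\<^sup>2) ^ j = ((c / (2 * P))\<^sup>2) ^ j"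
      unfolding power_mult_distrib[symmetric]
      by (rule arg_cong[of _ _ "\<lambda>x. x ^ j"]) (use P in \<open>simp add: power2_eq_square divide_simps\<close>)
    show ?thesis unfolding 1 norm_mult norm_coef[OF c less_imp_le[OF nu]] 2[symmetric] by simp
  qed
  then show ?thesis
    using summable_mult[OF pochhammer_even_summable[OF B less_imp_le[OF nu] zero_le_power2 r]] by (simp only:)
qed

lemma regroup_gamma:
  fixes u :: complex
  assumes "u * v * w * z = s * t"
  shows "u / 2 * (g / h) * v * (p / (f * k) * w * z) = s * (1 / (h * k) / f) / 2 * (g * p * t)"
proof -
  have "u / 2 * (g / h) * v * (p / (f * k) * w * z) = (u * v * w * z) * (g * p / (2 * h * f * k))" by (simp add: mult_ac)
  also have "\<dots> = s * (1 / (h * k) / f) / 2 * (g * p * t)" unfolding assms by (simp add: mult_ac)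
  finally show ?thesis .
qed

lemma regroup_const:
  fixes x :: complex
  assumes "x = 1 / p * d * s * u" "u * F = h"
  shows "x * (g / e) * Q * F = g / (p * e) * (d * Q * s * h)"
  unfolding assms(1) assms(2)[symmetric] by (simp add: mult_ac)

text \<open>
  The powers of 2 in the constant of the identity; \<open>w\<close> stands for \<open>2 / (A + D)\<close> and \<open>T\<close> for \<open>A * D\<close>, where
  \<open>A\<close> and \<open>D\<close> are the two square roots in the \<open>n\<close>-th term.
\<close>

lemma power_balance:
  fixes w T :: real
  assumes "w \<noteq> 0" "T \<noteq> 0"
  shows "w ^ (m + 2) / 2 = 1 / 2 ^ (m + 1) * (1 / T) * (2 / (w * T)) ^ m * (T * w\<^sup>2) ^ (m + 1)"
proof (induction m)
  case 0
  then show ?case using assms by (simp add: power2_eq_square)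
next
  case (Suc m)
  have f: "1 / 2 * (2 / (w * T)) * (T * w\<^sup>2) = w" using assms by (simp add: power2_eq_square)
  have "w ^ (Suc m + 2) / 2 = w ^ (m + 2) / 2 * w" by simp
  also have "\<dots> = (1 / 2 ^ (m + 1) * (1 / T) * (2 / (w * T)) ^ m * (T * w\<^sup>2) ^ (m + 1)) * (1 / 2 * (2 / (w * T)) * (T * w\<^sup>2))"
    unfolding Suc f ..
  also have "\<dots> = 1 / 2 ^ (Suc m + 1) * (1 / T) * (2 / (w * T)) ^ Suc m * (T * w\<^sup>2) ^ (Suc m + 1)"
    by (simp only: power_Suc add_Suc) (simp add: mult_ac)
  finally show ?case .
qed

text \<open>
  The sum over \<open>j\<close> that is left after the inversion formula has been applied, evaluated by
  \<open>hyp2f1_quadratic\<close> with \<open>x = q\<^sup>2\<close>. It is used twice, with \<open>a = k / 2\<close> and with \<open>a = 0\<close>.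
\<close>

lemma coef_gamma_sums:
  assumes P: "P > 0" and q: "0 < q" and c: "c = 2 * q * P / (1 + q\<^sup>2)" and nu: "Re \<nu> > 0" and a: "a \<ge> 0"
    and B: "norm (\<nu> + of_real a) \<le> B" "1 \<le> B" and r: "16 * B\<^sup>2 * q\<^sup>2 < 1"
  shows "(\<lambda>j. coef \<nu> c j * (Gamma (\<nu> + 2 * of_nat j + of_real a) * of_real (pi * P) powr (- (\<nu> + 2 * of_nat j + of_real a)))) sums
     (of_real ((pi * P / (1 + q\<^sup>2)) powr (- a)) / 2 * (Gamma (\<nu> + of_real a) / Gamma (\<nu> + 1)) * of_real q powr \<nu> *
       hyp2f1_series (\<nu> + of_real a) (of_real a) (\<nu> + 1) (of_real (q\<^sup>2)))"
proof -
  let ?b = "\<nu> + of_real a"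
  let ?K = "of_real ((pi * P / (1 + q\<^sup>2)) powr (- a)) / 2 * (Gamma ?b / Gamma (\<nu> + 1)) * of_real q powr \<nu>"
  have q1: "1 + q\<^sup>2 > 0" by (simp add: add_pos_nonneg)
  have "(\<lambda>j. ?K * (pochhammer ?b (2 * j) / (fact j * pochhammer (\<nu> + 1) j) * of_real (q\<^sup>2) ^ j * (1 + of_real (q\<^sup>2)) powr (- (?b + 2 * of_nat j)))) sums
     (?K * hyp2f1_series ?b (of_real a) (\<nu> + 1) (of_real (q\<^sup>2)))"
    using nu B r by (intro sums_mult hyp2f1_quadratic) (auto simp: norm_power)
  moreover have "?K * (pochhammer ?b (2 * j) / (fact j * pochhammer (\<nu> + 1) j) * of_real (q\<^sup>2) ^ j * (1 + of_real (q\<^sup>2)) powr (- (?b + 2 * of_nat j)))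
      = coef \<nu> c j * (Gamma (\<nu> + 2 * of_nat j + of_real a) * of_real (pi * P) powr (- (\<nu> + 2 * of_nat j + of_real a)))" for j
  proof -
    have G: "Gamma (\<nu> + 2 * of_nat j + of_real a) = Gamma ?b * pochhammer ?b (2 * j)"
      using Gamma_add_nat[of ?b "2 * j"] nu a by (simp add: add_ac)
    have R: "rGamma (\<nu> + of_nat j + 1) = 1 / (Gamma (\<nu> + 1) * pochhammer (\<nu> + 1) j)"
      using Gamma_add_nat[of "\<nu> + 1" j] nu by (simp add: rGamma_inverse_Gamma divide_inverse add_ac)
    define lq where "lq = complex_of_real (ln q)"
    define l1 where "l1 = complex_of_real (ln (1 + q\<^sup>2))"
    define lp where "lp = complex_of_real (ln (pi * P))"
    have pP: "pi * P > 0" using P by simp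
    have pc: "pi * c / 2 = q * (pi * P) / (1 + q\<^sup>2)"
    proof -
      have "c * (1 + q\<^sup>2) = 2 * q * P" using q1 by (simp add: c)
      moreover have "pi * c / 2 * (1 + q\<^sup>2) = pi * (c * (1 + q\<^sup>2)) / 2" by simp
      ultimately have "pi * c / 2 * (1 + q\<^sup>2) = q * (pi * P)" by simp
      then show ?thesis using q1 by (simp only: eq_divide_eq) simp
    qed
    have "ln (pi * c / 2) = ln q + ln (pi * P) - ln (1 + q\<^sup>2)"
      unfolding pc using q1 ln_divide_pos[OF mult_pos_pos[OF q pP] q1] ln_mult_pos[OF q pP] by linarith
    moreover have "pi * c / 2 > 0" unfolding pc by (rule divide_pos_pos[OF mult_pos_pos[OF q pP] q1])
    ultimately have 1: "of_real (pi * c / 2) powr s = exp (s * (lq + lp - l1))" for s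
      by (simp only: powr_of_real_pos lq_def lp_def l1_def of_real_add of_real_diff)
    have 2: "of_real (pi * P) powr s = exp (s * lp)" for s
      unfolding lp_def using pP by (rule powr_of_real_pos)
    have 3: "of_real q powr s = exp (s * lq)" for s unfolding lq_def using q by (rule powr_of_real_pos)
    have 4: "(1 + of_real (q\<^sup>2)) powr s = exp (s * l1)" for s
      using powr_of_real_pos[OF q1, of s] by (simp add: l1_def)
    have 5: "of_real ((pi * P / (1 + q\<^sup>2)) powr (- a)) = exp (- of_real a * (lp - l1))"
    proof -
      have "(pi * P / (1 + q\<^sup>2)) powr (- a) = exp (- a * (ln (pi * P) - ln (1 + q\<^sup>2)))"
        using pP q1 by (simp only: powr_def ln_div) (use pP q1 in auto)
      then show ?thesis by (simp add: lp_def l1_def flip: exp_of_real)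
    qed
    have 6: "of_real (q\<^sup>2) ^ j = exp (2 * of_nat j * lq)"
    proof -
      have "complex_of_real q = exp lq" using q by (simp add: lq_def exp_of_real)
      then have "of_real (q\<^sup>2) ^ j = exp lq ^ (2 * j)" by (simp add: power_mult)
      then show ?thesis by (simp flip: exp_of_nat_mult)
    qed
    have "exp (- of_real a * (lp - l1)) * exp (\<nu> * lq) * exp (2 * of_nat j * lq) * exp (- (?b + 2 * of_nat j) * l1)
       = exp ((\<nu> + 2 * of_nat j) * (lq + lp - l1)) * exp (- (\<nu> + 2 * of_nat j + of_real a) * lp)"
      unfolding exp_add[symmetric] by (rule arg_cong[of _ _ exp]) (simp add: algebra_simps)
    then show ?thesis unfolding coef_def G R 1 2 3 4 5 6 by (rule regroup_gamma)
  qed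
  ultimately show ?thesis by simp
qed

text \<open>
  With \<open>a\<^sup>2 = \<alpha>\<close> and \<open>b\<^sup>2 = \<beta>\<close>, the terms of the two series are \<open>lterm k \<nu> n a b\<close> and
  \<open>rterm k \<nu> n a b\<close>. They are functions of the roots \<open>a\<close> and \<open>b\<close> because the domain
  \<open>Re a > Re b > 0\<close> of the continuation is described by the roots.
\<close>

definition shroot :: "complex \<Rightarrow> nat \<Rightarrow> complex" where
  "shroot a n = csqrt (of_nat n + a\<^sup>2)"

definition qratio :: "complex \<Rightarrow> complex \<Rightarrow> nat \<Rightarrow> complex" where
  "qratio a b n = (shroot a n - shroot b n) / (shroot a n + shroot b n)"

definition lterm :: "nat \<Rightarrow> complex \<Rightarrow> nat \<Rightarrow> complex \<Rightarrow> complex \<Rightarrow> complex" where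
  "lterm k \<nu> n a b = of_nat (sum_squares_reps k n) *
     Bessel_I \<nu> (of_real (pi * sqrt (real n)) * (a - b)) * Bessel_K \<nu> (of_real (pi * sqrt (real n)) * (a + b))"

definition rterm :: "nat \<Rightarrow> complex \<Rightarrow> nat \<Rightarrow> complex \<Rightarrow> complex \<Rightarrow> complex" where
  "rterm k \<nu> n a b = of_nat (sum_squares_reps k n) / (shroot a n * shroot b n) * qratio a b n powr \<nu> *
     (1 / shroot a n + 1 / shroot b n) ^ (k - 2) *
     hyp2f1 (\<nu> + 1 - of_nat k / 2) (1 - of_nat k / 2) (\<nu> + 1) (qratio a b n ^ 2)"

definition rconst :: "nat \<Rightarrow> complex \<Rightarrow> complex" where
  "rconst k \<nu> = Gamma (\<nu> + of_nat k / 2) / (of_real (pi powr (real k / 2)) * 2 ^ (k - 1) * Gamma (\<nu> + 1))"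

lemma hyp2f1_series_commute: "hyp2f1_series a b c x = hyp2f1_series b a c x"
  by (simp add: hyp2f1_series_def mult.commute)

lemma hyp2f1_series_zero: "hyp2f1_series a 0 c x = 1"
proof -
  have "hyp2f1_series a 0 c x = (\<Sum>n. if n = 0 then 1 else 0)"
    unfolding hyp2f1_series_def by (intro suminf_cong) (auto simp: pochhammer_0_left)
  also have "\<dots> = 1" by (subst suminf_finite[of "{0}"]) auto
  finally show ?thesis .
qed

text \<open>
  Let \<open>A\<close> and \<open>D\<close> be the two roots. Then \<open>P / (1 + q\<^sup>2) = ((A + D) / 2)\<^sup>2\<close> and
  \<open>1 - q\<^sup>2 = 4 * A * D / (A + D)\<^sup>2\<close>, which identifies all factors once Euler's transformation has been
  applied.
\<close>

lemma rterm_real: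
  assumes k: "k \<ge> 2" and b: "b > 0" and ab: "b < a" and nu: "Re \<nu> > 0"
    and B: "norm \<nu> + real k \<le> B" "1 \<le> B" and r: "16 * B\<^sup>2 * ((a - b) / (a + b))\<^sup>2 < 1"
  shows "(\<lambda>j. of_nat (sum_squares_reps k n) * (coef \<nu> ((a\<^sup>2 - b\<^sup>2) / 2) j * (Gamma (\<nu> + 2 * of_nat j + of_nat k / 2) *
      of_real (pi * (real n + (a\<^sup>2 + b\<^sup>2) / 2)) powr (- (\<nu> + 2 * of_nat j + of_nat k / 2)))))
    sums (rconst k \<nu> * rterm k \<nu> n (of_real a) (of_real b))"
proof -
  define A where "A = sqrt (real n + a\<^sup>2)"
  define D where "D = sqrt (real n + b\<^sup>2)"
  define P where "P = real n + (a\<^sup>2 + b\<^sup>2) / 2"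
  define c where "c = (a\<^sup>2 - b\<^sup>2) / 2"
  define q where "q = (A - D) / (A + D)"
  have a: "a > 0" using b ab by simp
  have A2: "A\<^sup>2 = real n + a\<^sup>2" "D\<^sup>2 = real n + b\<^sup>2" by (simp_all add: A_def D_def)
  have "a\<^sup>2 > b\<^sup>2" using b ab by (simp add: power_strict_mono)
  then have AD: "A > D" by (simp add: A_def D_def)
  have D: "D > 0" "A > 0" using a b by (simp_all add: A_def D_def add_nonneg_pos)
  have "A \<ge> a" "D \<ge> b" using a b by (simp_all add: A_def D_def real_le_rsqrt)
  have q0: "q > 0" using AD D by (simp add: q_def)
  have AD1: "A + D > 0" using D by simp
  have x1: "1 + q\<^sup>2 = 2 * (A\<^sup>2 + D\<^sup>2) / (A + D)\<^sup>2" "1 - q\<^sup>2 = 4 * A * D / (A + D)\<^sup>2"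
    using AD1 by (simp_all add: q_def power_divide divide_simps) (simp_all add: power2_eq_square algebra_simps)
  have P1: "P = (A\<^sup>2 + D\<^sup>2) / 2" unfolding A2 P_def by (simp add: field_simps)
  have P0: "P > 0" using D by (simp add: P1 add_pos_pos)
  have PQ: "P / (1 + q\<^sup>2) = ((A + D) / 2)\<^sup>2"
  proof -
    define W where "W = A\<^sup>2 + D\<^sup>2"
    have "W \<noteq> 0" using D by (simp add: W_def sum_power2_eq_zero_iff)
    then show ?thesis unfolding x1 P1 W_def[symmetric] using AD1 by (simp add: power_divide)
  qed
  have c1: "c = 2 * q * P / (1 + q\<^sup>2)"
  proof -
    have "2 * q * P / (1 + q\<^sup>2) = 2 * q * (P / (1 + q\<^sup>2))" by simp
    also have "\<dots> = 2 * q * ((A + D) / 2)\<^sup>2" by (simp only: PQ)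
    also have "\<dots> = (A - D) * (A + D) / 2" unfolding q_def using AD1 by (simp add: power2_eq_square)
    also have "\<dots> = c" unfolding c_def using A2 by (simp add: power2_eq_square algebra_simps)
    finally show ?thesis ..
  qed
  have qle: "q \<le> (a - b) / (a + b)"
  proof -
    have "q = (A\<^sup>2 - D\<^sup>2) / (A + D)\<^sup>2" using AD1 by (simp add: q_def power2_eq_square divide_simps) (simp add: algebra_simps)
    also have "A\<^sup>2 - D\<^sup>2 = a\<^sup>2 - b\<^sup>2" unfolding A2 by simp
    also have "(a\<^sup>2 - b\<^sup>2) / (A + D)\<^sup>2 \<le> (a\<^sup>2 - b\<^sup>2) / (a + b)\<^sup>2"
      using \<open>A \<ge> a\<close> \<open>D \<ge> b\<close> \<open>a\<^sup>2 > b\<^sup>2\<close> a b ab by (intro divide_left_mono power_mono mult_pos_pos zero_less_power) auto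
    also have "\<dots> = (a - b) / (a + b)" using a b by (simp add: power2_eq_square divide_simps) (simp add: algebra_simps)
    finally show ?thesis .
  qed
  have rq: "16 * B\<^sup>2 * q\<^sup>2 < 1"
  proof -
    have "q\<^sup>2 \<le> ((a - b) / (a + b))\<^sup>2" using qle q0 by (intro power_mono) auto
    then have "16 * B\<^sup>2 * q\<^sup>2 \<le> 16 * B\<^sup>2 * ((a - b) / (a + b))\<^sup>2" by (intro mult_left_mono) auto
    then show ?thesis using r by linarith
  qed
  have Bk: "norm (\<nu> + of_real (real k / 2)) \<le> B"
    using norm_triangle_ineq[of \<nu> "of_real (real k / 2)"] B(1) by (simp add: norm_divide)
  have q1: "q\<^sup>2 < 1"
  proof -
    have "1 * q\<^sup>2 \<le> 16 * B\<^sup>2 * q\<^sup>2" using one_le_power[OF B(2), of 2] by (intro mult_right_mono) auto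
    then show ?thesis using rq by linarith
  qed
  have k2: "of_real (real k / 2) = (of_nat k / 2 :: complex)" by simp
  let ?F = "hyp2f1_series (\<nu> + of_nat k / 2) (of_nat k / 2) (\<nu> + 1) (of_real (q\<^sup>2))"
  let ?H = "hyp2f1_series (\<nu> + 1 - of_nat k / 2) (1 - of_nat k / 2) (\<nu> + 1) (of_real (q\<^sup>2))"
  have sums: "(\<lambda>j. coef \<nu> c j * (Gamma (\<nu> + 2 * of_nat j + of_nat k / 2) * of_real (pi * P) powr (- (\<nu> + 2 * of_nat j + of_nat k / 2)))) sums
     (of_real ((pi * P / (1 + q\<^sup>2)) powr (- (real k / 2))) / 2 * (Gamma (\<nu> + of_nat k / 2) / Gamma (\<nu> + 1)) * of_real q powr \<nu> * ?F)"
    using coef_gamma_sums[OF P0 q0 c1 nu _ Bk B(2) rq] unfolding k2 by simp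
  have HF: "of_real ((1 - q\<^sup>2) ^ (k - 1)) * ?F = ?H"
  proof -
    have "(1 - of_real (q\<^sup>2)) powr (of_nat k / 2 + (\<nu> + of_nat k / 2) - (\<nu> + 1)) * hyp2f1_series (of_nat k / 2) (\<nu> + of_nat k / 2) (\<nu> + 1) (of_real (q\<^sup>2))
       = hyp2f1_series (\<nu> + 1 - of_nat k / 2) (\<nu> + 1 - (\<nu> + of_nat k / 2)) (\<nu> + 1) (of_real (q\<^sup>2))"
    proof (rule hyp2f1_euler)
      show "norm (complex_of_real (q\<^sup>2)) < 1" unfolding norm_of_real using q1 by simp
    qed (use nu in simp)
    moreover have "of_nat k / 2 + (\<nu> + of_nat k / 2) - (\<nu> + 1) = (of_nat (k - 1) :: complex)" using k by (simp add: of_nat_diff)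
    moreover have "(1 - complex_of_real (q\<^sup>2)) powr of_nat (k - 1) = of_real ((1 - q\<^sup>2) ^ (k - 1))"
    proof -
      have "complex_of_real (1 - q\<^sup>2) \<noteq> 0" using q1 by (simp only: of_real_eq_0_iff)
      then have "complex_of_real (1 - q\<^sup>2) powr of_nat (k - 1) = of_real (1 - q\<^sup>2) ^ (k - 1)" by (intro powr_nat' disjI1)
      then show ?thesis by simp
    qed
    moreover have "\<nu> + 1 - (\<nu> + of_nat k / 2) = 1 - of_nat k / 2" by simp
    ultimately show ?thesis by (simp only: hyp2f1_series_commute[of "of_nat k / 2" "\<nu> + of_nat k / 2"])
  qed
  have const: "(pi * P / (1 + q\<^sup>2)) powr (- (real k / 2)) / 2 = 1 / (pi powr (real k / 2) * 2 ^ (k - 1)) * (1 / (A * D)) * (1 / A + 1 / D) ^ (k - 2) * (1 - q\<^sup>2) ^ (k - 1)"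
  proof -
    define S where "S = A + D"
    define T where "T = A * D"
    have ST: "S > 0" "T > 0" using AD1 D by (simp_all add: S_def T_def)
    obtain m where m: "k = m + 2" using k by (metis le_add_diff_inverse2)
    have "(pi * P / (1 + q\<^sup>2)) powr (- (real k / 2)) = (pi * (P / (1 + q\<^sup>2))) powr (- (real k / 2))" by simp
    also have "\<dots> = pi powr (- (real k / 2)) * ((S / 2)\<^sup>2) powr (- (real k / 2))" unfolding PQ S_def by (rule powr_mult)
    also have "((S / 2)\<^sup>2) powr (- (real k / 2)) = 1 / (S / 2) ^ k"
    proof -
      have e: "(S / 2)\<^sup>2 = (S / 2) powr 2" using ST by simp
      have "((S / 2)\<^sup>2) powr (- (real k / 2)) = (S / 2) powr (- real k)" unfolding e powr_powr by simp
      also have "\<dots> = 1 / (S / 2) ^ k"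
      proof -
        have "S / 2 > 0" using ST by simp
        then show ?thesis by (simp only: powr_minus_divide powr_realpow)
      qed
      finally show ?thesis .
    qed
    finally have 1: "(pi * P / (1 + q\<^sup>2)) powr (- (real k / 2)) / 2 = pi powr (- (real k / 2)) * (1 / (S / 2) ^ k / 2)" by simp
    have 2: "1 / A + 1 / D = S / T" using D by (simp add: S_def T_def field_simps)
    have 3: "1 - q\<^sup>2 = 4 * T / S\<^sup>2" unfolding x1 by (simp add: S_def T_def)
    have "1 / (S / 2) ^ k / 2 = 1 / 2 ^ (k - 1) * (1 / T) * (S / T) ^ (k - 2) * (4 * T / S\<^sup>2) ^ (k - 1)"
    proof -
      have e: "S / 2 = 1 / (2 / S)" "S / T = 2 / ((2 / S) * T)" "4 * T / S\<^sup>2 = T * (2 / S)\<^sup>2"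
        using ST by (simp_all add: power_divide)
      have "1 / (1 / (2 / S)) ^ k = (2 / S) ^ (m + 2)" unfolding m by (simp add: power_divide)
      moreover have "k - 2 = m" "k - 1 = m + 1" by (simp_all add: m)
      ultimately show ?thesis using power_balance[of "2 / S" T m] ST unfolding e by simp
    qed
    moreover have "pi powr (- (real k / 2)) = 1 / pi powr (real k / 2)" by (rule powr_minus_divide)
    ultimately show ?thesis unfolding 1 2 3 T_def[symmetric] by simp
  qed
  have roots: "shroot (of_real a) n = of_real A" "shroot (of_real b) n = of_real D"
  proof -
    have "shroot (of_real a) n = csqrt (of_real (real n + a\<^sup>2))" "shroot (of_real b) n = csqrt (of_real (real n + b\<^sup>2))"
      by (simp_all add: shroot_def)
    then show "shroot (of_real a) n = of_real A" "shroot (of_real b) n = of_real D"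
      unfolding A_def D_def by (simp_all only: of_real_sqrt add_nonneg_nonneg of_nat_0_le_iff zero_le_power2)
  qed
  have qr: "qratio (of_real a) (of_real b) n = of_real q" unfolding qratio_def roots q_def by simp
  have h: "hyp2f1 (\<nu> + 1 - of_nat k / 2) (1 - of_nat k / 2) (\<nu> + 1) (of_real q ^ 2) = ?H"
    using q1 by (simp add: hyp2f1_def norm_power abs_square_less_1)
  have "of_real ((pi * P / (1 + q\<^sup>2)) powr (- (real k / 2))) / 2 * (Gamma (\<nu> + of_nat k / 2) / Gamma (\<nu> + 1)) * of_real q powr \<nu> * ?F
    = rconst k \<nu> * (1 / (of_real A * of_real D) * of_real q powr \<nu> * (1 / of_real A + 1 / of_real D) ^ (k - 2) * ?H)"
  proof -
    have "of_real ((pi * P / (1 + q\<^sup>2)) powr (- (real k / 2))) / 2 = complex_of_real ((pi * P / (1 + q\<^sup>2)) powr (- (real k / 2)) / 2)" by simp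
    also have "\<dots> = 1 / (of_real (pi powr (real k / 2)) * 2 ^ (k - 1)) * (1 / (of_real A * of_real D)) * (1 / of_real A + 1 / of_real D) ^ (k - 2) * of_real ((1 - q\<^sup>2) ^ (k - 1))"
      unfolding const by (simp only: of_real_mult of_real_divide of_real_1 of_real_add of_real_power of_real_numeral)
    finally show ?thesis unfolding rconst_def by (rule regroup_const[OF _ HF])
  qed
  then have "(\<lambda>j. coef \<nu> c j * (Gamma (\<nu> + 2 * of_nat j + of_nat k / 2) * of_real (pi * P) powr (- (\<nu> + 2 * of_nat j + of_nat k / 2)))) sums
     (rconst k \<nu> * (1 / (of_real A * of_real D) * of_real q powr \<nu> * (1 / of_real A + 1 / of_real D) ^ (k - 2) * ?H))"
    using sums by simp
  then have "(\<lambda>j. of_nat (sum_squares_reps k n) * (coef \<nu> c j * (Gamma (\<nu> + 2 * of_nat j + of_nat k / 2) * of_real (pi * P) powr (- (\<nu> + 2 * of_nat j + of_nat k / 2))))) sums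
     (of_nat (sum_squares_reps k n) * (rconst k \<nu> * (1 / (of_real A * of_real D) * of_real q powr \<nu> * (1 / of_real A + 1 / of_real D) ^ (k - 2) * ?H)))"
    by (rule sums_mult)
  then show ?thesis unfolding rterm_def roots qr h c_def P_def by (simp add: mult_ac)
qed

text \<open>
  Here \<open>z * Z / (4 * y)\<close> and \<open>(z\<^sup>2 + Z\<^sup>2) / (4 * y)\<close> do not depend on \<open>n\<close>, since \<open>z\<close> and \<open>Z\<close> are proportional to
  \<open>sqrt n\<close> and \<open>y\<close> is proportional to \<open>n\<close>.
\<close>

lemma lterm_real:
  assumes b: "b > 0" and ab: "b < a" and nu: "Re \<nu> > 0"
    and B: "norm \<nu> + real k \<le> B" "1 \<le> B" and r: "16 * B\<^sup>2 * ((a - b) / (a + b))\<^sup>2 < 1"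
  shows "(\<lambda>j. of_nat (sum_squares_reps k (Suc n)) * (coef \<nu> ((a\<^sup>2 - b\<^sup>2) / 2) j *
      mint (\<nu> + 2 * of_nat j) (of_real (pi * ((a\<^sup>2 + b\<^sup>2) / 2))) (of_real (pi * real (Suc n)))))
    sums lterm k \<nu> (Suc n) (of_real a) (of_real b)"
proof -
  define s where "s = sqrt (real (Suc n))"
  have s: "s > 0" "s\<^sup>2 = real (Suc n)" by (simp_all add: s_def)
  define z where "z = pi * s * (a - b)"
  define Z where "Z = pi * s * (a + b)"
  have z: "z > 0" "Z > 0" using s ab b by (simp_all add: z_def Z_def)
  have zZ: "z / Z = (a - b) / (a + b)" using s by (simp add: z_def Z_def)
  have nuB: "Re \<nu> \<le> B" using complex_Re_le_cmod[of \<nu>] B(1) by linarith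
  have e1: "z * Z / (4 * (pi * real (Suc n))) = pi * ((a\<^sup>2 - b\<^sup>2) / 2) / 2"
    unfolding s(2)[symmetric] z_def Z_def using s(1) by (simp add: power2_eq_square divide_simps) (simp add: algebra_simps)
  have e2: "(z\<^sup>2 + Z\<^sup>2) / (4 * (pi * real (Suc n))) = pi * ((a\<^sup>2 + b\<^sup>2) / 2)"
    unfolding s(2)[symmetric] z_def Z_def using s(1) by (simp add: power2_eq_square divide_simps) (simp add: algebra_simps)
  have "(\<lambda>j. of_real (z * Z / (4 * (pi * real (Suc n)))) powr (\<nu> + 2 * of_nat j) * (rGamma (\<nu> + of_nat j + 1) / fact j) *
      mint (\<nu> + 2 * of_nat j) (of_real ((z\<^sup>2 + Z\<^sup>2) / (4 * (pi * real (Suc n))))) (of_real (pi * real (Suc n))) / 2)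
    sums (Bessel_I \<nu> (of_real z) * Bessel_K \<nu> (of_real Z))"
    using z nu nuB B(2) r zZ by (intro Bessel_I_Bessel_K_sums) auto
  then have "(\<lambda>j. coef \<nu> ((a\<^sup>2 - b\<^sup>2) / 2) j * mint (\<nu> + 2 * of_nat j) (of_real (pi * ((a\<^sup>2 + b\<^sup>2) / 2))) (of_real (pi * real (Suc n))))
    sums (Bessel_I \<nu> (of_real z) * Bessel_K \<nu> (of_real Z))"
    unfolding e1 e2 coef_def by (simp only: mult.assoc times_divide_eq_left times_divide_eq_right)
  then have "(\<lambda>j. of_nat (sum_squares_reps k (Suc n)) * (coef \<nu> ((a\<^sup>2 - b\<^sup>2) / 2) j * mint (\<nu> + 2 * of_nat j) (of_real (pi * ((a\<^sup>2 + b\<^sup>2) / 2))) (of_real (pi * real (Suc n)))))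
    sums (of_nat (sum_squares_reps k (Suc n)) * (Bessel_I \<nu> (of_real z) * Bessel_K \<nu> (of_real Z)))"
    by (rule sums_mult)
  moreover have "of_real z = of_real (pi * sqrt (real (Suc n))) * (complex_of_real a - of_real b)"
    "of_real Z = of_real (pi * sqrt (real (Suc n))) * (complex_of_real a + of_real b)"
    by (simp_all add: z_def Z_def s_def)
  ultimately show ?thesis unfolding lterm_def by (simp only: mult.assoc)
qed

lemma double_series_dominated:
  fixes f :: "nat \<Rightarrow> nat \<Rightarrow> complex"
  assumes "summable u" "\<And>n. u n \<ge> 0" "summable w" "\<And>n. w n \<ge> 0" and "\<And>n j. norm (f n j) \<le> u n * w j"
  shows "\<exists>S. (\<lambda>n. \<Sum>j. f n j) sums S \<and> (\<lambda>j. \<Sum>n. f n j) sums S"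
proof -
  have "(\<lambda>p. norm (f (fst p) (snd p))) summable_on UNIV"
    by (rule summable_on_comparison_test[OF product_pairs_summable[OF assms(1-4)]]) (use assms(5) in auto)
  from double_series(1,2)[OF this] show ?thesis by blast
qed

text \<open>
  Both series over \<open>n\<close> become double series over \<open>n\<close> and \<open>j\<close>. In the order \<open>n\<close> first, \<open>theta_bessel_sums\<close>
  for \<open>s = \<nu> + 2 * j\<close> relates them for each \<open>j\<close>, up to a term whose sum over \<open>j\<close> is
  \<open>q powr \<nu> / (2 * \<nu>)\<close>.
\<close>

theorem bessel_sum_identity_real:
  assumes k: "k \<ge> 2" and b: "b > 0" and ab: "b < a" and nu: "Re \<nu> > 0"
    and B: "norm \<nu> + real k \<le> B" "1 \<le> B" and r: "16 * B\<^sup>2 * ((a - b) / (a + b))\<^sup>2 < 1"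
  shows "\<exists>S. (\<lambda>n. rconst k \<nu> * rterm k \<nu> n (of_real a) (of_real b)) sums S \<and>
     (\<lambda>n. lterm k \<nu> (Suc n) (of_real a) (of_real b)) sums (S - of_real ((a - b) / (a + b)) powr \<nu> / (2 * \<nu>))"
proof -
  define p where "p = (a\<^sup>2 + b\<^sup>2) / 2"
  define c where "c = (a\<^sup>2 - b\<^sup>2) / 2"
  define q where "q = (a - b) / (a + b)"
  define C where "C = coef \<nu> c"
  have nu0: "\<nu> \<noteq> 0" using nu by auto
  have ab0: "a > 0" "a + b > 0" using b ab by auto
  have q0: "q > 0" using b ab by (simp add: q_def)
  have p0: "p > 0" using ab0 b by (simp add: p_def add_pos_pos)
  have "b\<^sup>2 < a\<^sup>2" using b ab by (simp add: power_strict_mono)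
  then have c0: "c > 0" by (simp add: c_def)
  have q1: "1 + q\<^sup>2 > 0" by (simp add: add_pos_nonneg)
  have cq: "c = 2 * q * p / (1 + q\<^sup>2)"
  proof -
    have "(1 + q\<^sup>2) * (a + b)\<^sup>2 = 4 * p"
      using ab0 by (simp add: q_def p_def power_divide distrib_right) (simp add: power2_eq_square algebra_simps)
    moreover have "q * (a + b)\<^sup>2 = 2 * c"
      using ab0 by (simp add: q_def c_def power2_eq_square) (simp add: algebra_simps)
    ultimately have "c * (1 + q\<^sup>2) * (a + b)\<^sup>2 = 2 * q * p * (a + b)\<^sup>2" by algebra
    then have "c * (1 + q\<^sup>2) = 2 * q * p" using ab0 by simp
    then show ?thesis using q1 by (simp add: eq_divide_eq)
  qed
  have cp: "16 * B\<^sup>2 * (c / (2 * p))\<^sup>2 < 1"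
  proof -
    have "c / (2 * p) = q / (1 + q\<^sup>2)" using p0 by (simp add: cq)
    also have "\<dots> \<le> q" using q0 q1 by (simp add: divide_le_eq)
    finally have "(c / (2 * p))\<^sup>2 \<le> q\<^sup>2" using c0 p0 by (intro power_mono) auto
    then have "16 * B\<^sup>2 * (c / (2 * p))\<^sup>2 \<le> 16 * B\<^sup>2 * q\<^sup>2" by (intro mult_left_mono) auto
    then show ?thesis using r by (simp add: q_def)
  qed
  let ?r = "\<lambda>n. of_nat (sum_squares_reps k n) :: complex" and ?rr = "\<lambda>n. real (sum_squares_reps k n)"
  let ?s = "\<lambda>j. \<nu> + 2 * of_nat j"
  let ?f = "\<lambda>n j. ?r (Suc n) * (C j * mint (?s j) (of_real (pi * p)) (of_real (pi * real (Suc n))))"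
  let ?G = "\<lambda>n j. Gamma (?s j + of_nat k / 2) * of_real (pi * (real n + p)) powr (- (?s j + of_nat k / 2))"
  let ?g = "\<lambda>n j. ?r n * (C j * ?G n j)"
  have "\<exists>S. (\<lambda>n. \<Sum>j. ?f n j) sums S \<and> (\<lambda>j. \<Sum>n. ?f n j) sums S"
  proof (rule double_series_dominated)
    let ?u = "\<lambda>n. fact k * (?rr (Suc n) / (pi * real (Suc n)) ^ k)"
    \<comment> \<open>The bound \<open>rint_le_power\<close> raises the order by \<open>k\<close>, whence the shift by \<open>k\<close> in place of \<open>k / 2\<close>.\<close>
    let ?m = "complex_of_real (Re \<nu> + real k)"
    let ?w = "\<lambda>j. (pi * p) powr (- (Re \<nu> + real k)) * (norm (C j * Gamma (?m + 2 * of_nat j)) * (1 / (pi * p)\<^sup>2) ^ j)"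
    show "summable ?u" using k by (intro summable_mult summable_reps_inverse_power) simp
    show "summable ?w"
      unfolding C_def
    proof (intro summable_mult coef_gamma_summable[OF c0 p0 nu _ _ B(2) cp])
      show "norm ?m \<le> B" using B(1) nu complex_Re_le_cmod[of \<nu>] by (simp only: norm_of_real)
    qed (use nu in simp)
    show "?u n \<ge> 0" for n by simp
    show "?w j \<ge> 0" for j by simp
    fix n j
    define y where "y = pi * real (Suc n)"
    have y: "y > 0" by (simp add: y_def)
    have "norm (mint (?s j) (of_real (pi * p)) (of_real y)) \<le> rint (Re \<nu> + 2 * real j) (pi * p) y"
      using norm_mint_le[of "of_real (pi * p)" "of_real y" "?s j"] p0 y by simp
    also have "\<dots> \<le> fact k / y ^ k * rint (Re \<nu> + 2 * real j + real k) (pi * p) 0"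
      using p0 y nu by (intro rint_le_power) auto
    also have "rint (Re \<nu> + 2 * real j + real k) (pi * p) 0 = Gamma (Re \<nu> + 2 * real j + real k) * (pi * p) powr (- (Re \<nu> + 2 * real j + real k))"
      using nu p0 by (intro rint_gamma) auto
    also have "Gamma (Re \<nu> + 2 * real j + real k) = norm (Gamma (?m + 2 * of_nat j))"
    proof -
      have "?m + 2 * of_nat j = complex_of_real (Re \<nu> + 2 * real j + real k)" by simp
      moreover have "Gamma (Re \<nu> + 2 * real j + real k) > 0" using nu by (intro Gamma_real_pos) simp
      ultimately show ?thesis by (simp only: Gamma_complex_of_real norm_of_real)
    qed
    also have "(pi * p) powr (- (Re \<nu> + 2 * real j + real k)) = (pi * p) powr (- (Re \<nu> + real k)) * (1 / (pi * p)\<^sup>2) ^ j"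
    proof -
      have pp: "pi * p > 0" using p0 by simp
      have e: "- (Re \<nu> + 2 * real j + real k) = - (Re \<nu> + real k) - real (2 * j)" by simp
      show ?thesis unfolding e powr_diff powr_realpow[OF pp] by (simp add: power_mult power_divide)
    qed
    finally have m: "norm (mint (?s j) (of_real (pi * p)) (of_real y)) \<le> fact k / y ^ k * (norm (Gamma (?m + 2 * of_nat j)) * ((pi * p) powr (- (Re \<nu> + real k)) * (1 / (pi * p)\<^sup>2) ^ j))" .
    have "norm (?f n j) = ?rr (Suc n) * norm (C j) * norm (mint (?s j) (of_real (pi * p)) (of_real y))"
      by (simp add: norm_mult y_def)
    also have "\<dots> \<le> ?rr (Suc n) * norm (C j) * (fact k / y ^ k * (norm (Gamma (?m + 2 * of_nat j)) * ((pi * p) powr (- (Re \<nu> + real k)) * (1 / (pi * p)\<^sup>2) ^ j)))"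
      by (intro mult_left_mono m) auto
    also have "\<dots> = ?u n * ?w j" unfolding y_def norm_mult by (simp add: mult_ac)
    finally show "norm (?f n j) \<le> ?u n * ?w j" .
  qed
  then obtain S where S: "(\<lambda>n. \<Sum>j. ?f n j) sums S" "(\<lambda>j. \<Sum>n. ?f n j) sums S" by blast
  have "\<exists>T. (\<lambda>n. \<Sum>j. ?g n j) sums T \<and> (\<lambda>j. \<Sum>n. ?g n j) sums T"
  proof (rule double_series_dominated)
    let ?u = "\<lambda>n. ?rr n * (pi * (real n + p)) powr (- (real k / 2 + Re \<nu>))"
    let ?w = "\<lambda>j. norm (C j * Gamma (\<nu> + of_nat k / 2 + 2 * of_nat j)) * (1 / (pi * p)\<^sup>2) ^ j"
    show "summable ?u" by (rule summable_reps_shift_powr[OF nu p0])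
    show "summable ?w"
      unfolding C_def
    proof (rule coef_gamma_summable[OF c0 p0 nu _ _ B(2) cp])
      show "norm (\<nu> + of_nat k / 2) \<le> B" using B(1) norm_triangle_ineq[of \<nu> "of_nat k / 2"] by (simp add: norm_divide)
    qed (use nu in \<open>simp add: add_pos_nonneg\<close>)
    show "?u n \<ge> 0" for n by simp
    show "?w j \<ge> 0" for j by simp
    fix n j
    define x where "x = pi * (real n + p)"
    have x: "x > 0" "pi * p > 0" "pi * p \<le> x" using p0 by (auto simp: x_def add_nonneg_pos)
    have "norm (complex_of_real x powr (- (?s j + of_nat k / 2))) = x powr (- (real k / 2 + Re \<nu>) - real (2 * j))"
    proof -
      have e: "Re (- (?s j + of_nat k / 2)) = - (real k / 2 + Re \<nu>) - real (2 * j)" by simp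
      show ?thesis unfolding norm_powr_of_real[OF x(1)] e ..
    qed
    also have "\<dots> = x powr (- (real k / 2 + Re \<nu>)) * (1 / x ^ (2 * j))"
      unfolding powr_diff powr_realpow[OF x(1)] by simp
    also have "\<dots> \<le> x powr (- (real k / 2 + Re \<nu>)) * (1 / (pi * p) ^ (2 * j))"
      by (intro mult_left_mono frac_le[OF zero_le_one order_refl zero_less_power[OF x(2)] power_mono[OF x(3) less_imp_le[OF x(2)]]] powr_ge_zero)
    finally have m: "norm (complex_of_real x powr (- (?s j + of_nat k / 2))) \<le> x powr (- (real k / 2 + Re \<nu>)) * (1 / (pi * p)\<^sup>2) ^ j"
      by (simp add: power_mult power_divide)
    have "norm (?g n j) = ?rr n * norm (C j * Gamma (\<nu> + of_nat k / 2 + 2 * of_nat j)) * norm (complex_of_real x powr (- (?s j + of_nat k / 2)))"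
      unfolding x_def[symmetric] norm_mult by (simp add: add_ac)
    also have "\<dots> \<le> ?rr n * norm (C j * Gamma (\<nu> + of_nat k / 2 + 2 * of_nat j)) * (x powr (- (real k / 2 + Re \<nu>)) * (1 / (pi * p)\<^sup>2) ^ j)"
      by (intro mult_left_mono m) auto
    also have "\<dots> = ?u n * ?w j" unfolding x_def by (simp add: mult_ac)
    finally show "norm (?g n j) \<le> ?u n * ?w j" .
  qed
  then obtain T where T: "(\<lambda>n. \<Sum>j. ?g n j) sums T" "(\<lambda>j. \<Sum>n. ?g n j) sums T" by blast
  have gn: "(\<Sum>j. ?g n j) = rconst k \<nu> * rterm k \<nu> n (of_real a) (of_real b)" for n
    using rterm_real[OF k b ab nu B r, of n] unfolding C_def c_def p_def by (rule sums_unique[symmetric])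
  have fn: "(\<Sum>j. ?f n j) = lterm k \<nu> (Suc n) (of_real a) (of_real b)" for n
    using lterm_real[OF b ab nu B r, of n] unfolding C_def c_def p_def by (rule sums_unique[symmetric])
  \<comment> \<open>The case of exponent 0, in which the hypergeometric series reduces to 1.\<close>
  have "(\<lambda>j. C j * (Gamma (?s j + of_real 0) * of_real (pi * p) powr (- (?s j + of_real 0)))) sums
     (of_real ((pi * p / (1 + q\<^sup>2)) powr (- 0)) / 2 * (Gamma (\<nu> + of_real 0) / Gamma (\<nu> + 1)) * of_real q powr \<nu> *
       hyp2f1_series (\<nu> + of_real 0) (of_real 0) (\<nu> + 1) (of_real (q\<^sup>2)))"
    unfolding C_def using B r by (intro coef_gamma_sums[OF p0 q0 cq nu _ _ B(2)]) (auto simp: q_def)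
  moreover have "p \<noteq> 0" "1 + q\<^sup>2 \<noteq> 0" using p0 q1 by simp_all
  moreover have "Gamma (\<nu> + 1) = \<nu> * Gamma \<nu>" "Gamma \<nu> \<noteq> 0"
    using Re_pos_not_nonpos_Int[OF nu] nu0 by (auto intro: Gamma_plus1 simp: Gamma_eq_zero_iff)
  ultimately have third: "(\<lambda>j. C j * (Gamma (?s j) * of_real (pi * p) powr (- ?s j))) sums (of_real q powr \<nu> / (2 * \<nu>))"
    by (simp add: hyp2f1_series_zero)
  have col: "(\<Sum>n. ?f n j) = (\<Sum>n. ?g n j) - C j * (Gamma (?s j) * of_real (pi * p) powr (- ?s j))" for j
  proof -
    have sj: "Re (?s j) > 0" using nu by simp
    have k0: "k > 0" using k by simp
    have gs: "summable (\<lambda>n. ?r n * ?G n j)"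
    proof (rule summable_norm_cancel, rule summable_comparison_test)
      show "summable (\<lambda>n. norm (Gamma (?s j + of_nat k / 2)) * (?rr n * (pi * (real n + p)) powr (- (real k / 2 + Re (?s j)))))"
        by (intro summable_mult summable_reps_shift_powr sj p0)
      have "norm (?r n * ?G n j) = norm (Gamma (?s j + of_nat k / 2)) * (?rr n * (pi * (real n + p)) powr (- (real k / 2 + Re (?s j))))" for n
      proof -
        have x: "pi * (real n + p) > 0" using p0 by (simp add: add_nonneg_pos)
        have e: "Re (- (?s j + of_nat k / 2)) = - (real k / 2 + Re (?s j))" by simp
        show ?thesis unfolding norm_mult norm_powr_of_real[OF x] e norm_of_nat by (rule mult.left_commute)
      qed
      then show "\<exists>N. \<forall>n\<ge>N. norm (norm (?r n * ?G n j)) \<le> norm (Gamma (?s j + of_nat k / 2)) * (?rr n * (pi * (real n + p)) powr (- (real k / 2 + Re (?s j))))"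
        by simp
    qed
    have "(\<lambda>n. C j * (?r (Suc n) * mint (?s j) (of_real (pi * p)) (of_real (pi * real (Suc n))))) sums
      (C j * ((\<Sum>n. ?r n * ?G n j) - Gamma (?s j) * of_real (pi * p) powr (- ?s j)))"
      by (intro sums_mult theta_bessel_sums[OF k0 p0 sj])
    then have "(\<Sum>n. ?f n j) = C j * ((\<Sum>n. ?r n * ?G n j) - Gamma (?s j) * of_real (pi * p) powr (- ?s j))"
      by (simp only: mult.left_commute sums_iff)
    moreover have "(\<Sum>n. ?g n j) = C j * (\<Sum>n. ?r n * ?G n j)"
      using suminf_mult[OF gs, of "C j"] by (simp only: mult.left_commute)
    ultimately show ?thesis by (simp only: right_diff_distrib)
  qed
  have "(\<lambda>j. \<Sum>n. ?f n j) sums (T - of_real q powr \<nu> / (2 * \<nu>))"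
    unfolding col by (intro sums_diff T(2) third)
  then have "S = T - of_real q powr \<nu> / (2 * \<nu>)" using S(2) sums_unique2 by blast
  then show ?thesis using S(1) T(1) unfolding gn fn q_def by blast
qed

section \<open>Regularity of the terms in the parameters\<close>

lemma shroot_cut:
  assumes "Re a > 0"
  shows "of_nat n + a\<^sup>2 \<notin> \<real>\<^sub>\<le>\<^sub>0"
proof
  assume "of_nat n + a\<^sup>2 \<in> \<real>\<^sub>\<le>\<^sub>0"
  then have "Im (a\<^sup>2) = 0" "real n + Re (a\<^sup>2) \<le> 0" by (auto simp: complex_nonpos_Reals_iff)
  then have "Re a * Im a = 0" and re: "(Re a)\<^sup>2 - (Im a)\<^sup>2 \<le> 0" by (auto simp: power2_eq_square)
  then have "Im a = 0" using assms by simp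
  then show False using assms re by simp
qed

lemma shroot_sq: "shroot a n ^ 2 = of_nat n + a\<^sup>2"
  by (simp add: shroot_def)

lemma Re_shroot_pos:
  assumes "Re a > 0" shows "Re (shroot a n) > 0"
proof -
  have "Re (csqrt z) > 0" if "z \<notin> \<real>\<^sub>\<le>\<^sub>0" for z
  proof (rule ccontr)
    assume "\<not> Re (csqrt z) > 0"
    then have "Re (csqrt z) = 0" using csqrt_principal[of z] by linarith
    then have "csqrt z = \<i> * of_real (Im (csqrt z))" by (intro complex_eqI) (simp_all only: Re_i_times Im_i_times Re_complex_of_real Im_complex_of_real minus_zero)
    then have "(csqrt z)\<^sup>2 = (\<i> * of_real (Im (csqrt z)))\<^sup>2" by (rule arg_cong)
    then have "z = of_real (- (Im (csqrt z))\<^sup>2)" unfolding power2_csqrt power_mult_distrib by (simp del: csqrt.simps)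
    moreover have "of_real (- (Im (csqrt z))\<^sup>2) \<in> (\<real>\<^sub>\<le>\<^sub>0 :: complex set)"
      unfolding nonpos_Reals_of_real_iff by simp
    ultimately show False using that by simp
  qed
  then show ?thesis using shroot_cut[OF assms] unfolding shroot_def by blast
qed

lemma shroot_0: "Re a > 0 \<Longrightarrow> shroot a 0 = a"
  by (simp add: shroot_def csqrt_square)

text \<open>
  A real ratio \<open>t = (A - D) / (A + D)\<close> means that \<open>A\<close> is a real multiple of \<open>D\<close>, and the multiple is
  positive because both roots have positive real part.
\<close>

lemma qratio_real_cases:
  assumes a: "Re a > 0" and b: "Re b > 0" and q: "qratio a b n = of_real t"
  shows "- 1 < t" "t < 1" "shroot a n = of_real ((1 + t) / (1 - t)) * shroot b n"
proof -
  let ?A = "shroot a n" and ?D = "shroot b n"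
  have A: "Re ?A > 0" "Re ?D > 0" using a b by (auto intro: Re_shroot_pos)
  then have "?A + ?D \<noteq> 0" by (auto simp: complex_eq_iff)
  then have "?A - ?D = of_real t * (?A + ?D)" using q by (simp add: qratio_def field_simps)
  then have e: "of_real (1 - t) * ?A = of_real (1 + t) * ?D" by (simp add: algebra_simps)
  then have "(1 - t) * Re ?A = (1 + t) * Re ?D" using arg_cong[OF e, of Re] unfolding times_complex.simps(1) Re_complex_of_real Im_complex_of_real by simp
  then have "(1 - t) * Re ?A + (1 - t) * Re ?D = 2 * Re ?D" "(1 + t) * Re ?A + (1 + t) * Re ?D = 2 * Re ?A"
    by (simp_all add: algebra_simps)
  then have "(1 - t) * (Re ?A + Re ?D) > 0" "(1 + t) * (Re ?A + Re ?D) > 0"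
    using A by (simp_all add: distrib_left)
  then show t: "- 1 < t" "t < 1" using A by (auto simp: zero_less_mult_iff)
  then have "of_real (1 - t) \<noteq> (0 :: complex)" by (simp only: of_real_eq_0_iff)
  then have "?A = of_real (1 + t) / of_real (1 - t) * ?D" using e by (simp add: field_simps)
  then show "?A = of_real ((1 + t) / (1 - t)) * ?D" by simp
qed

lemma qratio_eq_0_iff:
  assumes a: "Re a > 0" and b: "Re b > 0"
  shows "qratio a b n = 0 \<longleftrightarrow> a = b"
proof
  assume "qratio a b n = 0"
  then have "shroot a n = shroot b n" using qratio_real_cases(3)[OF a b, of n 0] by simp
  then have "a\<^sup>2 = b\<^sup>2" using shroot_sq[of a n] shroot_sq[of b n] by simp
  then have "a = b \<or> a = - b" by (simp add: power2_eq_iff)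
  then show "a = b" using a b by auto
qed (simp add: qratio_def)

text \<open>
  A negative ratio means \<open>n + a\<^sup>2 = r\<^sup>2 * (n + b\<^sup>2)\<close> with \<open>0 < r < 1\<close>. Comparison of the imaginary parts gives
  \<open>\<bar>Im a\<bar> \<le> r\<^sup>2 * \<bar>Im b\<bar>\<close> as \<open>Re a \<ge> Re b\<close>, and then the real parts force \<open>Re a < Re b\<close>.
\<close>

lemma qratio_nonneg_if_real:
  assumes b: "Re b > 0" and ab: "Re a \<ge> Re b" and q: "qratio a b n = of_real t"
  shows "t \<ge> 0"
proof (rule ccontr)
  assume t: "\<not> t \<ge> 0"
  have a: "Re a > 0" using ab b by simp
  note c = qratio_real_cases[OF a b q]
  define r where "r = (1 + t) / (1 - t)"
  have r: "0 < r" "r < 1" using c t by (simp_all add: r_def field_simps)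
  have "of_nat n + a\<^sup>2 = (of_real r * shroot b n)\<^sup>2" using c(3) shroot_sq[of a n] by (simp add: r_def)
  also have "\<dots> = of_real (r\<^sup>2) * (of_nat n + b\<^sup>2)" by (simp add: power_mult_distrib shroot_sq)
  finally have e: "of_nat n + a\<^sup>2 = of_real (r\<^sup>2) * (of_nat n + b\<^sup>2)" .
  obtain X Y x y where ab_eq: "a = Complex X Y" "b = Complex x y" by (cases a; cases b) auto
  have re: "real n + X\<^sup>2 - Y\<^sup>2 = r\<^sup>2 * (real n + x\<^sup>2 - y\<^sup>2)" and im: "X * Y = r\<^sup>2 * (x * y)"
    using arg_cong[OF e, of Re] arg_cong[OF e, of Im] by (simp_all add: ab_eq power2_eq_square algebra_simps)
  have X: "X \<ge> x" "x > 0" using ab b by (simp_all add: ab_eq)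
  have r2: "r\<^sup>2 < 1" "r\<^sup>2 > 0" using r by (simp_all add: abs_square_less_1)
  have "\<bar>Y\<bar> \<le> r\<^sup>2 * \<bar>y\<bar>"
  proof -
    have "X * \<bar>Y\<bar> = x * (r\<^sup>2 * \<bar>y\<bar>)" using arg_cong[OF im, of abs] X r2 by (simp add: abs_mult)
    also have "\<dots> \<le> X * (r\<^sup>2 * \<bar>y\<bar>)" using X by (intro mult_right_mono) auto
    finally show ?thesis using X by simp
  qed
  then have "Y\<^sup>2 \<le> (r\<^sup>2 * \<bar>y\<bar>)\<^sup>2" using abs_le_square_iff[of Y "r\<^sup>2 * \<bar>y\<bar>"] by (simp add: abs_mult)
  also have "(r\<^sup>2 * \<bar>y\<bar>)\<^sup>2 = r\<^sup>2 * (r\<^sup>2 * y\<^sup>2)" by (simp add: power_mult_distrib power2_eq_square)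
  also have "\<dots> \<le> r\<^sup>2 * y\<^sup>2" using r2 by (intro mult_left_mono mult_left_le_one_le) auto
  finally have Y: "Y\<^sup>2 \<le> r\<^sup>2 * y\<^sup>2" .
  have "real n * r\<^sup>2 \<le> real n" using r2 by (simp add: mult_left_le)
  then have "X\<^sup>2 \<le> r\<^sup>2 * x\<^sup>2" using re Y by (simp add: algebra_simps)
  also have "\<dots> < x\<^sup>2" using r2 X by simp
  also have "\<dots> \<le> X\<^sup>2" using X by (intro power_mono) auto
  finally show False by simp
qed

lemma qratio_cut:
  assumes "Re b > 0" "Re a \<ge> Re b" "a \<noteq> b"
  shows "qratio a b n \<notin> \<real>\<^sub>\<le>\<^sub>0"
proof
  assume "qratio a b n \<in> \<real>\<^sub>\<le>\<^sub>0"
  then obtain t where t: "t \<le> 0" "qratio a b n = of_real t" by (auto elim!: nonpos_Reals_cases)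
  then have "t = 0" using qratio_nonneg_if_real[OF assms(1,2) t(2)] by simp
  then show False using t(2) qratio_eq_0_iff[of a b n] assms by simp
qed

lemma qratio_sq_cut:
  assumes a: "Re a > 0" and b: "Re b > 0"
  shows "qratio a b n ^ 2 \<notin> of_real ` {1..}"
proof
  assume "qratio a b n ^ 2 \<in> of_real ` {1..}"
  then obtain s where s: "s \<ge> 1" "qratio a b n ^ 2 = of_real s" by auto
  then have "qratio a b n ^ 2 = of_real (sqrt s) ^ 2" by (simp flip: of_real_power)
  then have "qratio a b n = of_real (sqrt s) \<or> qratio a b n = of_real (- sqrt s)" by (simp add: power2_eq_iff)
  moreover have "sqrt s \<ge> 1" using s by simp
  ultimately show False using qratio_real_cases(1,2)[OF a b] by fastforce
qed

text \<open>
  The lemma is applied on open sets for the continuation, and on a half-line that ends on the boundary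
  \<open>Re a = Re b\<close>, where differentiability within \<open>U\<close> gives continuity up to the end point.
\<close>

lemma lterm_holomorphic:
  assumes U: "f holomorphic_on U" "g holomorphic_on U"
    and "\<And>w. w \<in> U \<Longrightarrow> Re (f w) \<ge> Re (g w) \<and> Re (g w) > 0 \<and> f w \<noteq> g w"
  shows "(\<lambda>w. lterm k \<nu> (Suc n) (f w) (g w)) holomorphic_on U"
proof -
  define c where "c = pi * sqrt (real (Suc n))"
  have c: "c > 0" by (simp add: c_def)
  have I: "(Bessel_I \<nu> \<circ> (\<lambda>w. of_real c * (f w - g w))) holomorphic_on U"
  proof (rule holomorphic_on_compose_gen[OF _ Bessel_I_holomorphic])
    show "(\<lambda>w. of_real c * (f w - g w)) ` U \<subseteq> - \<real>\<^sub>\<le>\<^sub>0"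
    proof safe
      fix w assume w: "w \<in> U" "of_real c * (f w - g w) \<in> \<real>\<^sub>\<le>\<^sub>0"
      then have "c * (Re (f w) - Re (g w)) \<le> 0" "c * (Im (f w) - Im (g w)) = 0" by (auto simp: complex_nonpos_Reals_iff)
      then have "Re (f w) = Re (g w)" "Im (f w) = Im (g w)" using c assms(3)[OF w(1)] by (auto simp: mult_le_0_iff)
      then show False using assms(3)[OF w(1)] by (simp add: complex_eq_iff)
    qed
  qed (intro holomorphic_intros U)
  have K: "(Bessel_K \<nu> \<circ> (\<lambda>w. of_real c * (f w + g w))) holomorphic_on U"
  proof (rule holomorphic_on_compose_gen[of _ _ _ "{z. Re z > 0}"])
    have "(\<lambda>z. mint \<nu> (z / 2) (z / 2) / 2) holomorphic_on {z. Re z > 0}"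
      using mint_holomorphic_args[of \<nu> "1/2" "1/2"] by (intro holomorphic_intros) auto
    then show "Bessel_K \<nu> holomorphic_on {z. Re z > 0}"
      by (rule holomorphic_transform) (simp add: Bessel_K_eq_mint)
    show "(\<lambda>w. of_real c * (f w + g w)) ` U \<subseteq> {z. Re z > 0}"
      using c assms(3) by (auto intro!: mult_pos_pos add_pos_pos) (meson less_le_trans)
  qed (intro holomorphic_intros U)
  show ?thesis
    unfolding lterm_def c_def[symmetric] using I K by (intro holomorphic_intros) (simp_all add: o_def)
qed

lemma rterm_holomorphic:
  assumes U: "f holomorphic_on U" "g holomorphic_on U" and nu: "Re \<nu> > 0" and k: "k > 0"
    and fg: "\<And>w. w \<in> U \<Longrightarrow> Re (f w) \<ge> Re (g w) \<and> Re (g w) > 0 \<and> f w \<noteq> g w"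
  shows "(\<lambda>w. rterm k \<nu> n (f w) (g w)) holomorphic_on U" "(\<lambda>w. qratio (f w) (g w) n powr \<nu>) holomorphic_on U"
proof -
  have fg': "Re (f w) > 0" "Re (g w) > 0" if "w \<in> U" for w using fg[OF that] by auto
  have A: "(\<lambda>w. shroot (f w) n) holomorphic_on U" "(\<lambda>w. shroot (g w) n) holomorphic_on U"
    unfolding shroot_def by (intro holomorphic_intros U shroot_cut fg'; assumption)+
  have nz: "shroot (f w) n \<noteq> 0" "shroot (g w) n \<noteq> 0" "shroot (f w) n + shroot (g w) n \<noteq> 0" if "w \<in> U" for w
    using Re_shroot_pos[OF fg'(1)[OF that], of n] Re_shroot_pos[OF fg'(2)[OF that], of n] by (auto simp: complex_eq_iff)
  have Q: "(\<lambda>w. qratio (f w) (g w) n) holomorphic_on U"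
    unfolding qratio_def by (intro holomorphic_intros A nz)
  show P: "(\<lambda>w. qratio (f w) (g w) n powr \<nu>) holomorphic_on U"
    using fg by (intro holomorphic_intros Q qratio_cut) auto
  have H: "(hyp2f1 (\<nu> + 1 - of_nat k / 2) (1 - of_nat k / 2) (\<nu> + 1) \<circ> (\<lambda>w. qratio (f w) (g w) n ^ 2)) holomorphic_on U"
  proof (rule holomorphic_on_compose_gen[OF _ hyp2f1_holomorphic])
    show "(\<lambda>w. qratio (f w) (g w) n ^ 2) ` U \<subseteq> - of_real ` {1..}" using qratio_sq_cut[OF fg'] by auto
  qed (use nu k in \<open>auto intro!: holomorphic_intros Q\<close>)
  show "(\<lambda>w. rterm k \<nu> n (f w) (g w)) holomorphic_on U"
    unfolding rterm_def using H by (intro holomorphic_intros A P nz) (auto simp: o_def nz)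
qed

section \<open>Majorants of the two series\<close>

lemma norm_powr_le: "norm (z powr s) \<le> norm z powr Re s * exp (pi * \<bar>Im s\<bar>)"
proof (cases "z = 0")
  case False
  have "\<bar>Im s * Im (Ln z)\<bar> \<le> \<bar>Im s\<bar> * pi"
    unfolding abs_mult using Im_Ln_le_pi[OF False] mpi_less_Im_Ln[OF False] by (intro mult_left_mono) auto
  then have "- (Im s * Im (Ln z)) \<le> pi * \<bar>Im s\<bar>" by (simp add: mult.commute)
  then have "exp (Re s * ln (norm z) - Im s * Im (Ln z)) \<le> exp (Re s * ln (norm z) + pi * \<bar>Im s\<bar>)" by simp
  then show ?thesis using False by (simp add: powr_def exp_add[symmetric])
qed simp

text \<open>
  Since \<open>v + 1 / v \<ge> 2\<close>, increasing the common argument by \<open>x - x0\<close> divides the integrand by at least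
  \<open>exp (2 * (x - x0))\<close>.
\<close>

lemma rint_decay:
  assumes "x0 > 0" "x0 \<le> x"
  shows "rint s x x \<le> exp (2 * x0 - 2 * x) * rint s x0 x0"
proof -
  have "rker s x x v \<le> exp (2 * x0 - 2 * x) * rker s x0 x0 v" for v
  proof (cases "v > 0")
    case True
    have "2 \<le> v + 1 / v" using True sum_squares_ge_zero[of "v - 1" 0] by (simp add: field_simps power2_eq_square)
    then have "(x - x0) * 2 \<le> (x - x0) * (v + 1 / v)" using assms by (intro mult_left_mono) auto
    then have "(s - 1) * ln v - x * v - x / v \<le> (2 * x0 - 2 * x) + ((s - 1) * ln v - x0 * v - x0 / v)"
      by (simp add: algebra_simps diff_divide_distrib)
    then have "exp ((s - 1) * ln v - x * v - x / v) \<le> exp (2 * x0 - 2 * x) * exp ((s - 1) * ln v - x0 * v - x0 / v)"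
      unfolding exp_add[symmetric] by simp
    then show ?thesis using True by (simp add: rker_def)
  qed (simp add: rker_def)
  then have "rint s x x \<le> (LINT v|lborel. exp (2 * x0 - 2 * x) * rker s x0 x0 v)"
    unfolding rint_def using assms by (intro integral_mono rker_integrable Bochner_Integration.integrable_mult_right) auto
  then show ?thesis by (simp add: rint_def)
qed

lemma summable_reps_exp:
  assumes d: "d > 0"
  shows "summable (\<lambda>n. real (sum_squares_reps k n) * (sqrt (real n) powr s * exp (- (d * sqrt (real n)))))"
proof (rule summable_comparison_test_ev)
  have "((\<lambda>x::real. sqrt x powr s * exp (- (d * sqrt x)) * (1 + x) powr (real k / 2 + 1)) \<longlongrightarrow> 0) at_top"
    using d by real_asymp
  then have "eventually (\<lambda>x::real. sqrt x powr s * exp (- (d * sqrt x)) * (1 + x) powr (real k / 2 + 1) < 1) at_top"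
    by (rule order_tendstoD) simp
  then have "eventually (\<lambda>n. sqrt (real n) powr s * exp (- (d * sqrt (real n))) * (1 + real n) powr (real k / 2 + 1) < 1) sequentially"
    by (rule eventually_compose_filterlim[OF _ filterlim_real_sequentially])
  then show "eventually (\<lambda>n. norm (real (sum_squares_reps k n) * (sqrt (real n) powr s * exp (- (d * sqrt (real n)))))
       \<le> real (sum_squares_reps k n) * (1 + real n) powr (- (real k / 2 + 1))) sequentially"
  proof eventually_elim
    case (elim n)
    have "sqrt (real n) powr s * exp (- (d * sqrt (real n))) \<le> 1 / (1 + real n) powr (real k / 2 + 1)"
      using elim by (simp add: less_imp_le pos_le_divide_eq)
    then have "sqrt (real n) powr s * exp (- (d * sqrt (real n))) \<le> (1 + real n) powr (- (real k / 2 + 1))"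
      by (simp only: powr_minus_divide)
    then show ?case by (simp add: abs_mult mult_left_mono)
  qed
qed (rule summable_reps_powr, simp)

text \<open>
  With \<open>z\<close> and \<open>Z\<close> the arguments of the two Bessel functions, the product is of order
  \<open>exp (Re z - Re Z)\<close> up to powers, and \<open>Re z - Re Z = - 2 * \<pi> * sqrt n * Re b\<close>.
\<close>

lemma lterm_bound:
  assumes R: "R > 0" and d: "d > 0" and nu: "Re \<nu> > 0"
  shows "\<exists>g. summable g \<and> (\<forall>n a b. norm a \<le> R \<longrightarrow> norm b \<le> R \<longrightarrow> d \<le> Re b \<longrightarrow> Re b \<le> Re a \<longrightarrow>
     norm (lterm k \<nu> (Suc n) a b) \<le> g n)"
proof -
  have "Re \<nu> > - 1 / 2" using nu by simp
  then obtain C where C: "C > 0" "\<And>z. norm (bseries \<nu> ((z / 2)\<^sup>2)) \<le> C * exp \<bar>Re z\<bar>" using bseries_bound by auto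
  define E where "E = exp (pi * \<bar>Im \<nu>\<bar>)"
  define M where "M = (pi * R) powr Re \<nu> * E * C * rint (Re \<nu>) d d * exp (2 * d)"
  define h where "h = (\<lambda>n. real (sum_squares_reps k n) * (sqrt (real n) powr Re \<nu> * exp (- ((2 * pi * d) * sqrt (real n)))))"
  have "norm (lterm k \<nu> (Suc n) a b) \<le> M * h (Suc n)"
    if ab: "norm a \<le> R" "norm b \<le> R" "d \<le> Re b" "Re b \<le> Re a" for n a b
  proof -
    define q where "q = sqrt (real (Suc n))"
    define c where "c = pi * q"
    define z where "z = of_real c * (a - b)"
    define Z where "Z = of_real c * (a + b)"
    define x where "x = Re Z / 2"
    have q: "q \<ge> 1" by (simp add: q_def)
    have c: "c \<ge> 1" "c > 0" using q mult_mono[of 1 pi 1 q] pi_ge_two by (auto simp: c_def)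
    have Rez: "Re z \<ge> 0" using ab c by (simp add: z_def)
    have "d \<le> c * d" using c d by simp
    also have "c * d \<le> x" unfolding x_def Z_def using ab c by (simp add: mult_left_mono)
    finally have x: "d \<le> x" .
    have "norm (a - b) \<le> R + R" using norm_triangle_ineq4[of a b] ab by simp
    then have "c * norm (a - b) \<le> c * (2 * R)" using c by (intro mult_left_mono) auto
    then have nz: "norm (z / 2) \<le> (pi * R) * q" using c q by (simp add: z_def norm_mult c_def mult_ac)
    have "norm ((z / 2) powr \<nu>) \<le> norm (z / 2) powr Re \<nu> * E" unfolding E_def by (rule norm_powr_le)
    also have "\<dots> \<le> ((pi * R) * q) powr Re \<nu> * E"
      using nz nu by (intro mult_right_mono powr_mono2) (auto simp: E_def)
    finally have P: "norm ((z / 2) powr \<nu>) \<le> (pi * R) powr Re \<nu> * q powr Re \<nu> * E" by (simp add: powr_mult)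
    have I: "norm (Bessel_I \<nu> z) \<le> ((pi * R) powr Re \<nu> * q powr Re \<nu> * E) * (C * exp (Re z))"
      unfolding Bessel_I_bseries norm_mult using P C(2)[of z] Rez nu
      by (intro mult_mono) (auto simp: E_def)
    have "norm (mint \<nu> (Z / 2) (Z / 2)) \<le> rint (Re \<nu>) x x"
      using norm_mint_le[of "Z / 2" "Z / 2" \<nu>] x d by (simp add: x_def)
    also have "\<dots> \<le> exp (2 * d - 2 * x) * rint (Re \<nu>) d d" by (rule rint_decay[OF d x])
    finally have "norm (mint \<nu> (Z / 2) (Z / 2)) \<le> exp (2 * d - Re Z) * rint (Re \<nu>) d d" by (simp add: x_def)
    moreover have "norm (Bessel_K \<nu> Z) \<le> norm (mint \<nu> (Z / 2) (Z / 2))"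
    proof -
      have "Bessel_K \<nu> Z = mint \<nu> (Z / 2) (Z / 2) / 2" by (rule Bessel_K_eq_mint) (use x d in \<open>simp add: x_def\<close>)
      then show ?thesis by (simp only: norm_divide norm_numeral) simp
    qed
    ultimately have K: "norm (Bessel_K \<nu> Z) \<le> exp (2 * d - Re Z) * rint (Re \<nu>) d d" by linarith
    have "norm (Bessel_I \<nu> z) * norm (Bessel_K \<nu> Z) \<le>
       (((pi * R) powr Re \<nu> * q powr Re \<nu> * E) * (C * exp (Re z))) * (exp (2 * d - Re Z) * rint (Re \<nu>) d d)"
      using C(1) by (intro mult_mono I K) (auto simp: E_def)
    also have "\<dots> = M * (q powr Re \<nu> * exp (Re z - Re Z))"
      unfolding M_def exp_diff by (simp add: field_simps)
    also have "Re z - Re Z = - (2 * c * Re b)" by (simp add: z_def Z_def algebra_simps)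
    also have "M * (q powr Re \<nu> * exp (- (2 * c * Re b))) \<le> M * (q powr Re \<nu> * exp (- (2 * c * d)))"
      using ab c C(1) R by (intro mult_left_mono) (auto simp: M_def E_def rint_nonneg)
    finally have "norm (Bessel_I \<nu> z) * norm (Bessel_K \<nu> Z) \<le> M * (q powr Re \<nu> * exp (- (2 * c * d)))" .
    then have "real (sum_squares_reps k (Suc n)) * (norm (Bessel_I \<nu> z) * norm (Bessel_K \<nu> Z)) \<le>
      real (sum_squares_reps k (Suc n)) * (M * (q powr Re \<nu> * exp (- (2 * c * d))))" by (intro mult_left_mono) auto
    then show ?thesis
      unfolding lterm_def h_def q_def[symmetric] c_def[symmetric] z_def[symmetric] Z_def[symmetric] norm_mult norm_of_nat
      by (simp add: c_def mult_ac)
  qed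
  moreover have "summable h" unfolding h_def by (rule summable_reps_exp) (use d in simp)
  then have "summable (\<lambda>n. M * h (Suc n))" by (intro summable_mult) (simp add: summable_Suc_iff)
  ultimately show ?thesis by blast
qed

lemma Re_shroot_ge:
  assumes a: "Re a > 0" "norm a \<le> R" and n: "2 * R\<^sup>2 \<le> real n" "1 \<le> n"
  shows "sqrt (1 + real n) / 2 \<le> Re (shroot a n)"
proof -
  let ?A = "shroot a n"
  have "\<bar>Re (a\<^sup>2)\<bar> \<le> norm (a\<^sup>2)" by (rule abs_Re_le_cmod)
  also have "\<dots> \<le> R\<^sup>2" using a by (simp add: norm_power power_mono)
  finally have "real n - R\<^sup>2 \<le> Re (?A ^ 2)" by (simp add: shroot_sq)
  also have "Re (?A ^ 2) = (Re ?A)\<^sup>2 - (Im ?A)\<^sup>2" by (simp add: power2_eq_square)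
  finally have "real n / 2 \<le> (Re ?A)\<^sup>2" using n zero_le_power2[of "Im ?A"] by linarith
  then have "(1 + real n) / 4 \<le> (Re ?A)\<^sup>2" using n by simp
  then have "sqrt ((1 + real n) / 4) \<le> sqrt ((Re ?A)\<^sup>2)" by (rule real_sqrt_le_mono)
  also have "sqrt ((Re ?A)\<^sup>2) = Re ?A" using Re_shroot_pos[OF a(1), of n] by simp
  finally show ?thesis by (simp add: real_sqrt_divide)
qed

text \<open>
  Both roots grow like \<open>sqrt n\<close> and their ratio \<open>q\<close> decays like \<open>1 / n\<close>, as
  \<open>q = (a\<^sup>2 - b\<^sup>2) / (A + D)\<^sup>2\<close>. So the hypergeometric factor stays bounded and the term is
  \<open>r\<^sub>k(n)\<close> times a power of \<open>n\<close> with exponent \<open>- k / 2 - Re \<nu>\<close>.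
\<close>

lemma rterm_bound:
  assumes R: "R > 0" and nu: "Re \<nu> > 0" and k: "k \<ge> 2"
  shows "\<exists>N g. summable g \<and> (\<forall>n\<ge>N. \<forall>a b. norm a \<le> R \<longrightarrow> norm b \<le> R \<longrightarrow> 0 < Re b \<longrightarrow> Re b \<le> Re a \<longrightarrow>
     norm (rterm k \<nu> n a b) \<le> g n)"
proof -
  let ?F = "hyp2f1 (\<nu> + 1 - of_nat k / 2) (1 - of_nat k / 2) (\<nu> + 1)"
  have "continuous_on (cball 0 (1/4)) ?F"
    by (rule holomorphic_on_imp_continuous_on, rule holomorphic_on_subset[OF hyp2f1_holomorphic])
       (use nu k in \<open>auto simp: norm_mult\<close>)
  then have "compact (?F ` cball 0 (1/4))" by (intro compact_continuous_image) auto
  then obtain H where H: "H > 0" "\<And>z. z \<in> cball 0 (1/4) \<Longrightarrow> norm (?F z) \<le> H"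
    using compact_imp_bounded bounded_pos by (metis imageI)
  obtain N0 :: nat where N0: "4 * R\<^sup>2 \<le> real N0" using real_arch_simple by blast
  define E where "E = exp (pi * \<bar>Im \<nu>\<bar>)"
  define M where "M = 4 * (2 * R\<^sup>2) powr Re \<nu> * E * 4 ^ (k - 2) * H"
  define h where "h = (\<lambda>n. real (sum_squares_reps k n) * (1 + real n) powr (- (real k / 2 + Re \<nu>)))"
  have "norm (rterm k \<nu> n a b) \<le> M * h n"
    if n: "n \<ge> Suc N0" and ab: "norm a \<le> R" "norm b \<le> R" "0 < Re b" "Re b \<le> Re a" for n a b
  proof -
    let ?A = "shroot a n" and ?D = "shroot b n"
    define t where "t = 1 + real n"
    have n': "2 * R\<^sup>2 \<le> real n" "1 \<le> n" "4 * R\<^sup>2 \<le> t" using n N0 zero_le_power2[of R] by (auto simp: t_def)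
    have t: "t > 0" "sqrt t > 0" by (auto simp: t_def)
    have A: "sqrt t / 2 \<le> Re ?A" "sqrt t / 2 \<le> Re ?D"
      unfolding t_def using Re_shroot_ge n' ab by auto
    then have nA: "sqrt t / 2 \<le> norm ?A" "sqrt t / 2 \<le> norm ?D" "sqrt t \<le> norm (?A + ?D)"
      using complex_Re_le_cmod[of ?A] complex_Re_le_cmod[of ?D] complex_Re_le_cmod[of "?A + ?D"] by auto
    have nz: "?A \<noteq> 0" "?D \<noteq> 0" "?A + ?D \<noteq> 0" using nA t by auto
    have "t / 4 = (sqrt t / 2) * (sqrt t / 2)" using t by simp
    also have "\<dots> \<le> norm ?A * norm ?D" using nA t by (intro mult_mono) auto
    finally have 1: "norm (1 / (?A * ?D)) \<le> 4 / t" using t nz by (simp add: norm_divide norm_mult field_simps)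
    have "norm (1 / ?A) \<le> 2 / sqrt t" "norm (1 / ?D) \<le> 2 / sqrt t"
      using nA t nz by (simp_all add: norm_divide field_simps)
    then have "norm (1 / ?A + 1 / ?D) \<le> 4 / sqrt t" using norm_triangle_ineq[of "1 / ?A" "1 / ?D"] by simp
    then have 2: "norm (1 / ?A + 1 / ?D) ^ (k - 2) \<le> (4 / sqrt t) ^ (k - 2)" by (intro power_mono) auto
    have "(?A - ?D) * (?A + ?D) = ?A\<^sup>2 - ?D\<^sup>2" by (simp add: algebra_simps power2_eq_square)
    also have "\<dots> = a\<^sup>2 - b\<^sup>2" by (simp add: shroot_sq)
    finally have "(?A - ?D) * (?A + ?D) = a\<^sup>2 - b\<^sup>2" .
    moreover have "qratio a b n = ((?A - ?D) * (?A + ?D)) / (?A + ?D)\<^sup>2" using nz by (simp add: qratio_def power2_eq_square)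
    ultimately have "qratio a b n = (a\<^sup>2 - b\<^sup>2) / (?A + ?D)\<^sup>2" by simp
    then have "norm (qratio a b n) = norm (a\<^sup>2 - b\<^sup>2) / norm (?A + ?D) ^ 2" by (simp add: norm_divide norm_power)
    also have "\<dots> \<le> (2 * R\<^sup>2) / sqrt t ^ 2"
    proof (intro frac_le)
      show "norm (a\<^sup>2 - b\<^sup>2) \<le> 2 * R\<^sup>2"
        using norm_triangle_ineq4[of "a\<^sup>2" "b\<^sup>2"] power_mono[OF ab(1), of 2] power_mono[OF ab(2), of 2] by (simp add: norm_power)
      show "sqrt t ^ 2 \<le> norm (?A + ?D) ^ 2" using nA t by (intro power_mono) auto
    qed (use t in auto)
    finally have q: "norm (qratio a b n) \<le> 2 * R\<^sup>2 / t" using t by simp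
    also have "\<dots> \<le> 1 / 2" using n' t by (simp add: field_simps)
    finally have "norm (qratio a b n) \<le> 1 / 2" .
    then have "norm (qratio a b n ^ 2) \<le> (1 / 2) ^ 2" unfolding norm_power by (intro power_mono) auto
    then have 3: "norm (?F (qratio a b n ^ 2)) \<le> H" by (intro H(2)) (simp add: power2_eq_square)
    have "norm (qratio a b n powr \<nu>) \<le> norm (qratio a b n) powr Re \<nu> * E" unfolding E_def by (rule norm_powr_le)
    also have "\<dots> \<le> (2 * R\<^sup>2 / t) powr Re \<nu> * E" using q nu by (intro mult_right_mono powr_mono2) (auto simp: E_def)
    finally have 4: "norm (qratio a b n powr \<nu>) \<le> (2 * R\<^sup>2 / t) powr Re \<nu> * E" .
    have "norm (rterm k \<nu> n a b) = real (sum_squares_reps k n) *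
        (norm (1 / (?A * ?D)) * norm (qratio a b n powr \<nu>) * norm (1 / ?A + 1 / ?D) ^ (k - 2) * norm (?F (qratio a b n ^ 2)))"
      unfolding rterm_def by (simp add: norm_mult norm_divide norm_power)
    also have "\<dots> \<le> real (sum_squares_reps k n) * ((4 / t) * ((2 * R\<^sup>2 / t) powr Re \<nu> * E) * (4 / sqrt t) ^ (k - 2) * H)"
      using t by (intro mult_left_mono mult_mono 1 2 3 4) (auto simp: E_def)
    also have "\<dots> = M * h n"
    proof -
      have "sqrt t ^ (k - 2) = t powr (real (k - 2) / 2)"
        using t by (simp add: powr_half_sqrt[symmetric] powr_powr flip: powr_realpow)
      then have "t * t powr Re \<nu> * sqrt t ^ (k - 2) = t powr 1 * t powr Re \<nu> * t powr (real (k - 2) / 2)" using t by simp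
      also have "\<dots> = t powr (real k / 2 + Re \<nu>)"
        unfolding powr_add[symmetric] using k by (simp add: of_nat_diff field_simps)
      finally have e: "t powr (- (real k / 2 + Re \<nu>)) = 1 / (t * t powr Re \<nu> * sqrt t ^ (k - 2))"
        by (simp only: powr_minus_divide)
      show ?thesis
        unfolding M_def h_def t_def[symmetric] e using R t by (simp add: powr_divide power_divide)
    qed
    finally show ?thesis .
  qed
  moreover have "summable (\<lambda>n. M * h n)" unfolding h_def by (intro summable_mult summable_reps_powr nu)
  ultimately show ?thesis by blast
qed

section \<open>Continuation in the parameters\<close>

lemma sums_dominated_locally:
  assumes con: "continuous_on S f" "continuous_on S g" and nu: "Re \<nu> > 0" and k: "k \<ge> 2"
    and fg: "\<And>w. w \<in> S \<Longrightarrow> Re (f w) \<ge> Re (g w) \<and> Re (g w) > 0" and z: "z \<in> S"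
  shows "\<exists>r>0. \<exists>N h. summable h \<and> (\<forall>n\<ge>N. \<forall>w\<in>S. dist w z \<le> r \<longrightarrow> norm (lterm k \<nu> (Suc n) (f w) (g w)) \<le> h n)"
    "\<exists>r>0. \<exists>N h. summable h \<and> (\<forall>n\<ge>N. \<forall>w\<in>S. dist w z \<le> r \<longrightarrow> norm (rterm k \<nu> n (f w) (g w)) \<le> h n)"
proof -
  \<comment> \<open>Near \<open>z\<close> the parameters move by less than \<open>d\<close>, so \<open>Re (g w)\<close> stays at least \<open>d\<close> and both norms stay at most \<open>R\<close>.\<close>
  define d where "d = min (Re (g z) / 2) 1"
  define R where "R = norm (f z) + norm (g z) + 1"
  have d: "d > 0" "2 * d \<le> Re (g z)" "d \<le> 1" using fg[OF z] by (auto simp: d_def)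
  have R: "R > 0" unfolding R_def by (intro add_nonneg_pos) auto
  have R1: "R \<ge> 1" unfolding R_def by simp
  obtain r1 where r1: "r1 > 0" "\<And>w. w \<in> S \<Longrightarrow> dist w z < r1 \<Longrightarrow> dist (f w) (f z) < d"
    using con(1) z d(1) unfolding continuous_on_iff by blast
  obtain r2 where r2: "r2 > 0" "\<And>w. w \<in> S \<Longrightarrow> dist w z < r2 \<Longrightarrow> dist (g w) (g z) < d"
    using con(2) z d(1) unfolding continuous_on_iff by blast
  obtain h1 where h1: "summable h1" "\<And>n a b. norm a \<le> R \<Longrightarrow> norm b \<le> R \<Longrightarrow> d \<le> Re b \<Longrightarrow> Re b \<le> Re a \<Longrightarrow>
     norm (lterm k \<nu> (Suc n) a b) \<le> h1 n"
    using lterm_bound[OF R d(1) nu, of k] by blast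
  obtain N h2 where h2: "summable h2" "\<And>n a b. N \<le> n \<Longrightarrow> norm a \<le> R \<Longrightarrow> norm b \<le> R \<Longrightarrow> 0 < Re b \<Longrightarrow> Re b \<le> Re a \<Longrightarrow>
     norm (rterm k \<nu> n a b) \<le> h2 n"
    using rterm_bound[OF R nu k] by blast
  have *: "norm (lterm k \<nu> (Suc n) (f w) (g w)) \<le> h1 n \<and> (N \<le> n \<longrightarrow> norm (rterm k \<nu> n (f w) (g w)) \<le> h2 n)"
    if w: "w \<in> S" "dist w z \<le> min r1 r2 / 2" for n w
  proof -
    have "dist w z < r1" "dist w z < r2" using w(2) r1(1) r2(1) by linarith+
    then have df: "norm (f w - f z) < d" "norm (g w - g z) < d" using r1(2) r2(2) w(1) by (auto simp: dist_norm)
    have "norm (f w) \<le> norm (f z) + norm (f w - f z)" "norm (g w) \<le> norm (g z) + norm (g w - g z)"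
      using norm_triangle_ineq[of "f z" "f w - f z"] norm_triangle_ineq[of "g z" "g w - g z"] by simp_all
    then have nR: "norm (f w) \<le> R" "norm (g w) \<le> R" using df d norm_ge_zero[of "f z"] norm_ge_zero[of "g z"] unfolding R_def by linarith+
    have "\<bar>Re (g w - g z)\<bar> \<le> norm (g w - g z)" by (rule abs_Re_le_cmod)
    then have "Re (g w) \<ge> d" using df d by simp
    then show ?thesis using h1(2)[of "f w" "g w" n] h2(2)[of n "f w" "g w"] nR fg[OF w(1)] by blast
  qed
  have r: "min r1 r2 / 2 > 0" using r1(1) r2(1) by simp
  show "\<exists>r>0. \<exists>N h. summable h \<and> (\<forall>n\<ge>N. \<forall>w\<in>S. dist w z \<le> r \<longrightarrow> norm (lterm k \<nu> (Suc n) (f w) (g w)) \<le> h n)"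
    using * h1(1) r by blast
  show "\<exists>r>0. \<exists>N h. summable h \<and> (\<forall>n\<ge>N. \<forall>w\<in>S. dist w z \<le> r \<longrightarrow> norm (rterm k \<nu> n (f w) (g w)) \<le> h n)"
    using * h2(1) r by blast
qed

lemma summable_terms:
  assumes nu: "Re \<nu> > 0" and k: "k \<ge> 2" and ab: "Re a \<ge> Re b" "Re b > 0"
  shows "summable (\<lambda>n. lterm k \<nu> (Suc n) a b)" "summable (\<lambda>n. rterm k \<nu> n a b)"
proof -
  have "norm b > 0" using ab by auto
  then have b: "0 < Re b" "0 < norm a + norm b" using ab by (auto intro: add_nonneg_pos)
  obtain g where g: "summable g" "\<forall>n c d. norm c \<le> norm a + norm b \<longrightarrow> norm d \<le> norm a + norm b \<longrightarrow> Re b \<le> Re d \<longrightarrow> Re d \<le> Re c \<longrightarrow>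
     norm (lterm k \<nu> (Suc n) c d) \<le> g n" using lterm_bound[OF b(2,1) nu] by blast
  then show "summable (\<lambda>n. lterm k \<nu> (Suc n) a b)"
    by (intro summable_comparison_test[OF _ g(1)]) (use ab in auto)
  obtain N h where h: "summable h" "\<forall>n\<ge>N. \<forall>c d. norm c \<le> norm a + norm b \<longrightarrow> norm d \<le> norm a + norm b \<longrightarrow> 0 < Re d \<longrightarrow> Re d \<le> Re c \<longrightarrow>
     norm (rterm k \<nu> n c d) \<le> h n" using rterm_bound[OF b(2) nu k] by blast
  then show "summable (\<lambda>n. rterm k \<nu> n a b)"
    by (intro summable_comparison_test[OF _ h(1)] exI[of _ N]) (use ab in auto)
qed

definition rside :: "nat \<Rightarrow> complex \<Rightarrow> complex \<Rightarrow> complex \<Rightarrow> complex" where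
  "rside k \<nu> a b = rconst k \<nu> * (\<Sum>n. rterm k \<nu> n a b) - qratio a b 0 powr \<nu> / (2 * \<nu>)"

definition lside :: "nat \<Rightarrow> complex \<Rightarrow> complex \<Rightarrow> complex \<Rightarrow> complex" where
  "lside k \<nu> a b = (\<Sum>n. lterm k \<nu> (Suc n) a b)"

lemma sides_holomorphic:
  assumes S: "f holomorphic_on S" "g holomorphic_on S" "open S" and nu: "Re \<nu> > 0" and k: "k \<ge> 2"
    and fg: "\<And>w. w \<in> S \<Longrightarrow> Re (f w) \<ge> Re (g w) \<and> Re (g w) > 0 \<and> f w \<noteq> g w"
  shows "(\<lambda>w. lside k \<nu> (f w) (g w)) holomorphic_on S" "(\<lambda>w. rside k \<nu> (f w) (g w)) holomorphic_on S"
proof -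
  have con: "continuous_on S f" "continuous_on S g" using S by (auto intro: holomorphic_on_imp_continuous_on)
  have k0: "k > 0" and nu0: "\<nu> \<noteq> 0" using k nu by auto
  have fg': "Re (f w) \<ge> Re (g w) \<and> Re (g w) > 0" if "w \<in> S" for w using fg[OF that] by blast
  note dom = sums_dominated_locally[OF con nu k fg']
  show "(\<lambda>w. lside k \<nu> (f w) (g w)) holomorphic_on S" unfolding lside_def
    by (rule holomorphic_suminf[OF S(3) lterm_holomorphic[OF S(1,2) fg] dom(1)])
  have "(\<lambda>w. \<Sum>n. rterm k \<nu> n (f w) (g w)) holomorphic_on S"
    by (rule holomorphic_suminf[OF S(3) rterm_holomorphic(1)[OF S(1,2) nu k0 fg] dom(2)])
  then show "(\<lambda>w. rside k \<nu> (f w) (g w)) holomorphic_on S" unfolding rside_def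
    by (intro holomorphic_on_diff holomorphic_on_mult holomorphic_on_divide holomorphic_on_const rterm_holomorphic(2)[OF S(1,2) nu k0 fg]) (use nu0 in auto)
qed

lemma sides_continuous:
  assumes S: "f holomorphic_on S" "g holomorphic_on S" and nu: "Re \<nu> > 0" and k: "k \<ge> 2"
    and fg: "\<And>w. w \<in> S \<Longrightarrow> Re (f w) \<ge> Re (g w) \<and> Re (g w) > 0 \<and> f w \<noteq> g w"
  shows "continuous_on S (\<lambda>w. lside k \<nu> (f w) (g w))" "continuous_on S (\<lambda>w. rside k \<nu> (f w) (g w))"
proof -
  have con: "continuous_on S f" "continuous_on S g" using S by (auto intro: holomorphic_on_imp_continuous_on)
  have k0: "k > 0" and nu0: "\<nu> \<noteq> 0" using k nu by auto
  have fg': "Re (f w) \<ge> Re (g w) \<and> Re (g w) > 0" if "w \<in> S" for w using fg[OF that] by blast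
  note dom = sums_dominated_locally[OF con nu k fg']
  show "continuous_on S (\<lambda>w. lside k \<nu> (f w) (g w))" unfolding lside_def
    by (rule continuous_on_suminf[OF holomorphic_on_imp_continuous_on[OF lterm_holomorphic[OF S(1,2) fg]] dom(1)])
  have "continuous_on S (\<lambda>w. \<Sum>n. rterm k \<nu> n (f w) (g w))"
    by (rule continuous_on_suminf[OF holomorphic_on_imp_continuous_on[OF rterm_holomorphic(1)[OF S(1,2) nu k0 fg]] dom(2)])
  then show "continuous_on S (\<lambda>w. rside k \<nu> (f w) (g w))" unfolding rside_def
    by (intro continuous_on_diff continuous_on_mult continuous_on_divide continuous_on_const
          holomorphic_on_imp_continuous_on[OF rterm_holomorphic(2)[OF S(1,2) nu k0 fg]]) (use nu0 in auto)
qed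

lemma sides_eq_near_diagonal:
  assumes k: "k \<ge> 2" and b: "b > 0" and ab: "b < a" and nu: "Re \<nu> > 0"
    and B: "norm \<nu> + real k \<le> B" "1 \<le> B" and a: "a < b + b / (4 * B)"
  shows "lside k \<nu> (of_real a) (of_real b) = rside k \<nu> (of_real a) (of_real b)"
proof -
  have "4 * B * (a - b) < b" using a B by (simp add: field_simps)
  then have "4 * B * (a - b) < a + b" using b ab by linarith
  then have "(4 * B * (a - b))\<^sup>2 < (a + b)\<^sup>2" using b ab B by (intro power_strict_mono) auto
  then have r: "16 * B\<^sup>2 * ((a - b) / (a + b))\<^sup>2 < 1"
    using b ab by (simp add: power_mult_distrib power_divide)
  obtain T where T: "(\<lambda>n. rconst k \<nu> * rterm k \<nu> n (of_real a) (of_real b)) sums T"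
     "(\<lambda>n. lterm k \<nu> (Suc n) (of_real a) (of_real b)) sums (T - of_real ((a - b) / (a + b)) powr \<nu> / (2 * \<nu>))"
    using bessel_sum_identity_real[OF k b ab nu B r] by blast
  have "summable (\<lambda>n. rterm k \<nu> n (of_real a) (of_real b))"
    by (rule summable_terms(2)[OF nu k]) (use b ab in auto)
  then have "rconst k \<nu> * (\<Sum>n. rterm k \<nu> n (of_real a) (of_real b)) = T"
    using sums_unique[OF T(1)] by (simp add: suminf_mult)
  moreover have "qratio (of_real a) (of_real b) 0 = of_real ((a - b) / (a + b))"
    unfolding qratio_def using b ab by (simp add: shroot_0)
  ultimately show ?thesis using sums_unique[OF T(2)] unfolding lside_def rside_def by simp
qed

text \<open>
  Continuation in \<open>a\<close> from the interval to the right of \<open>b\<close> on which the condition of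
  \<open>bessel_sum_identity_real\<close> holds.
\<close>

lemma sides_eq_real:
  assumes k: "k \<ge> 2" and nu: "Re \<nu> > 0" and b: "b > 0" and a: "Re a > b"
  shows "lside k \<nu> a (of_real b) = rside k \<nu> a (of_real b)"
proof -
  define B where "B = norm \<nu> + real k + 1"
  have B: "norm \<nu> + real k \<le> B" "1 \<le> B" by (auto simp: B_def)
  let ?S = "{a. Re a > b}"
  have S: "open ?S" by (rule open_halfspace_Re_gt)
  have "Re w \<ge> Re (complex_of_real b) \<and> Re (complex_of_real b) > 0 \<and> w \<noteq> of_real b" if "w \<in> ?S" for w
    using that b by auto
  note H = sides_holomorphic[where f = "\<lambda>a. a" and g = "\<lambda>_. of_real b", OF holomorphic_on_ident holomorphic_on_const S nu k this]
  show ?thesis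
  proof (rule holomorphic_eq_from_reals[of "\<lambda>a. lside k \<nu> a (of_real b)" ?S "\<lambda>a. rside k \<nu> a (of_real b)" b "b + b / (4 * B)"])
    show "connected ?S" by (intro convex_connected convex_halfspace_Re_gt)
    show "b < b + b / (4 * B)" using b B by simp
    show "lside k \<nu> (of_real x) (of_real b) = rside k \<nu> (of_real x) (of_real b)" if "b < x" "x < b + b / (4 * B)" for x
      by (rule sides_eq_near_diagonal[OF k b that(1) nu B that(2)])
    show "of_real ` {b<..<b + b / (4 * B)} \<subseteq> ?S" "a \<in> ?S" using a by auto
    show "open ?S" by (rule S)
    show "(\<lambda>a. lside k \<nu> a (of_real b)) holomorphic_on ?S" by (rule H(1))
    show "(\<lambda>a. rside k \<nu> a (of_real b)) holomorphic_on ?S" by (rule H(2))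
  qed
qed

text \<open>
  Continuation in \<open>b\<close>, from the real points of the strip.
\<close>

lemma sides_eq_open:
  assumes k: "k \<ge> 2" and nu: "Re \<nu> > 0" and b: "Re b > 0" and ab: "Re a > Re b"
  shows "lside k \<nu> a b = rside k \<nu> a b"
proof -
  let ?S = "{b. 0 < Re b} \<inter> {b. Re b < Re a}"
  note H = sides_holomorphic[of "\<lambda>_. a" ?S "\<lambda>b. b" \<nu> k, OF _ _ _ nu k]
  show ?thesis
  proof (rule holomorphic_eq_from_reals[of "lside k \<nu> a" ?S "rside k \<nu> a" 0 "Re a"])
    show "connected ?S" by (intro convex_connected convex_Int convex_halfspace_Re_gt convex_halfspace_Re_lt)
    show "open ?S" by (intro open_Int open_halfspace_Re_gt open_halfspace_Re_lt)
    then show "lside k \<nu> a holomorphic_on ?S" "rside k \<nu> a holomorphic_on ?S"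
      by (intro H; force intro!: holomorphic_intros)+
    show "lside k \<nu> a (of_real x) = rside k \<nu> a (of_real x)" if "0 < x" "x < Re a" for x
      by (rule sides_eq_real[OF k nu that])
  qed (use ab b in auto)
qed

text \<open>
  On the boundary \<open>Re a = Re b\<close>, approach \<open>a\<close> from the right. For \<open>a = b\<close> every term vanishes, as
  \<open>I\<^sub>\<nu>(0) = 0\<close> and all ratios are 0.
\<close>

theorem sides_eq:
  assumes k: "k \<ge> 2" and nu: "Re \<nu> > 0" and b: "Re b > 0" and ab: "Re a \<ge> Re b"
  shows "lside k \<nu> a b = rside k \<nu> a b"
proof (cases "a = b")
  case True
  have nu0: "\<nu> \<noteq> 0" using nu by auto
  then show ?thesis
    unfolding True lside_def rside_def lterm_def rterm_def qratio_def Bessel_I_def by simp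
next
  case False
  let ?S = "{w. Im w = 0 \<and> Re w \<ge> 0}"
  have ne: "a + w \<noteq> b" if "w \<in> ?S" for w
  proof
    assume "a + w = b"
    then have "Re a + Re w = Re b" by (metis plus_complex.simps(1))
    then have "Re w = 0" using ab that by simp
    then have "w = 0" using that by (simp add: complex_eq_iff)
    then show False using \<open>a + w = b\<close> False by simp
  qed
  have con: "continuous_on ?S (\<lambda>w. lside k \<nu> (a + w) b)" "continuous_on ?S (\<lambda>w. rside k \<nu> (a + w) b)"
    by (rule sides_continuous[where f = "\<lambda>w. a + w" and g = "\<lambda>_. b", OF _ _ nu k]; use ne b ab in \<open>force intro!: holomorphic_intros\<close>)+
  define X where "X = (\<lambda>n. complex_of_real (1 / real (Suc n)))"
  have "(\<lambda>n. 1 / real (Suc n)) \<longlonglongrightarrow> 0" using LIMSEQ_inverse_real_of_nat by (simp add: inverse_eq_divide)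
  then have X: "X \<longlonglongrightarrow> 0" unfolding X_def using tendsto_of_real by (metis of_real_0)
  have XS: "0 \<in> ?S" "eventually (\<lambda>n. X n \<in> ?S) sequentially" by (simp_all add: X_def)
  have "(\<lambda>n. lside k \<nu> (a + X n) b) \<longlonglongrightarrow> lside k \<nu> (a + 0) b" "(\<lambda>n. rside k \<nu> (a + X n) b) \<longlonglongrightarrow> rside k \<nu> (a + 0) b"
    by (rule continuous_on_tendsto_compose[OF con(1) X XS] continuous_on_tendsto_compose[OF con(2) X XS])+
  moreover have "lside k \<nu> (a + X n) b = rside k \<nu> (a + X n) b" for n
  proof (rule sides_eq_open[OF k nu b])
    have "Re (X n) = 1 / real (Suc n)" unfolding X_def by (rule Re_complex_of_real)
    moreover have "1 / real (Suc n) > 0" by simp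
    ultimately show "Re b < Re (a + X n)" using ab unfolding plus_complex.simps by linarith
  qed
  ultimately show ?thesis using LIMSEQ_unique by simp
qed

theorem theorem1p6:
  fixes k :: nat and \<alpha> \<beta> \<nu> :: complex
  assumes "k \<ge> 2"
    and "Re (csqrt \<alpha>) \<ge> Re (csqrt \<beta>)"
    and "Re (csqrt \<beta>) > 0"
    and "Re \<nu> > 0"
  defines "lhs_term \<equiv> \<lambda>n::nat. of_nat (sum_squares_reps k n) *
      Bessel_I \<nu> (of_real pi * (csqrt (of_nat n * \<alpha>) - csqrt (of_nat n * \<beta>))) *
      Bessel_K \<nu> (of_real pi * (csqrt (of_nat n * \<alpha>) + csqrt (of_nat n * \<beta>)))"
    and "q \<equiv> \<lambda>n::nat. (csqrt (of_nat n + \<alpha>) - csqrt (of_nat n + \<beta>)) /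
                      (csqrt (of_nat n + \<alpha>) + csqrt (of_nat n + \<beta>))"
  defines "rhs_term \<equiv> \<lambda>n::nat. of_nat (sum_squares_reps k n) /
      (csqrt (of_nat n + \<alpha>) * csqrt (of_nat n + \<beta>)) *
      q n powr \<nu> *
      (1 / csqrt (of_nat n + \<alpha>) + 1 / csqrt (of_nat n + \<beta>)) ^ (k - 2) *
      hyp2f1 (\<nu> + 1 - of_nat k / 2) (1 - of_nat k / 2) (\<nu> + 1) (q n ^ 2)"
  shows "summable (\<lambda>n. lhs_term (Suc n)) \<and> summable rhs_term \<and>
    (\<Sum>n. lhs_term (Suc n)) =
      - (1 / (2 * \<nu>)) * ((csqrt \<alpha> - csqrt \<beta>) / (csqrt \<alpha> + csqrt \<beta>)) powr \<nu> +
      Gamma (\<nu> + of_nat k / 2) /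
        (of_real (pi powr (real k / 2)) * 2 ^ (k - 1) * Gamma (\<nu> + 1)) *
      (\<Sum>n. rhs_term n)"
proof -
  define a where "a = csqrt \<alpha>"
  define b where "b = csqrt \<beta>"
  have ab: "Re a \<ge> Re b" "Re b > 0" "Re a > 0" using assms(2,3) by (auto simp: a_def b_def simp del: csqrt.simps)
  \<comment> \<open>The principal root is multiplicative here because the product of the roots stays in the right half-plane (or is 0).\<close>
  have sc: "csqrt (of_nat n * z) = of_real (sqrt (real n)) * csqrt z" if "Re (csqrt z) > 0" for n z
  proof (rule csqrt_unique)
    show "(of_real (sqrt (real n)) * csqrt z)\<^sup>2 = of_nat n * z"
      by (simp add: power_mult_distrib flip: of_real_power)
    show "0 < Re (of_real (sqrt (real n)) * csqrt z) \<or> Re (of_real (sqrt (real n)) * csqrt z) = 0 \<and> 0 \<le> Im (of_real (sqrt (real n)) * csqrt z)"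
      using that by (cases "n = 0") (auto simp del: csqrt.simps)
  qed
  have sc': "csqrt (of_nat n * \<alpha>) = of_real (sqrt (real n)) * a" "csqrt (of_nat n * \<beta>) = of_real (sqrt (real n)) * b" for n
    unfolding a_def b_def by (rule sc; use ab in \<open>simp add: a_def b_def del: csqrt.simps\<close>)+
  have l: "lhs_term = (\<lambda>n. lterm k \<nu> n a b)"
    unfolding lhs_term_def lterm_def sc' of_real_mult by (simp only: mult.assoc distrib_left right_diff_distrib)
  have q: "q = qratio a b" unfolding q_def qratio_def shroot_def a_def b_def by (simp add: fun_eq_iff)
  have r: "rhs_term = (\<lambda>n. rterm k \<nu> n a b)"
    unfolding rhs_term_def rterm_def q shroot_def a_def b_def by simp
  have "qratio a b 0 = (csqrt \<alpha> - csqrt \<beta>) / (csqrt \<alpha> + csqrt \<beta>)"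
    unfolding q[symmetric] q_def by simp
  then show ?thesis
    using summable_terms[OF assms(4,1) ab(1,2)] sides_eq[OF assms(1,4) ab(2,1)]
    unfolding l r lside_def rside_def rconst_def by simp
qed

end
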